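(* Let $f\in M^!_{k,\rho}$ and $F\in\mathcal H_{2-k,\overline\rho}$ with $\xi_{2-k}(F)=f$. The map $\sigma:\mathrm{SL}_2(\mathbb{Z})\to D_{2-k,\overline\rho}$, $\sigma(M):=(-2i)^{k+1}\pi\,F^+|_{2-k,\overline\rho}(M-I)$, is a parabolic cocycle and hence induces a cohomology class in $H^1_{\mathrm{par}}(\mathrm{SL}_2(\mathbb{Z}),D_{2-k,\overline\rho})$.
   Context: Let $k\in-\frac12\mathbb{N}_0$; $\mathrm{Mp}_2(\mathbb{Z})$ the pairs $(M,\phi)$, $M=\left(\begin{smallmatrix}a&b\\c&d\end{smallmatrix}\right)\in\mathrm{SL}_2(\mathbb{Z})$, $\phi$ holomorphic, $\phi^2=c\tau+d$. $\rho:\mathrm{Mp}_2(\mathbb{Z})\to\mathbb{C}^\times$ a unitary character factoring through a finite quotient with $\rho((I,-1))=(-1)^{2k}$. Slash $(h|_{\kappa,\rho}(M,\phi))(\tau)=\phi(\tau)^{-2\kappa}\rho((M,\phi))^{-1}h(M\tau)$, depending only on $M$, giving an action of $\mathrm{SL}_2(\mathbb{Z})$ extended linearly to the group ring. $M^!_{k,\rho}$: weakly holomorphic modular forms (holomorphic, invariant under $|_{k,\rho}$, $O(e^{Cv})$). $\mathcal H_{2-k,\overline\rho}$: harmonic Maass forms ($C^2$, invariant under $|_{2-k,\overline\rho}$, $O(e^{Cv})$, annihilated by $-v^2(\partial_u^2+\partial_v^2)+i(2-k)v(\partial_u+i\partial_v)$); $F=F^++F^-$, $F^+=\sum_nc_F^+(n)e^{2\pi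 in\tau}$, $F^-=c_F^-(0)v^{k-1}+\sum_{n\ne0}c_F^-(n)W_{2-k}(2\pi nv)e^{2\pi in\tau}$, $W_\kappa(x)=(-2x)^{1-\kappa}\Re(E_\kappa(-2x))$, $E_\kappa(z)=\int_1^\infty e^{-zt}t^{-\kappa}dt$ continued principally (boundary values from above on the negative axis); $\xi_{2-k}F=2iv^{2-k}\overline{\partial F/\partial\bar\tau}$. $D_{2-k,\overline\rho}$: for a cusp $\mathfrak a=M(i\infty)$ and $a,\varepsilon>0$ let $V_{\mathfrak a}(a,\varepsilon)=\{M\tau:\Im\tau<-\varepsilon,|\Re\tau|\le a\}$; for finite $E\subset\mathbb{P}^1(\mathbb{Q})$, an $E$-excised neighbourhood is a set $\Omega\subset\mathbb{P}^1(\mathbb{C})$ containing $U\setminus\bigcup_{\mathfrak a\in E}V_{\mathfrak a}(a_{\mathfrak a},\varepsilon_{\mathfrak a})$ for some open neighbourhood $U$ of $\mathbb{H}\cup\mathbb{P}^1(\mathbb{R})$; $D_{2-k,\overline\rho}[E]$ consists of germs of functions $h$ on open $E$-excised neighbourhoods $\Omega\not\ni-i$ with $(i+\tau)^{2-k}h(\tau)$ holomorphic on $\Omega$, and $D_{2-k,\overline\rho}=\bigcup_E D_{2-k,\overline\rho}[E]$; $\mathrm{SL}_2(\mathbb{Z})$ acts on it by the weight $2-k$ slash operator $|_{2-k,\overline\rho}$ (extended to such domains). With $T=\left(\begin{smallmatrix}1&1\\0&1\end{smallmatrix}\right)$: $Z^1_{\mathrm{par}}$ is the set of maps $\phi:\mathrm{SL}_2(\mathbb{Z})\to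 D_{2-k,\overline\rho}$ with $\phi(M_1M_2)=\phi(M_1)|_{2-k,\overline\rho}M_2+\phi(M_2)$ and $\phi(T)\in D_{2-k,\overline\rho}|_{2-k,\overline\rho}(T-I)$; $B^1$ is the set of maps $M\mapsto a|_{2-k,\overline\rho}(M-I)$ with $a\in D_{2-k,\overline\rho}$; $H^1_{\mathrm{par}}=Z^1_{\mathrm{par}}/B^1$.
   Formalization: In an E-excised neighbourhood each cusp in E is removed along with its set V; read literally, open excised neighbourhoods contain the cusps and the claim fails (k=0, F=E_2-3/(πv): σ(S) is a multiple of 1/τ, singular at the cusp 0). *)

theory Defs
  imports "HOL-Complex_Analysis.Complex_Analysis" "HOL-Algebra.Coset" "HOL-Library.Landau_Symbols"
begin

no_notation fps_nth (infixl \<open>$\<close> 75)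

section \<open>The groups $\mathrm{SL}_2(\mathbb{Z})$ and $\mathrm{Mp}_2(\mathbb{Z})$\<close>

typedef sl2z = "{M :: int^2^2. det M = 1}"
  morphisms sl2z_mat Abs_sl2z
  by (rule exI[of _ "mat 1"]) simp

setup_lifting type_definition_sl2z

instantiation sl2z :: monoid_mult
begin
lift_definition one_sl2z :: sl2z is "mat 1" by simp
lift_definition times_sl2z :: "sl2z \<Rightarrow> sl2z \<Rightarrow> sl2z" is "(**)" by (simp add: det_mul)
instance by standard (transfer; simp add: matrix_mul_assoc)+
end

abbreviation ea :: "sl2z \<Rightarrow> int" where "ea M \<equiv> sl2z_mat M $ 1 $ 1"
abbreviation eb :: "sl2z \<Rightarrow> int" where "eb M \<equiv> sl2z_mat M $ 1 $ 2"
abbreviation ec :: "sl2z \<Rightarrow> int" where "ec M \<equiv> sl2z_mat M $ 2 $ 1"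
abbreviation ed :: "sl2z \<Rightarrow> int" where "ed M \<equiv> sl2z_mat M $ 2 $ 2"

lift_definition sl2z_inv :: "sl2z \<Rightarrow> sl2z" is
  "\<lambda>M. vector [vector [M $ 2 $ 2, - (M $ 1 $ 2)], vector [- (M $ 2 $ 1), M $ 1 $ 1]]"
  by (simp add: det_2 algebra_simps)

lift_definition sl2z_T :: sl2z is "vector [vector [1, 1], vector [0, 1]]"
  by (simp add: det_2)

lemma sl2z_det: "ea M * ed M - eb M * ec M = 1"
  by transfer (simp add: det_2)

lemma sl2z_eqI: "ea M = ea N \<Longrightarrow> eb M = eb N \<Longrightarrow> ec M = ec N \<Longrightarrow> ed M = ed N \<Longrightarrow> M = N"
  by (simp add: sl2z_mat_inject[symmetric] vec_eq_iff forall_2)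

lemma sl2z_entries_times [simp]:
  "ea (M * N) = ea M * ea N + eb M * ec N" "eb (M * N) = ea M * eb N + eb M * ed N"
  "ec (M * N) = ec M * ea N + ed M * ec N" "ed (M * N) = ec M * eb N + ed M * ed N"
  by (simp_all add: times_sl2z.rep_eq matrix_matrix_mult_def sum_2)

lemma sl2z_entries_one [simp]: "ea 1 = 1" "eb 1 = 0" "ec 1 = 0" "ed 1 = 1"
  by (simp_all add: one_sl2z.rep_eq mat_def)

lemma sl2z_entries_T [simp]: "ea sl2z_T = 1" "eb sl2z_T = 1" "ec sl2z_T = 0" "ed sl2z_T = 1"
  by (simp_all add: sl2z_T.rep_eq)

lemma sl2z_entries_inv [simp]:
  "ea (sl2z_inv M) = ed M" "eb (sl2z_inv M) = - eb M" "ec (sl2z_inv M) = - ec M" "ed (sl2z_inv M) = ea M"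
  by (simp_all add: sl2z_inv.rep_eq)

lemma sl2z_inv_left [simp]: "sl2z_inv M * M = 1"
  using sl2z_det[of M] by (intro sl2z_eqI) (auto simp: algebra_simps)

lemma sl2z_inv_right [simp]: "M * sl2z_inv M = 1"
  using sl2z_det[of M] by (intro sl2z_eqI) (auto simp: algebra_simps)

definition upper_half :: "complex set" where
  "upper_half = {\<tau>. Im \<tau> > 0}"

definition autfac :: "sl2z \<Rightarrow> complex \<Rightarrow> complex" where
  "autfac M \<tau> = of_int (ec M) * \<tau> + of_int (ed M)"

definition sl2z_act :: "sl2z \<Rightarrow> complex \<Rightarrow> complex" where
  "sl2z_act M \<tau> = (of_int (ea M) * \<tau> + of_int (eb M)) / autfac M \<tau>"

lemma autfac_nonzero: "Im \<tau> \<noteq> 0 \<Longrightarrow> autfac M \<tau> \<noteq> 0"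
proof
  assume *: "Im \<tau> \<noteq> 0" "autfac M \<tau> = 0"
  hence "Im (autfac M \<tau>) = 0" "Re (autfac M \<tau>) = 0" by simp_all
  hence "ec M = 0 \<and> ed M = 0" using *(1) by (auto simp: autfac_def)
  thus False using sl2z_det[of M] by simp
qed

lemma autfac_mult:
  assumes "autfac N \<tau> \<noteq> 0"
  shows "autfac (M * N) \<tau> = autfac M (sl2z_act N \<tau>) * autfac N \<tau>"
  using assms by (simp add: autfac_def sl2z_act_def field_simps)

lemma sl2z_act_mult:
  assumes "autfac N \<tau> \<noteq> 0" 
  shows "sl2z_act (M * N) \<tau> = sl2z_act M (sl2z_act N \<tau>)"
proof -
  have "of_int (ea (M * N)) * \<tau> + of_int (eb (M * N)) =
     (of_int (ea M) * sl2z_act N \<tau> + of_int (eb M)) * autfac N \<tau>"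
    using assms by (simp add: sl2z_act_def field_simps) (simp add: autfac_def algebra_simps)
  thus ?thesis
    unfolding sl2z_act_def[of "M * N"] autfac_mult[OF assms] using assms
    by (simp add: sl2z_act_def[of M])
qed

lemma Im_sl2z_act: "Im (sl2z_act M \<tau>) = Im \<tau> / (cmod (autfac M \<tau>))\<^sup>2"
proof -
  let ?n = "of_int (ea M) * \<tau> + of_int (eb M)" and ?d = "autfac M \<tau>"
  have "Im ?n * Re ?d - Re ?n * Im ?d = (real_of_int (ea M) * of_int (ed M) - of_int (eb M) * of_int (ec M)) * Im \<tau>"
    by (simp add: autfac_def algebra_simps)
  also have "real_of_int (ea M) * of_int (ed M) - of_int (eb M) * of_int (ec M) = of_int (ea M * ed M - eb M * ec M)"
    by simp
  finally have "Im ?n * Re ?d - Re ?n * Im ?d = Im \<tau>"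
    by (simp only: sl2z_det of_int_1 mult_1_left)
  thus ?thesis unfolding sl2z_act_def Im_divide by (simp add: cmod_def)
qed

lemma sl2z_act_upper: "\<tau> \<in> upper_half \<Longrightarrow> sl2z_act M \<tau> \<in> upper_half"
  using autfac_nonzero[of \<tau> M] by (simp add: upper_half_def Im_sl2z_act)

lemma sl2z_act_holomorphic: "sl2z_act M holomorphic_on upper_half"
  unfolding sl2z_act_def autfac_def
  by (intro holomorphic_intros)
     (use autfac_nonzero[of _ M] in \<open>auto simp: autfac_def upper_half_def\<close>)

(* The function component lives on the upper half-plane; it is extended by 0 so that equal
   elements of Mp_2(Z) are equal in HOL. *)
definition mp2_pairs :: "(sl2z \<times> (complex \<Rightarrow> complex)) set" where
  "mp2_pairs = {(M, \<phi>). \<phi> holomorphic_on upper_half \<and>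
    (\<forall>\<tau>\<in>upper_half. (\<phi> \<tau>)\<^sup>2 = autfac M \<tau>) \<and> (\<forall>\<tau>. \<tau> \<notin> upper_half \<longrightarrow> \<phi> \<tau> = 0)}"

definition res_upper :: "(complex \<Rightarrow> complex) \<Rightarrow> complex \<Rightarrow> complex" where
  "res_upper h \<tau> = (if \<tau> \<in> upper_half then h \<tau> else 0)"

lemma res_upper_holomorphic: "res_upper h holomorphic_on upper_half \<longleftrightarrow> h holomorphic_on upper_half"
  by (intro holomorphic_cong) (auto simp: res_upper_def)

lemma mp2_pairs_I:
  "h holomorphic_on upper_half \<Longrightarrow> (\<And>\<tau>. \<tau> \<in> upper_half \<Longrightarrow> (h \<tau>)\<^sup>2 = autfac M \<tau>)
    \<Longrightarrow> (M, res_upper h) \<in> mp2_pairs"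
  by (simp add: mp2_pairs_def res_upper_holomorphic) (simp add: res_upper_def)

lemma mp2_pairs_one: "(1, res_upper (\<lambda>_. 1)) \<in> mp2_pairs"
  by (rule mp2_pairs_I) (auto simp: autfac_def)

typedef mp2 = mp2_pairs
  morphisms mp2_rep Abs_mp2
  using mp2_pairs_one by blast

setup_lifting type_definition_mp2

definition mp2_mat :: "mp2 \<Rightarrow> sl2z" where "mp2_mat x = fst (mp2_rep x)"
definition mp2_fun :: "mp2 \<Rightarrow> complex \<Rightarrow> complex" where "mp2_fun x = snd (mp2_rep x)"

instantiation mp2 :: monoid_mult
begin
lift_definition one_mp2 :: mp2 is "(1, res_upper (\<lambda>_. 1))"
  by (rule mp2_pairs_one)
lift_definition times_mp2 :: "mp2 \<Rightarrow> mp2 \<Rightarrow> mp2" is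
  "\<lambda>(M, \<phi>) (N, \<psi>). (M * N, res_upper (\<lambda>\<tau>. \<phi> (sl2z_act N \<tau>) * \<psi> \<tau>))"
proof clarify
  fix M N \<phi> \<psi> assume p: "(M, \<phi>) \<in> mp2_pairs" and q: "(N, \<psi>) \<in> mp2_pairs"
  show "(M * N, res_upper (\<lambda>\<tau>. \<phi> (sl2z_act N \<tau>) * \<psi> \<tau>)) \<in> mp2_pairs"
  proof (rule mp2_pairs_I)
    have "(\<lambda>\<tau>. \<phi> (sl2z_act N \<tau>)) holomorphic_on upper_half"
      using holomorphic_on_compose_gen[OF sl2z_act_holomorphic[of N], of \<phi> upper_half] p sl2z_act_upper
      by (auto simp: o_def mp2_pairs_def)
    thus "(\<lambda>\<tau>. \<phi> (sl2z_act N \<tau>) * \<psi> \<tau>) holomorphic_on upper_half"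
      using q by (auto simp: mp2_pairs_def intro: holomorphic_intros)
    show "(\<phi> (sl2z_act N \<tau>) * \<psi> \<tau>)\<^sup>2 = autfac (M * N) \<tau>" if "\<tau> \<in> upper_half" for \<tau>
      using that p q sl2z_act_upper[OF that, of N] autfac_nonzero[of \<tau> N]
      by (simp add: power_mult_distrib autfac_mult upper_half_def mp2_pairs_def)
  qed
qed
instance
proof
  fix x y z :: mp2
  obtain L \<phi> M \<psi> N \<theta> where xyz: "mp2_rep x = (L, \<phi>)" "mp2_rep y = (M, \<psi>)" "mp2_rep z = (N, \<theta>)"
    by (cases "mp2_rep x", cases "mp2_rep y", cases "mp2_rep z")
  have "sl2z_act (M * N) \<tau> = sl2z_act M (sl2z_act N \<tau>)" if "\<tau> \<in> upper_half" for \<tau>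
    using sl2z_act_mult[of N \<tau> M] autfac_nonzero[of \<tau> N] that by (simp add: upper_half_def)
  hence "mp2_rep (x * y * z) = mp2_rep (x * (y * z))"
    by (simp add: times_mp2.rep_eq xyz res_upper_def fun_eq_iff sl2z_act_upper mult.assoc)
  thus "x * y * z = x * (y * z)" by (simp add: mp2_rep_inject)
  show "1 * x = x"
    by transfer (auto simp: res_upper_def fun_eq_iff sl2z_act_upper mp2_pairs_def)
  show "x * 1 = x"
    by transfer (auto simp: res_upper_def fun_eq_iff sl2z_act_def autfac_def mp2_pairs_def)
qed
end

definition mp2_group :: "mp2 monoid" where
  "mp2_group = \<lparr>carrier = UNIV, monoid.mult = (*), one = 1\<rparr>"

lemma mp2_left_inverse: "\<exists>y. y * x = (1 :: mp2)"
proof -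
  obtain M \<phi> where xe: "mp2_rep x = (M, \<phi>)" by (cases "mp2_rep x")
  have x: "(M, \<phi>) \<in> mp2_pairs" using mp2_rep[of x] by (simp add: xe)
  define N where "N = sl2z_inv M"
  have nz: "\<phi> \<tau> \<noteq> 0" if "\<tau> \<in> upper_half" for \<tau>
    using x that autfac_nonzero[of \<tau> M] by (auto simp: mp2_pairs_def upper_half_def)
  have NM: "sl2z_act N (sl2z_act M \<tau>) = \<tau>" "sl2z_act M (sl2z_act N \<tau>) = \<tau>"
    if "\<tau> \<in> upper_half" for \<tau>
    using that sl2z_act_mult[of M \<tau> N] sl2z_act_mult[of N \<tau> M] autfac_nonzero[of \<tau>]
    by (auto simp: N_def upper_half_def sl2z_act_def[of 1] autfac_def[of 1])
  have hol: "(\<lambda>\<tau>. inverse (\<phi> (sl2z_act N \<tau>))) holomorphic_on upper_half"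
    using holomorphic_on_compose_gen[OF sl2z_act_holomorphic[of N], of \<phi> upper_half] x sl2z_act_upper nz
    by (auto simp: o_def mp2_pairs_def intro!: holomorphic_intros)
  have sq: "(inverse (\<phi> (sl2z_act N \<tau>)))\<^sup>2 = autfac N \<tau>" if "\<tau> \<in> upper_half" for \<tau>
  proof -
    have "autfac M (sl2z_act N \<tau>) * autfac N \<tau> = 1"
      using autfac_mult[of N \<tau> M] autfac_nonzero[of \<tau> N] that
      by (auto simp: N_def upper_half_def autfac_def[of 1])
    moreover have "(\<phi> (sl2z_act N \<tau>))\<^sup>2 = autfac M (sl2z_act N \<tau>)"
      using x sl2z_act_upper[OF that, of N] by (auto simp: mp2_pairs_def)
    ultimately show ?thesis by (simp add: power_inverse inverse_unique)
  qed
  let ?y = "(N, res_upper (\<lambda>\<tau>. inverse (\<phi> (sl2z_act N \<tau>))))"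
  have "?y \<in> mp2_pairs" by (rule mp2_pairs_I[OF hol sq])
  hence "mp2_rep (Abs_mp2 ?y * x) = mp2_rep 1"
    using NM nz by (simp add: times_mp2.rep_eq one_mp2.rep_eq Abs_mp2_inverse xe fun_eq_iff
        res_upper_def sl2z_act_upper) (simp add: N_def)
  thus ?thesis unfolding mp2_rep_inject by blast
qed

lemma group_mp2: "group mp2_group"
  by (rule groupI) (use mp2_left_inverse in \<open>auto simp: mp2_group_def mult.assoc\<close>)

definition unitary_character :: "(mp2 \<Rightarrow> complex) \<Rightarrow> bool" where
  "unitary_character \<rho> \<longleftrightarrow> (\<forall>x y. \<rho> (x * y) = \<rho> x * \<rho> y) \<and> (\<forall>x. norm (\<rho> x) = 1)"

definition factors_through_finite_quotient :: "(mp2 \<Rightarrow> complex) \<Rightarrow> bool" where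
  "factors_through_finite_quotient \<rho> \<longleftrightarrow>
    (\<exists>N \<psi>. N \<lhd> mp2_group \<and> finite (carrier (mp2_group Mod N)) \<and>
           (\<forall>x. \<rho> x = \<psi> (N #>\<^bsub>mp2_group\<^esub> x)))"

lift_definition mp2_Z :: mp2 is "(1, res_upper (\<lambda>_. -1))"
  by (rule mp2_pairs_I) (auto simp: autfac_def)


section \<open>The slash operator\<close>

(* Throughout, 2 * \<kappa> is an integer; the floor only serves to obtain an integer exponent. *)
definition slash_mp :: "real \<Rightarrow> (mp2 \<Rightarrow> complex) \<Rightarrow> (complex \<Rightarrow> complex) \<Rightarrow> mp2 \<Rightarrow> complex \<Rightarrow> complex" where
  "slash_mp \<kappa> \<rho> h x \<tau> = mp2_fun x \<tau> powi (- \<lfloor>2 * \<kappa>\<rfloor>) * inverse (\<rho> x) * h (sl2z_act (mp2_mat x) \<tau>)"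

(* The branch of sqrt (c\<tau> + d) that is the principal one on the upper half-plane, continued to
   the complement of the vertical ray from the pole -d/c downwards. *)
definition sqrt_autfac :: "sl2z \<Rightarrow> complex \<Rightarrow> complex" where
  "sqrt_autfac M \<tau> =
     (if ec M > 0 then csqrt \<i> * csqrt (- \<i> * autfac M \<tau>)
      else if ec M < 0 then csqrt (- \<i>) * csqrt (\<i> * autfac M \<tau>)
      else csqrt (of_int (ed M)))"

lemma sqrt_autfac_square: "(sqrt_autfac M \<tau>)\<^sup>2 = autfac M \<tau>"
  by (simp add: sqrt_autfac_def power_mult_distrib del: csqrt_ii) (simp add: autfac_def)

lemma sqrt_autfac_holomorphic: "sqrt_autfac M holomorphic_on upper_half"
proof -
  consider "ec M > 0" | "ec M < 0" | "ec M = 0" by linarith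
  thus ?thesis
  proof cases
    case 1
    thus ?thesis unfolding sqrt_autfac_def autfac_def
      by (auto intro!: holomorphic_intros simp: upper_half_def complex_nonpos_Reals_iff mult_less_0_iff zero_le_mult_iff
            mult_le_0_iff not_le)
  next
    case 2
    thus ?thesis unfolding sqrt_autfac_def autfac_def
      by (auto intro!: holomorphic_intros simp: upper_half_def complex_nonpos_Reals_iff mult_less_0_iff zero_le_mult_iff
            mult_le_0_iff not_le)
  next
    case 3
    thus ?thesis unfolding sqrt_autfac_def by (auto intro!: holomorphic_intros)
  qed
qed

lift_definition mp2_lift :: "sl2z \<Rightarrow> mp2" is "\<lambda>M. (M, res_upper (sqrt_autfac M))"
  by (intro mp2_pairs_I sqrt_autfac_holomorphic sqrt_autfac_square)

definition slash :: "real \<Rightarrow> (mp2 \<Rightarrow> complex) \<Rightarrow> (complex \<Rightarrow> complex) \<Rightarrow> sl2z \<Rightarrow> complex \<Rightarrow> complex" where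
  "slash \<kappa> \<rho> h M \<tau> =
     sqrt_autfac M \<tau> powi (- \<lfloor>2 * \<kappa>\<rfloor>) * inverse (\<rho> (mp2_lift M)) * h (sl2z_act M \<tau>)"

lemma mp2_mat_simps [simp]: "mp2_mat (x * y) = mp2_mat x * mp2_mat y" "mp2_mat (mp2_lift M) = M" "mp2_mat mp2_Z = 1"
  by (auto simp: mp2_mat_def times_mp2.rep_eq mp2_lift.rep_eq mp2_Z.rep_eq split: prod.splits)

lemma mp2_cases:
  obtains "x = mp2_lift (mp2_mat x)" | "x = mp2_Z * mp2_lift (mp2_mat x)"
proof -
  define M \<phi> where "M = mp2_mat x" and "\<phi> = mp2_fun x"
  have x: "mp2_rep x = (M, \<phi>)" by (simp add: M_def \<phi>_def mp2_mat_def mp2_fun_def)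
  have \<phi>: "\<phi> holomorphic_on upper_half" "\<And>\<tau>. \<tau> \<in> upper_half \<Longrightarrow> (\<phi> \<tau>)\<^sup>2 = autfac M \<tau>"
      "\<And>\<tau>. \<tau> \<notin> upper_half \<Longrightarrow> \<phi> \<tau> = 0"
    using mp2_rep[of x] by (auto simp: x mp2_pairs_def)
  have nz: "sqrt_autfac M \<tau> \<noteq> 0" if "\<tau> \<in> upper_half" for \<tau>
    using that sqrt_autfac_square[of M \<tau>] autfac_nonzero[of \<tau> M] by (auto simp: upper_half_def)
  have "(\<lambda>\<tau>. \<phi> \<tau> / sqrt_autfac M \<tau>) constant_on upper_half"
  proof (rule continuous_finite_range_constant)
    show "connected upper_half" unfolding upper_half_def
      by (intro convex_connected convex_halfspace_Im_gt)
    show "continuous_on upper_half (\<lambda>\<tau>. \<phi> \<tau> / sqrt_autfac M \<tau>)"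
      using \<phi>(1) sqrt_autfac_holomorphic[of M] nz
      by (intro continuous_intros holomorphic_on_imp_continuous_on) auto
    have "\<phi> \<tau> / sqrt_autfac M \<tau> \<in> {1, -1}" if "\<tau> \<in> upper_half" for \<tau>
    proof -
      have "(\<phi> \<tau> / sqrt_autfac M \<tau>)\<^sup>2 = 1"
        using \<phi>(2)[OF that] sqrt_autfac_square[of M \<tau>] autfac_nonzero[of \<tau> M] that
        by (simp add: power_divide upper_half_def)
      thus ?thesis by (simp add: power2_eq_1_iff)
    qed
    hence "(\<lambda>\<tau>. \<phi> \<tau> / sqrt_autfac M \<tau>) ` upper_half \<subseteq> {1, -1}" by blast
    thus "finite ((\<lambda>\<tau>. \<phi> \<tau> / sqrt_autfac M \<tau>) ` upper_half)"
      by (rule finite_subset) simp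
  qed
  then obtain s where s: "\<And>\<tau>. \<tau> \<in> upper_half \<Longrightarrow> \<phi> \<tau> = s * sqrt_autfac M \<tau>"
    using nz by (auto simp: constant_on_def field_simps)
  have i: "\<i> \<in> upper_half" by (simp add: upper_half_def)
  have "s\<^sup>2 * autfac M \<i> = autfac M \<i>"
    using \<phi>(2)[OF i] s[OF i] sqrt_autfac_square[of M \<i>] by (simp add: power_mult_distrib)
  hence "s\<^sup>2 = 1" using autfac_nonzero[of \<i> M] by simp
  hence "s = 1 \<or> s = -1" by (simp add: power2_eq_1_iff)
  thus ?thesis
  proof
    assume "s = 1"
    hence "mp2_rep x = mp2_rep (mp2_lift M)"
      using s \<phi>(3) by (auto simp: x mp2_lift.rep_eq res_upper_def fun_eq_iff)
    thus ?thesis using that(1) by (simp add: mp2_rep_inject M_def)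
  next
    assume "s = -1"
    hence "mp2_rep x = mp2_rep (mp2_Z * mp2_lift M)"
      using s \<phi>(3) by (auto simp: x mp2_lift.rep_eq times_mp2.rep_eq mp2_Z.rep_eq
          res_upper_def fun_eq_iff sl2z_act_upper)
    thus ?thesis using that(2) by (simp add: mp2_rep_inject M_def)
  qed
qed

lemma slash_mp_eq_slash:
  assumes "unitary_character \<rho>" "\<rho> mp2_Z = (-1) powi \<lfloor>2 * \<kappa>\<rfloor>" "\<tau> \<in> upper_half"
  shows "slash_mp \<kappa> \<rho> h x \<tau> = slash \<kappa> \<rho> h (mp2_mat x) \<tau>"
proof (cases x rule: mp2_cases)
  case 1
  have "mp2_fun x \<tau> = sqrt_autfac (mp2_mat x) \<tau>"
    using assms(3) by (subst 1) (simp add: mp2_fun_def mp2_lift.rep_eq res_upper_def)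
  with 1 show ?thesis by (simp add: slash_mp_def slash_def)
next
  case 2
  have "mp2_fun x \<tau> = - sqrt_autfac (mp2_mat x) \<tau>"
    using assms(3) by (subst 2) (simp add: mp2_fun_def mp2_lift.rep_eq times_mp2.rep_eq mp2_Z.rep_eq
      res_upper_def sl2z_act_upper)
  moreover have "\<rho> x = (-1) powi \<lfloor>2 * \<kappa>\<rfloor> * \<rho> (mp2_lift (mp2_mat x))"
    using assms(1,2) by (subst 2) (simp add: unitary_character_def)
  moreover have "(- z) powi (-n) = (-1) powi n * z powi (-n)" for z :: complex and n
    by (metis minus_mult_left mult_1 power_int_minus_one_minus power_int_mult_distrib)
  moreover have "(-1) powi n * inverse ((-1) powi n) = (1 :: complex)" for n
    by simp
  ultimately show ?thesis by (simp add: slash_mp_def slash_def)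
qed


section \<open>The projective line and excised neighbourhoods\<close>

abbreviation P1C :: "complex option topology" where
  "P1C \<equiv> Alexandroff_compactification euclidean"

definition P1R :: "complex option set" where "P1R = insert None (Some ` \<real>)"
definition P1Q :: "complex option set" where "P1Q = insert None (Some ` \<rat>)"

definition P1_act :: "sl2z \<Rightarrow> complex option \<Rightarrow> complex option" where
  "P1_act M z = (case z of
      None \<Rightarrow> if ec M = 0 then None else Some (of_int (ea M) / of_int (ec M))
    | Some \<tau> \<Rightarrow> if autfac M \<tau> = 0 then None else Some (sl2z_act M \<tau>))"

definition P1_holomorphic_on :: "(complex option \<Rightarrow> complex) \<Rightarrow> complex option set \<Rightarrow> bool" where
  "P1_holomorphic_on g \<Omega> \<longleftrightarrow> (\<lambda>\<tau>. g (Some \<tau>)) holomorphic_on {\<tau>. Some \<tau> \<in> \<Omega>} \<and>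
     (let chart = (\<lambda>w. if w = 0 then None else Some (1 / w)) in
      (\<lambda>w. g (chart w)) holomorphic_on {w. chart w \<in> \<Omega>})"

(* For the cusp M(\<infinity>). *)
definition cusp_strip :: "sl2z \<Rightarrow> real \<Rightarrow> real \<Rightarrow> complex option set" where
  "cusp_strip M a \<epsilon> = {P1_act M (Some \<tau>) | \<tau>. Im \<tau> < - \<epsilon> \<and> \<bar>Re \<tau>\<bar> \<le> a}"

(* The choice of M with M(\<infinity>) = \<aa> is immaterial, since a different choice shifts the strip.
   Together with the strip at a cusp the cusp itself is removed: it is an accumulation point of the
   strip and would otherwise lie in every excised neighbourhood, so that an open excised
   neighbourhood would contain a full neighbourhood of the cusp. *)
definition excised_nbhd :: "complex option set \<Rightarrow> complex option set \<Rightarrow> bool" where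
  "excised_nbhd E \<Omega> \<longleftrightarrow> (\<exists>U M a \<epsilon>.
     openin P1C U \<and> Some ` upper_half \<union> P1R \<subseteq> U \<and>
     (\<forall>\<aa>\<in>E. P1_act (M \<aa>) None = \<aa> \<and> a \<aa> > 0 \<and> \<epsilon> \<aa> > 0) \<and>
     U - (\<Union>\<aa>\<in>E. insert \<aa> (cusp_strip (M \<aa>) (a \<aa>) (\<epsilon> \<aa>))) \<subseteq> \<Omega>)"

lemma excised_nbhdI:
  assumes "openin P1C U" "Some ` upper_half \<union> P1R \<subseteq> U"
    and "\<And>\<aa>. \<aa> \<in> E \<Longrightarrow> P1_act (M \<aa>) None = \<aa> \<and> a \<aa> > 0 \<and> \<epsilon> \<aa> > 0"
    and "U - (\<Union>\<aa>\<in>E. insert \<aa> (cusp_strip (M \<aa>) (a \<aa>) (\<epsilon> \<aa>))) \<subseteq> \<Omega>"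
  shows "excised_nbhd E \<Omega>"
proof -
  have 3: "\<forall>\<aa>\<in>E. P1_act (M \<aa>) None = \<aa> \<and> a \<aa> > 0 \<and> \<epsilon> \<aa> > 0"
    by (rule ballI) (rule assms(3))
  show ?thesis unfolding excised_nbhd_def
    by (rule exI[of _ U], rule exI[of _ M], rule exI[of _ a], rule exI[of _ \<epsilon>],
        rule conjI[OF assms(1) conjI[OF assms(2) conjI[OF 3 assms(4)]]])
qed

lemma P1_act_one [simp]: "P1_act 1 z = z"
  by (cases z) (auto simp: P1_act_def sl2z_act_def autfac_def)

lemma sl2z_complex_det:
  "complex_of_int (ea M) * of_int (ed M) - of_int (eb M) * of_int (ec M) = 1"
proof -
  have "complex_of_int (ea M * ed M - eb M * ec M) = 1" by (simp only: sl2z_det of_int_1)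
  thus ?thesis by simp
qed

lemma sl2z_act_numerator:
  assumes "autfac M \<tau> = 0"
  shows "of_int (ec M) * (of_int (ea M) * \<tau> + of_int (eb M)) = -1"
    and "of_int (ec M) \<noteq> (0 :: complex)"
proof -
  have "of_int (ec M) * (of_int (ea M) * \<tau> + of_int (eb M)) =
      of_int (ea M) * autfac M \<tau> - (complex_of_int (ea M) * of_int (ed M) - of_int (eb M) * of_int (ec M))"
    by (simp add: autfac_def algebra_simps)
  thus *: "of_int (ec M) * (of_int (ea M) * \<tau> + of_int (eb M)) = -1"
    by (simp only: sl2z_complex_det assms) simp
  thus "of_int (ec M) \<noteq> (0 :: complex)" by auto
qed

lemma P1_act_mult: "P1_act (M * N) z = P1_act M (P1_act N z)"
proof (cases z)
  case None
  show ?thesis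
  proof (cases "ec N = 0")
    case True
    hence "ea N \<noteq> 0" using sl2z_det[of N] by auto
    thus ?thesis using True None by (auto simp: P1_act_def)
  next
    case False
    hence F: "complex_of_int (ec N) \<noteq> 0" by simp
    define r where "r = complex_of_int (ea N) / of_int (ec N)"
    have 1: "autfac M r = of_int (ec (M * N)) / of_int (ec N)"
      using F by (simp add: autfac_def r_def field_simps)
    have 2: "of_int (ea M) * r + complex_of_int (eb M) = of_int (ea (M * N)) / of_int (ec N)"
      using F by (simp add: r_def field_simps)
    have "P1_act M (P1_act N z) = P1_act M (Some r)"
      using None False by (simp add: P1_act_def r_def)
    also have "\<dots> = (if autfac M r = 0 then None else Some (sl2z_act M r))"
      by (simp add: P1_act_def)
    also have "autfac M r = 0 \<longleftrightarrow> ec (M * N) = 0"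
      unfolding 1 divide_eq_0_iff of_int_eq_0_iff using False by simp
    also have "sl2z_act M r = of_int (ea (M * N)) / of_int (ec (M * N))"
      unfolding sl2z_act_def 1 2 using F by (simp del: sl2z_entries_times)
    finally show ?thesis by (simp only: None P1_act_def option.case)
  qed
next
  case (Some \<tau>)
  show ?thesis
  proof (cases "autfac N \<tau> = 0")
    case True
    define u where "u = of_int (ea N) * \<tau> + complex_of_int (eb N)"
    have u: "u \<noteq> 0" using sl2z_act_numerator(1)[OF True] by (auto simp: u_def)
    have "autfac (M * N) \<tau> = of_int (ec M) * u + of_int (ed M) * autfac N \<tau>"
      by (simp add: u_def autfac_def algebra_simps)
    hence 1: "autfac (M * N) \<tau> = of_int (ec M) * u" using True by simp
    have "of_int (ea (M * N)) * \<tau> + of_int (eb (M * N)) = of_int (ea M) * u + of_int (eb M) * autfac N \<tau>"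
      by (simp add: u_def autfac_def algebra_simps)
    hence 2: "of_int (ea (M * N)) * \<tau> + of_int (eb (M * N)) = of_int (ea M) * u" using True by simp
    have 3: "autfac (M * N) \<tau> = 0 \<longleftrightarrow> ec M = 0" unfolding 1 using u by simp
    have 4: "sl2z_act (M * N) \<tau> = of_int (ea M) / of_int (ec M)"
      unfolding sl2z_act_def 1 2 using u by simp
    show ?thesis by (simp add: Some P1_act_def 3 4 True)
  next
    case False
    thus ?thesis using Some by (auto simp: P1_act_def autfac_mult sl2z_act_mult)
  qed
qed

lemma P1_act_inv [simp]:
  "P1_act (sl2z_inv M) (P1_act M z) = z" "P1_act M (P1_act (sl2z_inv M) z) = z"
  by (simp_all flip: P1_act_mult)

lemma openin_P1C:
  "openin P1C U \<longleftrightarrow> (\<forall>z. Some z \<in> U \<longrightarrow> (\<forall>\<^sub>F w in nhds z. Some w \<in> U)) \<and>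
     (None \<in> U \<longrightarrow> (\<forall>\<^sub>F w in at_infinity. Some w \<in> U))"
proof -
  have op: "open (Some -` U) \<longleftrightarrow> (\<forall>z. Some z \<in> U \<longrightarrow> (\<forall>\<^sub>F w in nhds z. Some w \<in> U))"
  proof
    assume "open (Some -` U)"
    thus "\<forall>z. Some z \<in> U \<longrightarrow> (\<forall>\<^sub>F w in nhds z. Some w \<in> U)"
      by (auto simp: eventually_nhds)
  next
    assume *: "\<forall>z. Some z \<in> U \<longrightarrow> (\<forall>\<^sub>F w in nhds z. Some w \<in> U)"
    show "open (Some -` U)"
      by (subst open_subopen) (use * in \<open>fastforce simp: eventually_nhds\<close>)
  qed
  have inf: "(\<forall>\<^sub>F w in at_infinity. Some w \<in> U) \<longleftrightarrow> bounded (- (Some -` U))"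
  proof
    assume "\<forall>\<^sub>F w in at_infinity. Some w \<in> U"
    then obtain b where "\<And>w. b \<le> norm w \<Longrightarrow> Some w \<in> U" by (auto simp: eventually_at_infinity)
    hence "- (Some -` U) \<subseteq> cball 0 b" by (force simp: not_le[symmetric])
    thus "bounded (- (Some -` U))" using bounded_cball bounded_subset by blast
  next
    assume "bounded (- (Some -` U))"
    then obtain b where "\<And>w. w \<in> - (Some -` U) \<Longrightarrow> norm w \<le> b" by (auto simp: bounded_iff)
    hence "\<And>w. b + 1 \<le> norm w \<Longrightarrow> Some w \<in> U" by fastforce
    thus "\<forall>\<^sub>F w in at_infinity. Some w \<in> U" by (auto simp: eventually_at_infinity)
  qed
  show ?thesis
  proof (cases "None \<in> U")
    case True
    have "openin P1C U \<longleftrightarrow> (\<exists>C. compact C \<and> U = insert None (Some ` (- C)))"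
      using True by (auto simp: openin_Alexandroff_compactification compact_imp_closed Compl_eq_Diff_UNIV)
    also have "\<dots> \<longleftrightarrow> compact (- (Some -` U))"
    proof
      assume "\<exists>C. compact C \<and> U = insert None (Some ` (- C))"
      then obtain C where C: "compact C" "U = insert None (Some ` (- C))" by auto
      have "- (Some -` U) = C" unfolding C(2) by auto
      thus "compact (- (Some -` U))" using C(1) by simp
    next
      assume *: "compact (- (Some -` U))"
      have "U = insert None (Some ` (- (- (Some -` U))))"
        using True by (auto simp: image_iff)
      with * show "\<exists>C. compact C \<and> U = insert None (Some ` (- C))" by blast
    qed
    finally show ?thesis using True op inf
      by (auto simp: compact_eq_bounded_closed closed_open)
  next
    case False
    hence "U = Some ` (Some -` U)" by (auto simp: image_iff) (metis option.exhaust)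
    hence "openin P1C U \<longleftrightarrow> open (Some -` U)"
      using False by (auto simp: openin_Alexandroff_compactification inj_vimage_image_eq)
    thus ?thesis using False op by simp
  qed
qed

lemma openin_P1C_UNIV: "openin P1C UNIV"
  by (simp add: openin_P1C)

lemma eventually_autfac_nonzero:
  assumes "autfac M z \<noteq> 0" shows "\<forall>\<^sub>F w in nhds z. autfac M w \<noteq> 0"
proof -
  have "open {w. autfac M w \<noteq> 0}" unfolding autfac_def
    by (intro open_Collect_neq continuous_intros)
  thus ?thesis using assms by (auto simp: eventually_nhds)
qed

lemma openin_P1_act_vimage:
  assumes U: "openin P1C U"
  shows "openin P1C (P1_act M -` U)"
proof -
  have fin: "\<forall>\<^sub>F w in nhds z. Some w \<in> U" if "Some z \<in> U" for z
    using U that by (auto simp: openin_P1C)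
  have inf: "\<forall>\<^sub>F w in at_infinity. Some w \<in> U" if "None \<in> U"
    using U that by (auto simp: openin_P1C)
  have act: "P1_act M (Some w) \<in> U" if "Some (sl2z_act M w) \<in> U" "autfac M w \<noteq> 0" for w
    using that by (auto simp: P1_act_def)
  have 1: "\<forall>\<^sub>F w in nhds z. P1_act M (Some w) \<in> U" if z: "P1_act M (Some z) \<in> U" for z
  proof (cases "autfac M z = 0")
    case False
    have "((\<lambda>w. sl2z_act M w) \<longlongrightarrow> sl2z_act M z) (nhds z)"
      unfolding sl2z_act_def autfac_def
      by (intro tendsto_intros filterlim_ident) (use False in \<open>auto simp: autfac_def\<close>)
    moreover have "\<forall>\<^sub>F w in nhds (sl2z_act M z). Some w \<in> U"
      using z False by (intro fin) (auto simp: P1_act_def)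
    ultimately have "\<forall>\<^sub>F w in nhds z. Some (sl2z_act M w) \<in> U"
      by (auto simp: filterlim_iff)
    thus ?thesis using eventually_autfac_nonzero[OF False]
      by eventually_elim (rule act)
  next
    case True
    note c = sl2z_act_numerator[OF True]
    have nz: "autfac M w \<noteq> 0" if "w \<noteq> z" for w
    proof -
      have "autfac M w - autfac M z = of_int (ec M) * (w - z)" by (simp add: autfac_def algebra_simps)
      thus ?thesis using True c(2) that by auto
    qed
    have "filterlim (\<lambda>w. (of_int (ea M) * w + of_int (eb M)) / autfac M w) at_infinity (at z)"
    proof (rule filterlim_divide_at_infinity)
      show "((\<lambda>w. of_int (ea M) * w + of_int (eb M)) \<longlongrightarrow> of_int (ea M) * z + of_int (eb M)) (at z)"
        by (intro tendsto_intros)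
      show "of_int (ea M) * z + of_int (eb M) \<noteq> 0" using c by auto
      have "((\<lambda>w. autfac M w) \<longlongrightarrow> autfac M z) (at z)"
        unfolding autfac_def by (intro tendsto_intros)
      thus "filterlim (\<lambda>w. autfac M w) (at 0) (at z)"
        using True nz by (auto simp: filterlim_at eventually_at_filter)
    qed
    hence "\<forall>\<^sub>F w in at z. Some (sl2z_act M w) \<in> U"
      using inf z True by (auto simp: filterlim_iff P1_act_def sl2z_act_def)
    hence "\<forall>\<^sub>F w in at z. P1_act M (Some w) \<in> U"
      using nz by (auto simp: eventually_at_filter elim!: eventually_mono intro: act)
    thus ?thesis using z by (auto simp: eventually_nhds_conv_at)
  qed
  have 2: "\<forall>\<^sub>F w in at_infinity. P1_act M (Some w) \<in> U" if z: "P1_act M None \<in> U"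
  proof (cases "ec M = 0")
    case True
    with sl2z_det[of M] have nz: "ea M \<noteq> 0" "ed M \<noteq> 0" by auto
    have "filterlim (\<lambda>w. (of_int (ea M) / of_int (ed M)) * w + of_int (eb M) / of_int (ed M) :: complex)
        at_infinity at_infinity"
    proof (rule tendsto_add_filterlim_at_infinity')
      show "filterlim (\<lambda>w. (of_int (ea M) / of_int (ed M)) * w :: complex) at_infinity at_infinity"
        by (rule tendsto_mult_filterlim_at_infinity[OF tendsto_const])
           (use nz in \<open>auto simp: filterlim_ident\<close>)
    qed (rule tendsto_const)
    moreover have "(\<lambda>w. (of_int (ea M) / of_int (ed M)) * w + of_int (eb M) / of_int (ed M)) = sl2z_act M"
      using True nz by (auto simp: sl2z_act_def autfac_def fun_eq_iff field_simps)
    ultimately have "filterlim (sl2z_act M) at_infinity at_infinity" by simp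
    hence "\<forall>\<^sub>F w in at_infinity. Some (sl2z_act M w) \<in> U"
      using inf z True by (auto simp: filterlim_iff P1_act_def)
    thus ?thesis using True nz by (auto intro!: act simp: autfac_def elim!: eventually_mono)
  next
    case False
    hence c: "complex_of_int (ec M) \<noteq> 0" by simp
    have lin: "filterlim (\<lambda>w. autfac M w) at_infinity at_infinity"
      unfolding autfac_def
      by (rule tendsto_add_filterlim_at_infinity'[OF
            tendsto_mult_filterlim_at_infinity[OF tendsto_const c filterlim_ident] tendsto_const])
    have ev: "\<forall>\<^sub>F w in at_infinity. autfac M w \<noteq> 0"
      using filterlim_at_infinity_imp_eventually_ne[OF lin] by blast
    have "((\<lambda>w. of_int (ea M) / of_int (ec M) - (1 / of_int (ec M)) / autfac M w) \<longlongrightarrow>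
        of_int (ea M) / of_int (ec M) - 0) at_infinity"
      by (intro tendsto_intros tendsto_divide_0[OF tendsto_const] lin)
    moreover have "\<forall>\<^sub>F w in at_infinity. of_int (ea M) / of_int (ec M) - (1 / of_int (ec M)) / autfac M w
        = sl2z_act M w"
      using ev
    proof eventually_elim
      case (elim w)
      have "(of_int (ea M) * w + of_int (eb M)) * of_int (ec M) = of_int (ea M) * autfac M w -
         (complex_of_int (ea M) * of_int (ed M) - of_int (eb M) * of_int (ec M))"
        by (simp add: autfac_def algebra_simps)
      hence "(of_int (ea M) * w + of_int (eb M)) * of_int (ec M) = of_int (ea M) * autfac M w - 1"
        by (simp only: sl2z_complex_det)
      hence "of_int (ea M) * w + of_int (eb M) = (of_int (ea M) * autfac M w - 1) / of_int (ec M)"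
        using c by (simp add: eq_divide_eq)
      thus ?case using elim c by (simp add: sl2z_act_def diff_divide_distrib)
    qed
    ultimately have "((\<lambda>w. sl2z_act M w) \<longlongrightarrow> of_int (ea M) / of_int (ec M)) at_infinity"
      using tendsto_cong by force
    hence "\<forall>\<^sub>F w in at_infinity. Some (sl2z_act M w) \<in> U"
      using fin[of "of_int (ea M) / of_int (ec M)"] z False by (auto simp: filterlim_iff P1_act_def)
    thus ?thesis using ev by eventually_elim (rule act)
  qed
  show ?thesis unfolding openin_P1C[of "P1_act M -` U"] using 1 2 by auto
qed


lemma P1_act_upper: "\<tau> \<in> upper_half \<Longrightarrow> P1_act M (Some \<tau>) \<in> Some ` upper_half"
  using sl2z_act_upper[of \<tau> M] autfac_nonzero[of \<tau> M] by (simp add: P1_act_def upper_half_def)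

lemma P1_act_P1R: "z \<in> P1R \<Longrightarrow> P1_act M z \<in> P1R"
  by (auto simp: P1R_def P1_act_def sl2z_act_def autfac_def split: option.splits)

lemma P1_act_P1Q: "z \<in> P1Q \<Longrightarrow> P1_act M z \<in> P1Q"
  by (auto simp: P1Q_def P1_act_def sl2z_act_def autfac_def split: option.splits)

lemma cusp_strip_lower: "\<epsilon> > 0 \<Longrightarrow> Some \<tau> \<in> cusp_strip M a \<epsilon> \<Longrightarrow> Im \<tau> < 0"
  by (auto simp: cusp_strip_def P1_act_def Im_sl2z_act divide_neg_pos autfac_nonzero split: if_splits)

lemma excised_nbhd_upper:
  assumes "excised_nbhd E \<Omega>" "E \<subseteq> P1Q" "\<tau> \<in> upper_half"
  shows "Some \<tau> \<in> \<Omega>"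
proof -
  from assms(1) obtain U M a \<epsilon> where *:
    "Some ` upper_half \<union> P1R \<subseteq> U"
    "\<forall>\<aa>\<in>E. P1_act (M \<aa>) None = \<aa> \<and> a \<aa> > (0::real) \<and> \<epsilon> \<aa> > (0::real)"
    "U - (\<Union>\<aa>\<in>E. insert \<aa> (cusp_strip (M \<aa>) (a \<aa>) (\<epsilon> \<aa>))) \<subseteq> \<Omega>"
    unfolding excised_nbhd_def by auto
  have "Some \<tau> \<notin> cusp_strip (M \<aa>) (a \<aa>) (\<epsilon> \<aa>)" if "\<aa> \<in> E" for \<aa>
    using cusp_strip_lower[of "\<epsilon> \<aa>" \<tau>] that *(2) assms(3) by (force simp: upper_half_def)
  moreover have "Some \<tau> \<notin> E"
    using assms(2,3) by (auto simp: P1Q_def upper_half_def dest!: subsetD elim!: Rats_cases')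
  ultimately show ?thesis using *(1,3) assms(3) by blast
qed

lemma cusp_strip_subset:
  assumes "P1_act M None = P1_act N None"
  shows "\<exists>c\<ge>0. \<forall>a \<epsilon>. cusp_strip N a \<epsilon> \<subseteq> cusp_strip M (a + c) \<epsilon>"
proof -
  define K where "K = sl2z_inv M * N"
  have N: "N = M * K" by (simp add: K_def flip: mult.assoc)
  have "P1_act K None = None" using assms[symmetric] by (simp add: K_def P1_act_mult)
  hence c: "ec K = 0" by (auto simp: P1_act_def split: if_splits)
  hence ad: "ea K * ed K = 1" using sl2z_det[of K] by simp
  hence "ea K = 1 \<and> ed K = 1 \<or> ea K = -1 \<and> ed K = -1" by (auto simp: zmult_eq_1_iff)
  hence act: "P1_act K (Some \<tau>) = Some (\<tau> + of_int (eb K * ed K))" for \<tau>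
    using c by (auto simp: P1_act_def sl2z_act_def autfac_def)
  show ?thesis
  proof (intro exI[of _ "\<bar>real_of_int (eb K * ed K)\<bar>"] conjI allI subsetI)
    fix a \<epsilon> z assume "z \<in> cusp_strip N a \<epsilon>"
    then obtain \<tau> where \<tau>: "z = P1_act N (Some \<tau>)" "Im \<tau> < - \<epsilon>" "\<bar>Re \<tau>\<bar> \<le> a"
      by (auto simp: cusp_strip_def)
    have "z = P1_act M (Some (\<tau> + of_int (eb K * ed K)))"
      unfolding \<tau>(1) N by (simp only: P1_act_mult act)
    moreover have "Im (\<tau> + of_int (eb K * ed K)) < - \<epsilon>" using \<tau> by simp
    moreover have "\<bar>Re (\<tau> + of_int (eb K * ed K))\<bar> \<le> a + \<bar>real_of_int (eb K * ed K)\<bar>"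
    proof -
      have "Re (\<tau> + of_int (eb K * ed K)) = Re \<tau> + real_of_int (eb K * ed K)" by simp
      thus ?thesis using \<tau>(3) by linarith
    qed
    ultimately show "z \<in> cusp_strip M (a + \<bar>real_of_int (eb K * ed K)\<bar>) \<epsilon>"
      unfolding cusp_strip_def by blast
  qed simp
qed

lemma cusp_strip_mono: "a \<le> a' \<Longrightarrow> \<epsilon>' \<le> \<epsilon> \<Longrightarrow> cusp_strip M a \<epsilon> \<subseteq> cusp_strip M a' \<epsilon>'"
  unfolding cusp_strip_def by fastforce

lemma excised_nbhd_Int:
  assumes "excised_nbhd E \<Omega>" "excised_nbhd E' \<Omega>'"
  shows "excised_nbhd (E \<union> E') (\<Omega> \<inter> \<Omega>')"
proof -
  from assms(1) obtain U M a \<epsilon> where *: "openin P1C U" "Some ` upper_half \<union> P1R \<subseteq> U"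
    "\<forall>\<aa>\<in>E. P1_act (M \<aa>) None = \<aa> \<and> a \<aa> > (0::real) \<and> \<epsilon> \<aa> > (0::real)"
    "U - (\<Union>\<aa>\<in>E. insert \<aa> (cusp_strip (M \<aa>) (a \<aa>) (\<epsilon> \<aa>))) \<subseteq> \<Omega>"
    unfolding excised_nbhd_def by auto
  from assms(2) obtain U' M' a' \<epsilon>' where **: "openin P1C U'" "Some ` upper_half \<union> P1R \<subseteq> U'"
    "\<forall>\<aa>\<in>E'. P1_act (M' \<aa>) None = \<aa> \<and> a' \<aa> > (0::real) \<and> \<epsilon>' \<aa> > (0::real)"
    "U' - (\<Union>\<aa>\<in>E'. insert \<aa> (cusp_strip (M' \<aa>) (a' \<aa>) (\<epsilon>' \<aa>))) \<subseteq> \<Omega>'"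
    unfolding excised_nbhd_def by auto
  define Q where "Q \<aa> N b \<delta> \<longleftrightarrow> P1_act N None = \<aa> \<and> b > 0 \<and> \<delta> > 0 \<and>
      (\<aa> \<in> E \<longrightarrow> cusp_strip (M \<aa>) (a \<aa>) (\<epsilon> \<aa>) \<subseteq> cusp_strip N b \<delta>) \<and>
      (\<aa> \<in> E' \<longrightarrow> cusp_strip (M' \<aa>) (a' \<aa>) (\<epsilon>' \<aa>) \<subseteq> cusp_strip N b \<delta>)" for \<aa> N b \<delta>
  have "\<exists>N b \<delta>. Q \<aa> N b \<delta>" if mem: "\<aa> \<in> E \<union> E'" for \<aa>
  proof -
    consider "\<aa> \<in> E" "\<aa> \<in> E'" | "\<aa> \<in> E" "\<aa> \<notin> E'" | "\<aa> \<notin> E" "\<aa> \<in> E'" using mem by blast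
    thus ?thesis
    proof cases
      case 1
      then obtain c where c: "c \<ge> 0" "\<And>a \<epsilon>. cusp_strip (M' \<aa>) a \<epsilon> \<subseteq> cusp_strip (M \<aa>) (a + c) \<epsilon>"
        using cusp_strip_subset[of "M \<aa>" "M' \<aa>"] *(3) **(3) by auto
      let ?b = "max (a \<aa>) (a' \<aa> + c)" and ?d = "min (\<epsilon> \<aa>) (\<epsilon>' \<aa>)"
      have "cusp_strip (M' \<aa>) (a' \<aa>) (\<epsilon>' \<aa>) \<subseteq> cusp_strip (M \<aa>) ?b ?d"
        using c(2) cusp_strip_mono[of "a' \<aa> + c" ?b ?d "\<epsilon>' \<aa>" "M \<aa>"] by fastforce
      moreover have "cusp_strip (M \<aa>) (a \<aa>) (\<epsilon> \<aa>) \<subseteq> cusp_strip (M \<aa>) ?b ?d"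
        by (rule cusp_strip_mono) auto
      ultimately show ?thesis using 1 *(3) **(3) c(1) unfolding Q_def
        by (intro exI[of _ "M \<aa>"] exI[of _ ?b] exI[of _ ?d]) auto
    next
      case 2
      thus ?thesis using *(3) unfolding Q_def
        by (intro exI[of _ "M \<aa>"] exI[of _ "a \<aa>"] exI[of _ "\<epsilon> \<aa>"]) auto
    next
      case 3
      thus ?thesis using **(3) unfolding Q_def
        by (intro exI[of _ "M' \<aa>"] exI[of _ "a' \<aa>"] exI[of _ "\<epsilon>' \<aa>"]) auto
    qed
  qed
  then obtain N b \<delta> where N: "\<And>\<aa>. \<aa> \<in> E \<union> E' \<Longrightarrow> Q \<aa> (N \<aa>) (b \<aa>) (\<delta> \<aa>)"
    by metis
  have "U \<inter> U' - (\<Union>\<aa>\<in>E \<union> E'. insert \<aa> (cusp_strip (N \<aa>) (b \<aa>) (\<delta> \<aa>))) \<subseteq> \<Omega> \<inter> \<Omega>'"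
  proof
    fix z assume z: "z \<in> U \<inter> U' - (\<Union>\<aa>\<in>E \<union> E'. insert \<aa> (cusp_strip (N \<aa>) (b \<aa>) (\<delta> \<aa>)))"
    have 1: "z \<notin> insert \<aa> (cusp_strip (M \<aa>) (a \<aa>) (\<epsilon> \<aa>))" if "\<aa> \<in> E" for \<aa>
      using N[of \<aa>] z that unfolding Q_def by blast
    have 2: "z \<notin> insert \<aa> (cusp_strip (M' \<aa>) (a' \<aa>) (\<epsilon>' \<aa>))" if "\<aa> \<in> E'" for \<aa>
      using N[of \<aa>] z that unfolding Q_def by blast
    have "z \<in> U - (\<Union>\<aa>\<in>E. insert \<aa> (cusp_strip (M \<aa>) (a \<aa>) (\<epsilon> \<aa>)))" using z 1 by blast
    moreover have "z \<in> U' - (\<Union>\<aa>\<in>E'. insert \<aa> (cusp_strip (M' \<aa>) (a' \<aa>) (\<epsilon>' \<aa>)))"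
      using z 2 by blast
    ultimately show "z \<in> \<Omega> \<inter> \<Omega>'" using subsetD[OF *(4)] subsetD[OF **(4)] by simp
  qed
  moreover have "P1_act (N \<aa>) None = \<aa> \<and> b \<aa> > 0 \<and> \<delta> \<aa> > 0" if "\<aa> \<in> E \<union> E'" for \<aa>
    using N[OF that] unfolding Q_def by (elim conjE) (intro conjI)
  moreover have "Some ` upper_half \<union> P1R \<subseteq> U \<inter> U'" using *(2) **(2) by (rule Int_greatest)
  ultimately show ?thesis
    by (intro excised_nbhdI[where U = "U \<inter> U'" and M = N and a = b and \<epsilon> = \<delta>] openin_Int *(1) **(1))
qed

lemma excised_nbhd_vimage:
  assumes "excised_nbhd E \<Omega>"
  shows "excised_nbhd (P1_act K -` E) (P1_act K -` \<Omega>)"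
proof -
  from assms obtain U M a \<epsilon> where *: "openin P1C U" "Some ` upper_half \<union> P1R \<subseteq> U"
    "\<forall>\<aa>\<in>E. P1_act (M \<aa>) None = \<aa> \<and> a \<aa> > (0::real) \<and> \<epsilon> \<aa> > (0::real)"
    "U - (\<Union>\<aa>\<in>E. insert \<aa> (cusp_strip (M \<aa>) (a \<aa>) (\<epsilon> \<aa>))) \<subseteq> \<Omega>"
    unfolding excised_nbhd_def by auto
  let ?M = "\<lambda>\<aa>. sl2z_inv K * M (P1_act K \<aa>)"
  have strip: "z \<in> cusp_strip (sl2z_inv K * N) b \<delta>" if "P1_act K z \<in> cusp_strip N b \<delta>" for z N b \<delta>
  proof -
    from that obtain \<tau> where \<tau>: "P1_act K z = P1_act N (Some \<tau>)" "Im \<tau> < - \<delta>" "\<bar>Re \<tau>\<bar> \<le> b"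
      by (auto simp: cusp_strip_def)
    from \<tau>(1) have "P1_act (sl2z_inv K) (P1_act K z) = P1_act (sl2z_inv K) (P1_act N (Some \<tau>))" by simp
    hence "z = P1_act (sl2z_inv K * N) (Some \<tau>)" by (simp add: P1_act_mult)
    thus ?thesis using \<tau> by (auto simp: cusp_strip_def)
  qed
  have "P1_act K -` U - (\<Union>\<aa>\<in>P1_act K -` E. insert \<aa>
      (cusp_strip (?M \<aa>) (a (P1_act K \<aa>)) (\<epsilon> (P1_act K \<aa>)))) \<subseteq> P1_act K -` \<Omega>"
  proof
    fix z assume z: "z \<in> P1_act K -` U - (\<Union>\<aa>\<in>P1_act K -` E. insert \<aa>
      (cusp_strip (?M \<aa>) (a (P1_act K \<aa>)) (\<epsilon> (P1_act K \<aa>))))"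
    have "P1_act K z \<notin> insert \<bb> (cusp_strip (M \<bb>) (a \<bb>) (\<epsilon> \<bb>))" if b: "\<bb> \<in> E" for \<bb>
    proof
      define \<aa> where "\<aa> = P1_act (sl2z_inv K) \<bb>"
      have \<aa>: "P1_act K \<aa> = \<bb>" by (simp add: \<aa>_def)
      assume "P1_act K z \<in> insert \<bb> (cusp_strip (M \<bb>) (a \<bb>) (\<epsilon> \<bb>))"
      hence "z = \<aa> \<or> z \<in> cusp_strip (?M \<aa>) (a (P1_act K \<aa>)) (\<epsilon> (P1_act K \<aa>))"
        using strip[of z "M \<bb>" "a \<bb>" "\<epsilon> \<bb>"] by (auto simp: \<aa> \<aa>_def)
      moreover have "\<aa> \<in> P1_act K -` E" using \<aa> b by simp
      ultimately show False using z by blast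
    qed
    moreover have "P1_act K z \<in> U" using z by blast
    ultimately have "P1_act K z \<in> U - (\<Union>\<aa>\<in>E. insert \<aa> (cusp_strip (M \<aa>) (a \<aa>) (\<epsilon> \<aa>)))" by blast
    thus "z \<in> P1_act K -` \<Omega>" using subsetD[OF *(4)] by simp
  qed
  moreover have "Some ` upper_half \<union> P1R \<subseteq> P1_act K -` U"
  proof
    fix z assume "z \<in> Some ` upper_half \<union> P1R"
    hence "P1_act K z \<in> Some ` upper_half \<union> P1R"
      using P1_act_upper[of _ K] P1_act_P1R[of z K] by auto
    thus "z \<in> P1_act K -` U" using subsetD[OF *(2)] by simp
  qed
  moreover have "P1_act (?M \<aa>) None = \<aa> \<and> a (P1_act K \<aa>) > 0 \<and> \<epsilon> (P1_act K \<aa>) > 0"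
    if "\<aa> \<in> P1_act K -` E" for \<aa>
    using bspec[OF *(3), of "P1_act K \<aa>"] that by (simp add: P1_act_mult)
  ultimately show ?thesis
    by (intro excised_nbhdI[where U = "P1_act K -` U" and M = ?M and a = "\<lambda>\<aa>. a (P1_act K \<aa>)"
          and \<epsilon> = "\<lambda>\<aa>. \<epsilon> (P1_act K \<aa>)"] openin_P1_act_vimage[OF *(1)])
qed

lemma excised_nbhd_remove:
  assumes "excised_nbhd E \<Omega>"
  shows "excised_nbhd (insert (P1_act K None) E) (\<Omega> - {P1_act K None})"
proof -
  have "excised_nbhd {P1_act K None} (- {P1_act K None})"
    unfolding excised_nbhd_def
    by (intro exI[of _ UNIV] exI[of _ "\<lambda>_. K"] exI[of _ "\<lambda>_. 1"])
       (auto simp: openin_P1C_UNIV)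
  from excised_nbhd_Int[OF assms this] show ?thesis by (simp add: Diff_eq)
qed


section \<open>Germs and the module of semi-analytic vectors\<close>

(* A function on an excised neighbourhood is represented by a total function; two of them have the
   same germ iff they agree on the finite points of some excised neighbourhood. *)
definition germ_eq :: "(complex \<Rightarrow> complex) \<Rightarrow> (complex \<Rightarrow> complex) \<Rightarrow> bool" where
  "germ_eq h h' \<longleftrightarrow> (\<exists>E \<Omega>. finite E \<and> E \<subseteq> P1Q \<and> excised_nbhd E \<Omega> \<and>
      (\<forall>\<tau>. Some \<tau> \<in> \<Omega> \<longrightarrow> h \<tau> = h' \<tau>))"

lemma excised_nbhd_UNIV: "excised_nbhd {} UNIV"
  unfolding excised_nbhd_def
  by (intro exI[of _ UNIV]) (auto simp: openin_P1C_UNIV)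

lemma germ_eq_binop:
  assumes "germ_eq h1 h2" "germ_eq h1' h2'"
  shows "germ_eq (\<lambda>\<tau>. B (h1 \<tau>) (h1' \<tau>)) (\<lambda>\<tau>. B (h2 \<tau>) (h2' \<tau>))"
proof -
  obtain E \<Omega> E' \<Omega>' where "finite E" "E \<subseteq> P1Q" "excised_nbhd E \<Omega>" "\<forall>\<tau>. Some \<tau> \<in> \<Omega> \<longrightarrow> h1 \<tau> = h2 \<tau>"
    "finite E'" "E' \<subseteq> P1Q" "excised_nbhd E' \<Omega>'" "\<forall>\<tau>. Some \<tau> \<in> \<Omega>' \<longrightarrow> h1' \<tau> = h2' \<tau>"
    using assms unfolding germ_eq_def by blast
  thus ?thesis unfolding germ_eq_def
    by (intro exI[of _ "E \<union> E'"] exI[of _ "\<Omega> \<inter> \<Omega>'"]) (auto intro: excised_nbhd_Int)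
qed

quotient_type germ = "complex \<Rightarrow> complex" / germ_eq
proof (rule equivpI)
  show "reflp germ_eq"
    unfolding reflp_def germ_eq_def using excised_nbhd_UNIV by blast
  show "symp germ_eq" unfolding symp_def germ_eq_def by metis
  show "transp germ_eq"
  proof (rule transpI)
    fix f g h assume fg: "germ_eq f g" and gh: "germ_eq g h"
    obtain E \<Omega> E' \<Omega>' where "finite E" "E \<subseteq> P1Q" "excised_nbhd E \<Omega>" "\<forall>\<tau>. Some \<tau> \<in> \<Omega> \<longrightarrow> f \<tau> = g \<tau>"
      "finite E'" "E' \<subseteq> P1Q" "excised_nbhd E' \<Omega>'" "\<forall>\<tau>. Some \<tau> \<in> \<Omega>' \<longrightarrow> g \<tau> = h \<tau>"
      using fg gh unfolding germ_eq_def by blast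
    thus "germ_eq f h" unfolding germ_eq_def
      by (intro exI[of _ "E \<union> E'"] exI[of _ "\<Omega> \<inter> \<Omega>'"]) (auto intro: excised_nbhd_Int)
  qed
qed

instantiation germ :: ab_group_add
begin
lift_definition zero_germ :: germ is "\<lambda>_. 0" .
lift_definition plus_germ :: "germ \<Rightarrow> germ \<Rightarrow> germ" is "\<lambda>g h \<tau>. g \<tau> + h \<tau>" by (rule germ_eq_binop)
lift_definition minus_germ :: "germ \<Rightarrow> germ \<Rightarrow> germ" is "\<lambda>g h \<tau>. g \<tau> - h \<tau>" by (rule germ_eq_binop)
lift_definition uminus_germ :: "germ \<Rightarrow> germ" is "\<lambda>g \<tau>. - g \<tau>"
  by (rule germ_eq_binop[where B = "\<lambda>x y. - x"])
instance
  by standard (transfer; simp add: equivp_reflp[OF germ_equivp] algebra_simps)+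
end

(* The values on the upper half-plane, which is contained in every excised neighbourhood. *)
lift_definition germ_upper :: "germ \<Rightarrow> complex \<Rightarrow> complex" is res_upper
  using excised_nbhd_upper by (fastforce simp: germ_eq_def res_upper_def)

lift_definition germ_slash :: "real \<Rightarrow> (mp2 \<Rightarrow> complex) \<Rightarrow> germ \<Rightarrow> sl2z \<Rightarrow> germ" is slash
proof -
  fix \<kappa> \<rho> g h M assume "germ_eq g h"
  then obtain E \<Omega> where *: "finite E" "E \<subseteq> P1Q" "excised_nbhd E \<Omega>" "\<forall>\<tau>. Some \<tau> \<in> \<Omega> \<longrightarrow> g \<tau> = h \<tau>"
    unfolding germ_eq_def by blast
  define \<aa> where "\<aa> = P1_act (sl2z_inv M) None"
  have "\<aa> \<in> P1Q" unfolding \<aa>_def by (rule P1_act_P1Q) (simp add: P1Q_def)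
  moreover have "finite (P1_act M -` E)"
    by (intro finite_vimageI *(1) inj_on_inverseI[where g = "P1_act (sl2z_inv M)"]) simp
  moreover have "P1_act M -` E \<subseteq> P1Q"
    using P1_act_P1Q[of "P1_act M _" "sl2z_inv M"] *(2) by auto
  moreover have "excised_nbhd (insert \<aa> (P1_act M -` E)) (P1_act M -` \<Omega> - {\<aa>})"
    unfolding \<aa>_def by (intro excised_nbhd_remove excised_nbhd_vimage *(3))
  moreover have "slash \<kappa> \<rho> g M \<tau> = slash \<kappa> \<rho> h M \<tau>" if "Some \<tau> \<in> P1_act M -` \<Omega> - {\<aa>}" for \<tau>
  proof -
    have "P1_act M (Some \<tau>) \<noteq> None"
    proof
      assume "P1_act M (Some \<tau>) = None"
      hence "Some \<tau> = \<aa>" unfolding \<aa>_def by (metis P1_act_inv(1))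
      thus False using that by simp
    qed
    hence "P1_act M (Some \<tau>) = Some (sl2z_act M \<tau>)" by (auto simp: P1_act_def split: if_splits)
    thus ?thesis using that *(4) by (simp add: slash_def)
  qed
  ultimately show "germ_eq (slash \<kappa> \<rho> g M) (slash \<kappa> \<rho> h M)"
    unfolding germ_eq_def
    by (intro exI[of _ "insert \<aa> (P1_act M -` E)"] exI[of _ "P1_act M -` \<Omega> - {\<aa>}"]) auto
qed

definition germ_slash_diff :: "real \<Rightarrow> (mp2 \<Rightarrow> complex) \<Rightarrow> germ \<Rightarrow> sl2z \<Rightarrow> germ" where
  "germ_slash_diff \<kappa> \<rho> \<gamma> M = germ_slash \<kappa> \<rho> \<gamma> M - germ_slash \<kappa> \<rho> \<gamma> 1"

(* (\<i> + \<tau>)^s, principal on the upper half-plane, with the branch cut running from -\<i> vertically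
   downwards.  (The cut of \<open>(\<i> + \<tau>) powr s\<close> would be the horizontal ray from -\<i> to the left.) *)
definition i_plus_powr :: "real \<Rightarrow> complex \<Rightarrow> complex" where
  "i_plus_powr s \<tau> = \<i> powr of_real s * (1 - \<i> * \<tau>) powr of_real s"

lemma i_plus_powr_upper:
  assumes "Im \<tau> > -1" shows "i_plus_powr s \<tau> = (\<i> + \<tau>) powr of_real s"
proof -
  have "\<i> * (1 - \<i> * \<tau>) = \<i> + \<tau>" by (simp add: algebra_simps)
  moreover have "(\<i> * (1 - \<i> * \<tau>)) powr of_real s = \<i> powr of_real s * (1 - \<i> * \<tau>) powr of_real s"
  proof -
    have "1 - \<i> * \<tau> \<noteq> 0" "Re (1 - \<i> * \<tau>) > 0" using assms by (auto simp: complex_eq_iff)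
    hence "\<bar>Im (Ln (1 - \<i> * \<tau>))\<bar> < pi / 2" using Re_Ln_pos_lt by blast
    hence "Ln (\<i> * (1 - \<i> * \<tau>)) = Ln \<i> + Ln (1 - \<i> * \<tau>)"
      using \<open>1 - \<i> * \<tau> \<noteq> 0\<close> by (intro Ln_times_simple) auto
    thus ?thesis using \<open>1 - \<i> * \<tau> \<noteq> 0\<close> by (simp add: powr_def distrib_left exp_add)
  qed
  ultimately show ?thesis by (simp add: i_plus_powr_def)
qed

(* The function h takes values at finite points only; it is g that has to be holomorphic at \<infinity>
   if \<infinity> lies in \<Omega>. *)
definition D_exc :: "real \<Rightarrow> complex option set \<Rightarrow> germ set" where
  "D_exc \<kappa> E = {abs_germ h | h. \<exists>\<Omega> g. openin P1C \<Omega> \<and> excised_nbhd E \<Omega> \<and> Some (- \<i>) \<notin> \<Omega> \<and>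
      P1_holomorphic_on g \<Omega> \<and> (\<forall>\<tau>. Some \<tau> \<in> \<Omega> \<longrightarrow> i_plus_powr \<kappa> \<tau> * h \<tau> = g (Some \<tau>))}"

definition D_mod :: "real \<Rightarrow> germ set" where
  "D_mod \<kappa> = (\<Union>E\<in>{E. finite E \<and> E \<subseteq> P1Q}. D_exc \<kappa> E)"


section \<open>Parabolic cohomology\<close>

definition Z1_par :: "real \<Rightarrow> (mp2 \<Rightarrow> complex) \<Rightarrow> (sl2z \<Rightarrow> germ) set" where
  "Z1_par \<kappa> \<rho> = {\<phi>. (\<forall>M. \<phi> M \<in> D_mod \<kappa>) \<and>
     (\<forall>M N. \<phi> (M * N) = germ_slash \<kappa> \<rho> (\<phi> M) N + \<phi> N) \<and>
     (\<exists>\<gamma>\<in>D_mod \<kappa>. \<phi> sl2z_T = germ_slash_diff \<kappa> \<rho> \<gamma> sl2z_T)}"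

definition B1 :: "real \<Rightarrow> (mp2 \<Rightarrow> complex) \<Rightarrow> (sl2z \<Rightarrow> germ) set" where
  "B1 \<kappa> \<rho> = {(\<lambda>M. germ_slash_diff \<kappa> \<rho> \<gamma> M) | \<gamma>. \<gamma> \<in> D_mod \<kappa>}"

definition cohomologous :: "real \<Rightarrow> (mp2 \<Rightarrow> complex) \<Rightarrow> ((sl2z \<Rightarrow> germ) \<times> (sl2z \<Rightarrow> germ)) set" where
  "cohomologous \<kappa> \<rho> = {(\<phi>, \<psi>). \<phi> \<in> Z1_par \<kappa> \<rho> \<and> \<psi> \<in> Z1_par \<kappa> \<rho> \<and> (\<lambda>M. \<phi> M - \<psi> M) \<in> B1 \<kappa> \<rho>}"

definition H1_par :: "real \<Rightarrow> (mp2 \<Rightarrow> complex) \<Rightarrow> (sl2z \<Rightarrow> germ) set set" where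
  "H1_par \<kappa> \<rho> = Z1_par \<kappa> \<rho> // cohomologous \<kappa> \<rho>"


section \<open>Modular forms and harmonic Maass forms\<close>

definition exp_growth :: "(complex \<Rightarrow> complex) \<Rightarrow> bool" where
  "exp_growth h \<longleftrightarrow> (\<exists>C. h \<in> O[filtercomap Im at_top](\<lambda>\<tau>. of_real (exp (C * Im \<tau>))))"

definition modular :: "real \<Rightarrow> (mp2 \<Rightarrow> complex) \<Rightarrow> (complex \<Rightarrow> complex) \<Rightarrow> bool" where
  "modular \<kappa> \<rho> h \<longleftrightarrow> (\<forall>M. \<forall>\<tau>\<in>upper_half. slash \<kappa> \<rho> h M \<tau> = h \<tau>)"

definition weakly_holomorphic :: "real \<Rightarrow> (mp2 \<Rightarrow> complex) \<Rightarrow> (complex \<Rightarrow> complex) set" where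
  "weakly_holomorphic \<kappa> \<rho> = {f. f holomorphic_on upper_half \<and> modular \<kappa> \<rho> f \<and> exp_growth f}"

definition d_u :: "(complex \<Rightarrow> complex) \<Rightarrow> complex \<Rightarrow> complex" where
  "d_u F \<tau> = frechet_derivative F (at \<tau>) 1"

definition d_v :: "(complex \<Rightarrow> complex) \<Rightarrow> complex \<Rightarrow> complex" where
  "d_v F \<tau> = frechet_derivative F (at \<tau>) \<i>"

definition C1_on :: "complex set \<Rightarrow> (complex \<Rightarrow> complex) \<Rightarrow> bool" where
  "C1_on S F \<longleftrightarrow> (\<forall>\<tau>\<in>S. F differentiable (at \<tau>)) \<and> continuous_on S (d_u F) \<and> continuous_on S (d_v F)"

definition C2_on :: "complex set \<Rightarrow> (complex \<Rightarrow> complex) \<Rightarrow> bool" where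
  "C2_on S F \<longleftrightarrow> C1_on S F \<and> C1_on S (d_u F) \<and> C1_on S (d_v F)"

definition hyp_laplacian :: "real \<Rightarrow> (complex \<Rightarrow> complex) \<Rightarrow> complex \<Rightarrow> complex" where
  "hyp_laplacian \<kappa> F \<tau> = - (of_real (Im \<tau>))\<^sup>2 * (d_u (d_u F) \<tau> + d_v (d_v F) \<tau>)
     + \<i> * of_real (\<kappa> * Im \<tau>) * (d_u F \<tau> + \<i> * d_v F \<tau>)"

definition harmonic_maass :: "real \<Rightarrow> (mp2 \<Rightarrow> complex) \<Rightarrow> (complex \<Rightarrow> complex) set" where
  "harmonic_maass \<kappa> \<rho> = {F. C2_on upper_half F \<and> modular \<kappa> \<rho> F \<and> exp_growth F \<and>
     (\<forall>\<tau>\<in>upper_half. hyp_laplacian \<kappa> F \<tau> = 0)}"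

definition d_taubar :: "(complex \<Rightarrow> complex) \<Rightarrow> complex \<Rightarrow> complex" where
  "d_taubar F \<tau> = (d_u F \<tau> + \<i> * d_v F \<tau>) / 2"

definition xi :: "real \<Rightarrow> (complex \<Rightarrow> complex) \<Rightarrow> complex \<Rightarrow> complex" where
  "xi \<kappa> F \<tau> = 2 * \<i> * of_real (Im \<tau> powr \<kappa>) * cnj (d_taubar F \<tau>)"

(* The generalised exponential integral: \<open>expint_slit\<close> continues the integral to the slit plane. *)
definition expint_slit :: "real \<Rightarrow> complex \<Rightarrow> complex" where
  "expint_slit \<kappa> = (SOME g. g holomorphic_on (- \<real>\<^sub>\<le>\<^sub>0) \<and>
     (\<forall>z. Re z > 0 \<longrightarrow> g z = integral {1..} (\<lambda>t. exp (- z * of_real t) * of_real (t powr (- \<kappa>)))))"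

definition expint :: "real \<Rightarrow> complex \<Rightarrow> complex" where
  "expint \<kappa> z = (if z \<in> \<real>\<^sub>\<le>\<^sub>0 then Lim (at_right 0) (\<lambda>s. expint_slit \<kappa> (z + \<i> * of_real s))
     else expint_slit \<kappa> z)"

definition W_fun :: "real \<Rightarrow> real \<Rightarrow> complex" where
  "W_fun \<kappa> x = of_real (- 2 * x) powr of_real (1 - \<kappa>) * of_real (Re (expint \<kappa> (of_real (- 2 * x))))"

abbreviation e_fun :: "real \<Rightarrow> complex \<Rightarrow> complex" where
  "e_fun n \<tau> \<equiv> exp (2 * of_real pi * \<i> * of_real n * \<tau>)"

(* A function invariant under the slash operator satisfies F(\<tau> + 1) = \<rho>(T,1) F(\<tau>), hence its
   Fourier expansion runs over these n. *)
definition fourier_index :: "(mp2 \<Rightarrow> complex) \<Rightarrow> real set" where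
  "fourier_index \<rho> = {n. e_fun n 1 = \<rho> (mp2_lift sl2z_T)}"

definition maass_expansion ::
  "real \<Rightarrow> (mp2 \<Rightarrow> complex) \<Rightarrow> (complex \<Rightarrow> complex) \<Rightarrow> (real \<Rightarrow> complex) \<Rightarrow> (real \<Rightarrow> complex) \<Rightarrow> bool" where
  "maass_expansion \<kappa> \<rho> F cp cm \<longleftrightarrow>
     (\<forall>n. n \<notin> fourier_index \<rho> \<longrightarrow> cp n = 0 \<and> cm n = 0) \<and>
     (\<forall>\<tau>\<in>upper_half. \<exists>Fp Fm.
        ((\<lambda>n. cp n * e_fun n \<tau>) has_sum Fp) (fourier_index \<rho>) \<and>
        ((\<lambda>n. cm n * W_fun \<kappa> (2 * pi * n * Im \<tau>) * e_fun n \<tau>) has_sum Fm) (fourier_index \<rho> - {0}) \<and>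
        F \<tau> = Fp + (cm 0 * of_real (Im \<tau> powr (1 - \<kappa>)) + Fm))"

definition maass_coeffs ::
  "real \<Rightarrow> (mp2 \<Rightarrow> complex) \<Rightarrow> (complex \<Rightarrow> complex) \<Rightarrow> (real \<Rightarrow> complex) \<times> (real \<Rightarrow> complex)" where
  "maass_coeffs \<kappa> \<rho> F = (THE (cp, cm). maass_expansion \<kappa> \<rho> F cp cm)"

definition maass_plus :: "real \<Rightarrow> (mp2 \<Rightarrow> complex) \<Rightarrow> (complex \<Rightarrow> complex) \<Rightarrow> complex \<Rightarrow> complex" where
  "maass_plus \<kappa> \<rho> F \<tau> = (\<Sum>\<^sub>\<infinity>n\<in>fourier_index \<rho>. fst (maass_coeffs \<kappa> \<rho> F) n * e_fun n \<tau>)"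


definition sigma_fun :: "real \<Rightarrow> (mp2 \<Rightarrow> complex) \<Rightarrow> (complex \<Rightarrow> complex) \<Rightarrow> sl2z \<Rightarrow> complex \<Rightarrow> complex" where
  "sigma_fun k \<rho> F M \<tau> =
     (let \<kappa> = 2 - k; \<rho>' = (\<lambda>x. cnj (\<rho> x)); Fp = maass_plus \<kappa> \<rho>' F
      in (- 2 * \<i>) powr of_real (k + 1) * of_real pi * (slash \<kappa> \<rho>' Fp M \<tau> - slash \<kappa> \<rho>' Fp 1 \<tau>))"

(* \<open>sigma_fun\<close> is defined on the upper half-plane only; \<open>sigma_cocycle\<close> is the germ that continues it. *)
definition sigma_cocycle :: "real \<Rightarrow> (mp2 \<Rightarrow> complex) \<Rightarrow> (complex \<Rightarrow> complex) \<Rightarrow> sl2z \<Rightarrow> germ" where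
  "sigma_cocycle k \<rho> F M = (THE \<gamma>. \<gamma> \<in> D_mod (2 - k) \<and>
     (\<forall>\<tau>\<in>upper_half. germ_upper \<gamma> \<tau> = sigma_fun k \<rho> F M \<tau>))"

end

theory Submission
  imports Defs "HOL-Real_Asymp.Real_Asymp"
begin

text \<open>
  Write \<open>\<kappa> = 2 - k\<close> and \<open>f\<^sup>c w = cnj (f (cnj w))\<close>. Up to a constant, the non-holomorphic part \<open>F\<^sup>-\<close>
  is \<open>X \<tau> (cnj \<tau>)\<close>, where \<open>X \<tau> w\<close> is a primitive in \<open>w\<close> (on the lower half-plane) of
  \<open>f\<^sup>c w \<cdot> (\<tau> - w) powr (-\<kappa>)\<close>, written as a Fourier series of incomplete gamma functions. For fixed \<open>w\<close>
  it continues holomorphically in \<open>\<tau>\<close> to the complement of the vertical ray below \<open>w\<close>, so it lies in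
  the module of germs with the single excised cusp \<open>\<infinity>\<close>. By the modularity of \<open>f\<close>, the functions
  \<open>X(\<cdot>, M w)|M\<close> and \<open>X(\<cdot>, w)\<close> have the same derivative in \<open>w\<close>, hence
  \<open>X(\<cdot>, M w)|M - X(\<cdot>, w)\<close> does not depend on \<open>w\<close>. At \<open>w = cnj \<tau>\<close> it is a multiple of
  \<open>F\<^sup>-|(M - I) = - F\<^sup>+|(M - I)\<close>, and at \<open>w = - \<i>\<close> it visibly continues to an excised neighbourhood.
  The cocycle relation is then inherited from the upper half-plane by the identity theorem, and
  \<open>\<sigma>(T) = 0\<close> because the Fourier series \<open>F\<^sup>+\<close> is invariant under \<open>T\<close>.
\<close>

section \<open>Excised neighbourhoods\<close>

text \<open>A primitive in \<open>w\<close> is determined only up to a function of \<tau>, but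
  \<open>maass_plus\<close> reads \<open>F\<^sup>+\<close> off the expansion in
  \<open>W_fun\<close>, which is unique. So the constant of integration of every Fourier term is
  forced: at \<open>w = cnj \<tau>\<close> the term must restrict to a multiple of
  \<open>W_fun\<close>, or of \<open>v powr (1 - \<kappa>)\<close> for index 0, times an
  exponential.

  Three multivalued functions have to be kept on one branch: the power of \<i> + \<tau> in the
  definition of the module, the square root of c\<tau> + d in the slash operator, and
  \<open>X\<close> itself. Their cuts are vertical rays going down, so each fits into a strip
  excised at infinity. For this reason infinity is always adjoined to the excised cusps, after which
  a germ in the module is represented by a function holomorphic on an open subset of the plane.

  The weight may be half-integral, and complex powers are not multiplicative. Products of powers are
  therefore compared as integer powers of square roots, whose sign is constant on a connected set
  and can be read off at one point.\<close>

definition at_cusp :: "complex filter" where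
  "at_cusp = filtercomap (\<lambda>\<tau>. max \<bar>Re \<tau>\<bar> (Im \<tau>)) at_top"

text \<open>Removing the strip |Re \<tau>| \<le> R, Im \<tau> < -R from the neighbourhood |Re
  \<tau>| > R or |Im \<tau>| > R of infinity leaves exactly the region on the right. One parameter
  \<open>R\<close> thus serves as radius of the neighbourhood and as both parameters of the
  strip.\<close>

lemma eventually_at_cusp:
  "eventually P at_cusp \<longleftrightarrow> (\<exists>R>0. \<forall>\<tau>. R < \<bar>Re \<tau>\<bar> \<or> R < Im \<tau> \<longrightarrow> P \<tau>)"
proof
  assume "eventually P at_cusp"
  then obtain N where N: "\<And>\<tau>. N \<le> max \<bar>Re \<tau>\<bar> (Im \<tau>) \<Longrightarrow> P \<tau>"
    unfolding at_cusp_def eventually_filtercomap_at_top_linorder by blast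
  show "\<exists>R>0. \<forall>\<tau>. R < \<bar>Re \<tau>\<bar> \<or> R < Im \<tau> \<longrightarrow> P \<tau>"
    by (rule exI[of _ "max N 1"]) (auto intro!: N)
next
  assume "\<exists>R>0. \<forall>\<tau>. R < \<bar>Re \<tau>\<bar> \<or> R < Im \<tau> \<longrightarrow> P \<tau>"
  then obtain R where R: "\<And>\<tau>. R < \<bar>Re \<tau>\<bar> \<or> R < Im \<tau> \<Longrightarrow> P \<tau>" by blast
  show "eventually P at_cusp"
    unfolding at_cusp_def eventually_filtercomap_at_top_linorder
    by (rule exI[of _ "R + 1"]) (auto intro!: R simp: le_max_iff_disj)
qed

lemma at_cusp_le_at_infinity: "at_cusp \<le> at_infinity"
  unfolding le_filter_def
proof (intro allI impI)
  fix P :: "complex \<Rightarrow> bool" assume "eventually P at_infinity"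
  then obtain b where b: "\<And>x. b \<le> norm x \<Longrightarrow> P x" by (auto simp: eventually_at_infinity)
  show "eventually P at_cusp"
    unfolding eventually_at_cusp
  proof (intro exI[of _ "max b 1"] conjI allI impI b)
    fix \<tau> :: complex assume "max b 1 < \<bar>Re \<tau>\<bar> \<or> max b 1 < Im \<tau>"
    thus "b \<le> norm \<tau>" using abs_Re_le_cmod[of \<tau>] abs_Im_le_cmod[of \<tau>] by auto
  qed simp
qed

lemma eventually_at_cusp_autfac_nonzero: "\<forall>\<^sub>F \<tau> in at_cusp. autfac M \<tau> \<noteq> 0"
  unfolding eventually_at_cusp
\<comment> \<open>The only possible zero is the real number -d/c. For c = 0 the quotient is 0 by
  convention, and then the determinant excludes a zero.\<close>
proof (intro exI[of _ "1 + \<bar>of_int (ed M) / of_int (ec M)\<bar>"] conjI allI impI notI)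
  fix \<tau> assume \<tau>: "1 + \<bar>real_of_int (ed M) / of_int (ec M)\<bar> < \<bar>Re \<tau>\<bar> \<or> 1 + \<bar>real_of_int (ed M) / of_int (ec M)\<bar> < Im \<tau>"
    and 0: "autfac M \<tau> = 0"
  have "Im \<tau> = 0" using autfac_nonzero 0 by blast
  have c: "ec M \<noteq> 0" using sl2z_act_numerator(2)[OF 0] by auto
  have "Re (autfac M \<tau>) = 0" using 0 by simp
  hence "Re \<tau> = - (of_int (ed M) / of_int (ec M))"
    using c by (simp add: autfac_def field_simps)
  moreover have "0 \<le> \<bar>real_of_int (ed M) / of_int (ec M)\<bar>" by simp
  ultimately show False using \<tau> \<open>Im \<tau> = 0\<close> by linarith
qed (simp add: add_pos_nonneg)

lemma inj_P1_act: "P1_act M x = P1_act M y \<longleftrightarrow> x = y"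
  by (metis P1_act_inv(1))

lemma openin_P1C_image_P1_act: "openin P1C U \<Longrightarrow> openin P1C (P1_act M ` U)"
proof -
  assume "openin P1C U"
  hence "openin P1C (P1_act (sl2z_inv M) -` U)" by (rule openin_P1_act_vimage)
  also have "P1_act (sl2z_inv M) -` U = P1_act M ` U"
    by (auto simp: image_iff) (metis P1_act_inv(2))
  finally show ?thesis .
qed

lemma openin_P1C_Some: "open A \<Longrightarrow> openin P1C (Some ` A)"
  unfolding openin_P1C using eventually_nhds_in_open[of A] by (simp add: image_iff)

lemma openin_P1C_insert_None:
  "open A \<Longrightarrow> \<forall>\<^sub>F w in at_infinity. w \<in> A \<Longrightarrow> openin P1C (insert None (Some ` A))"
  unfolding openin_P1C using eventually_nhds_in_open[of A] by (simp add: image_iff)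

text \<open>Membership in an excised neighbourhood can be tested locally at each point of the real
  projective line; at an excised cusp the test is pulled back to the cusp at infinity.\<close>

lemma excised_nbhdI_local:
  assumes upper: "upper_half \<subseteq> S"
    and real: "\<And>x. x \<in> \<real> \<Longrightarrow> Some x \<notin> E \<Longrightarrow> \<forall>\<^sub>F w in nhds x. w \<in> S"
    and cusp: "\<And>\<aa>. \<aa> \<in> E \<Longrightarrow> \<exists>M. P1_act M None = \<aa> \<and> (\<forall>\<^sub>F \<tau> in at_cusp. sl2z_act M \<tau> \<in> S)"
    and "None \<in> E"
  shows "excised_nbhd E (Some ` S)"
proof -
  have "\<exists>M R. P1_act M None = \<aa> \<and> R > 0 \<and>
      (\<forall>\<tau>. R < \<bar>Re \<tau>\<bar> \<or> R < Im \<tau> \<longrightarrow> autfac M \<tau> \<noteq> 0 \<and> sl2z_act M \<tau> \<in> S)" if "\<aa> \<in> E" for \<aa>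
  proof -
    obtain M where M: "P1_act M None = \<aa>" "\<forall>\<^sub>F \<tau> in at_cusp. sl2z_act M \<tau> \<in> S" using cusp \<open>\<aa> \<in> E\<close> by blast
    have "\<forall>\<^sub>F \<tau> in at_cusp. autfac M \<tau> \<noteq> 0 \<and> sl2z_act M \<tau> \<in> S"
      using eventually_at_cusp_autfac_nonzero M(2) by (rule eventually_conj)
    thus ?thesis using M(1) unfolding eventually_at_cusp by blast
  qed
  then obtain M R where MR: "\<And>\<aa>. \<aa> \<in> E \<Longrightarrow> P1_act (M \<aa>) None = \<aa> \<and> R \<aa> > 0 \<and>
      (\<forall>\<tau>. R \<aa> < \<bar>Re \<tau>\<bar> \<or> R \<aa> < Im \<tau> \<longrightarrow> autfac (M \<aa>) \<tau> \<noteq> 0 \<and> sl2z_act (M \<aa>) \<tau> \<in> S)"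
    by metis
  have "\<exists>e>0. ball x e \<subseteq> S" if "x \<in> \<real>" "Some x \<notin> E" for x
    using real[OF that] unfolding eventually_nhds_metric by (auto simp: subset_iff dist_commute)
  then obtain e where e: "\<And>x. x \<in> \<real> \<Longrightarrow> Some x \<notin> E \<Longrightarrow> e x > 0 \<and> ball x (e x) \<subseteq> S" by metis
  \<comment> \<open>\<open>B r\<close> is symmetric in the imaginary part because it has to be an
    open neighbourhood of infinity in the sphere; its portion with |Re| \<le> r that does not
    satisfy Im > r is what the excised strip removes.\<close>
  define B where "B r = insert None (Some ` {\<tau>. r < \<bar>Re \<tau>\<bar> \<or> r < \<bar>Im \<tau>\<bar>})" for r :: real

  have openB: "openin P1C (B r)" for r
  proof -
    have "open {\<tau>. r < \<bar>Re \<tau>\<bar> \<or> r < \<bar>Im \<tau>\<bar>}"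
      by (intro open_Collect_disj open_Collect_less continuous_intros)
    moreover have "\<forall>\<^sub>F \<tau> in at_infinity. r < \<bar>Re \<tau>\<bar> \<or> r < \<bar>Im \<tau>\<bar>"
      unfolding eventually_at_infinity
    proof (intro exI[of _ "2 * \<bar>r\<bar> + 1"] allI impI)
      fix \<tau> :: complex assume "2 * \<bar>r\<bar> + 1 \<le> norm \<tau>"
      thus "r < \<bar>Re \<tau>\<bar> \<or> r < \<bar>Im \<tau>\<bar>" using cmod_le[of \<tau>] by linarith
    qed
    ultimately show ?thesis
      unfolding B_def by (intro openin_P1C_insert_None) simp_all
  qed
  define U where "U = Some ` upper_half \<union> (\<Union>x\<in>{x\<in>\<real>. Some x \<notin> E}. Some ` ball x (e x))
      \<union> (\<Union>\<aa>\<in>E. P1_act (M \<aa>) ` B (R \<aa>))"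
  have "openin P1C (Some ` upper_half)"
    by (rule openin_P1C_Some) (simp add: upper_half_def open_halfspace_Im_gt)
  moreover have "openin P1C (\<Union>x\<in>{x\<in>\<real>. Some x \<notin> E}. Some ` ball x (e x))"
    by (rule openin_Union) (use openin_P1C_Some in blast)
  moreover have "openin P1C (\<Union>\<aa>\<in>E. P1_act (M \<aa>) ` B (R \<aa>))"
    by (rule openin_Union) (use openin_P1C_image_P1_act openB in blast)
  ultimately have "openin P1C U" unfolding U_def by (intro openin_Un)
  moreover have "Some ` upper_half \<union> P1R \<subseteq> U"
  proof
    fix z assume "z \<in> Some ` upper_half \<union> P1R"
    then consider "z \<in> Some ` upper_half" | "z \<in> E" | x where "z = Some x" "x \<in> \<real>" "z \<notin> E"
      using \<open>None \<in> E\<close> by (auto simp: P1R_def)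
    thus "z \<in> U"
    proof cases
      case 2
      have "P1_act (M z) None = z" using MR[OF 2] by blast
      moreover have "None \<in> B (R z)" by (simp add: B_def)
      ultimately have "z \<in> P1_act (M z) ` B (R z)" by (metis imageI)
      thus ?thesis using 2 by (auto simp: U_def)
    next
      case 3
      hence "x \<in> ball x (e x)" using e by simp
      thus ?thesis using 3 unfolding U_def by blast
    qed (auto simp: U_def)
  qed
  moreover have "U - (\<Union>\<aa>\<in>E. insert \<aa> (cusp_strip (M \<aa>) (R \<aa>) (R \<aa>))) \<subseteq> Some ` S"
  proof
    fix z assume z: "z \<in> U - (\<Union>\<aa>\<in>E. insert \<aa> (cusp_strip (M \<aa>) (R \<aa>) (R \<aa>)))"
    have "z \<in> U" using z by (rule DiffD1)
    then consider "z \<in> Some ` upper_half" | x where "x \<in> {x\<in>\<real>. Some x \<notin> E}" "z \<in> Some ` ball x (e x)"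
      | \<aa> where "\<aa> \<in> E" "z \<in> P1_act (M \<aa>) ` B (R \<aa>)"
      unfolding U_def by (elim UnE UN_E)
    thus "z \<in> Some ` S"
    proof cases
      case 1 thus ?thesis using image_mono[OF upper] by (rule subsetD[rotated])
    next
      case 2
      have "Some ` ball x (e x) \<subseteq> Some ` S" using e[of x] 2(1) by (intro image_mono) simp
      thus ?thesis using 2(2) by (rule subsetD)
    next
      case (3 \<aa>)
      from 3(2) obtain w where w: "z = P1_act (M \<aa>) w" "w \<in> B (R \<aa>)" by (rule imageE)
      note * = MR[OF 3(1)]
      have zn: "z \<notin> insert \<aa> (cusp_strip (M \<aa>) (R \<aa>) (R \<aa>))"
        using DiffD2[OF z] 3(1) by (auto simp del: insert_iff)
      have "w \<noteq> None"
      proof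
        assume "w = None"
        thus False using zn * by (simp add: w(1))
      qed
      then obtain \<tau> where \<tau>: "w = Some \<tau>" by auto
      have "\<not> (Im \<tau> < - R \<aa> \<and> \<bar>Re \<tau>\<bar> \<le> R \<aa>)"
        using zn unfolding w(1) \<tau> cusp_strip_def by auto
      hence "R \<aa> < \<bar>Re \<tau>\<bar> \<or> R \<aa> < Im \<tau>" using w(2) by (auto simp: \<tau> B_def)
      thus ?thesis using * by (auto simp: w(1) \<tau> P1_act_def)
    qed
  qed
  moreover have "P1_act (M \<aa>) None = \<aa> \<and> 0 < R \<aa> \<and> 0 < R \<aa>" if "\<aa> \<in> E" for \<aa>
    using MR[OF that] by simp
  ultimately show ?thesis
    by (intro excised_nbhdI[of U E M R R])
qed

section \<open>What an excised neighbourhood contains near real points and near cusps\<close>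

lemma excised_nbhdE:
  assumes "excised_nbhd E \<Omega>"
  obtains U M a \<epsilon> where "openin P1C U" "Some ` upper_half \<union> P1R \<subseteq> U"
    "\<And>\<aa>. \<aa> \<in> E \<Longrightarrow> P1_act (M \<aa>) None = \<aa> \<and> a \<aa> > 0 \<and> \<epsilon> \<aa> > 0"
    "\<And>z. z \<in> U \<Longrightarrow> (\<And>\<aa>. \<aa> \<in> E \<Longrightarrow> z \<notin> insert \<aa> (cusp_strip (M \<aa>) (a \<aa>) (\<epsilon> \<aa>))) \<Longrightarrow> z \<in> \<Omega>"
proof -
  from assms obtain U M a \<epsilon> where *: "openin P1C U" "Some ` upper_half \<union> P1R \<subseteq> U"
    "\<forall>\<aa>\<in>E. P1_act (M \<aa>) None = \<aa> \<and> a \<aa> > (0::real) \<and> \<epsilon> \<aa> > (0::real)"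
    "U - (\<Union>\<aa>\<in>E. insert \<aa> (cusp_strip (M \<aa>) (a \<aa>) (\<epsilon> \<aa>))) \<subseteq> \<Omega>"
    unfolding excised_nbhd_def by auto
  show thesis
    by (rule that[OF *(1,2), of M a \<epsilon>]) (use *(3,4) in blast)+
qed

lemma openin_P1C_horizontal_strip: "openin P1C (Some ` {w. \<bar>Im w\<bar> < \<epsilon>})"
proof -
  have "open {w. \<bar>Im w\<bar> < \<epsilon>}" by (intro open_Collect_less continuous_intros)
  thus ?thesis by (rule openin_P1C_Some)
qed

lemma P1Q_subset_P1R: "P1Q \<subseteq> P1R"
proof -
  have "(\<rat> :: complex set) \<subseteq> \<real>" by (auto elim!: Rats_cases')
  thus ?thesis by (auto simp: P1Q_def P1R_def)
qed

text \<open>Pulled back by \<open>M\<close>, a real point other than the cusp becomes a finite real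
  number. The open strip |Im| < \<epsilon> around the real line is a neighbourhood of it that does
  not meet Im < -\<epsilon>, so the excision is invisible near such a point.\<close>

lemma horizontal_strip_avoids_cusp_strip:
  assumes "P1_act M None = \<aa>" "\<epsilon> > 0" "P1_act (sl2z_inv M) z \<in> Some ` {w. \<bar>Im w\<bar> < \<epsilon>}"
  shows "z \<notin> insert \<aa> (cusp_strip M a \<epsilon>)"
proof
  assume "z \<in> insert \<aa> (cusp_strip M a \<epsilon>)"
  then consider "z = P1_act M None" | \<tau> where "z = P1_act M (Some \<tau>)" "Im \<tau> < - \<epsilon>"
    using assms(1) by (auto simp: cusp_strip_def)
  thus False using assms(2,3) by cases auto
qed

lemma P1_act_in_horizontal_strip:
  assumes "z \<in> P1R" "P1_act M None \<noteq> z" "\<epsilon> > 0"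
  shows "P1_act (sl2z_inv M) z \<in> Some ` {w. \<bar>Im w\<bar> < \<epsilon>}"
proof -
  have "P1_act (sl2z_inv M) z \<noteq> None" using assms(2) by (metis P1_act_inv(2))
  moreover have "P1_act (sl2z_inv M) z \<in> P1R" by (rule P1_act_P1R) fact
  ultimately obtain y where "P1_act (sl2z_inv M) z = Some y" "y \<in> \<real>" by (auto simp: P1R_def)
  thus ?thesis using assms(3) by (auto simp: complex_is_Real_iff)
qed

text \<open>Together with \<open>excised_nbhd_eventually_cusp\<close> this is the converse of
  \<open>excised_nbhdI_local\<close>. Finiteness of \<open>E\<close> allows the conditions for all
  excised cusps to hold simultaneously.\<close>

lemma excised_nbhd_eventually_real:
  assumes "excised_nbhd E \<Omega>" "finite E" "x \<in> \<real>" "Some x \<notin> E"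
  shows "\<forall>\<^sub>F w in nhds x. Some w \<in> \<Omega>"
proof -
  obtain U M a \<epsilon> where *: "openin P1C U" "Some ` upper_half \<union> P1R \<subseteq> U"
    "\<And>\<aa>. \<aa> \<in> E \<Longrightarrow> P1_act (M \<aa>) None = \<aa> \<and> a \<aa> > 0 \<and> \<epsilon> \<aa> > 0"
    "\<And>z. z \<in> U \<Longrightarrow> (\<And>\<aa>. \<aa> \<in> E \<Longrightarrow> z \<notin> insert \<aa> (cusp_strip (M \<aa>) (a \<aa>) (\<epsilon> \<aa>))) \<Longrightarrow> z \<in> \<Omega>"
    using excised_nbhdE[OF assms(1)] by blast
  have x: "Some x \<in> P1R" using assms(3) by (auto simp: P1R_def)
  have "\<forall>\<^sub>F w in nhds x. Some w \<notin> insert \<bb> (cusp_strip (M \<bb>) (a \<bb>) (\<epsilon> \<bb>))" if b: "\<bb> \<in> E" for \<bb>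
  proof -
    let ?V = "P1_act (sl2z_inv (M \<bb>)) -` (Some ` {w. \<bar>Im w\<bar> < \<epsilon> \<bb>})"
    have "Some x \<in> ?V"
      using P1_act_in_horizontal_strip[OF x, of "M \<bb>" "\<epsilon> \<bb>"] *(3)[OF b] b assms(4) by auto
    moreover have "openin P1C ?V" by (intro openin_P1_act_vimage openin_P1C_horizontal_strip)
    ultimately have "\<forall>\<^sub>F w in nhds x. Some w \<in> ?V" by (auto simp: openin_P1C)
    thus ?thesis
      by eventually_elim (use horizontal_strip_avoids_cusp_strip *(3)[OF b] in blast)
  qed
  hence "\<forall>\<^sub>F w in nhds x. \<forall>\<bb>\<in>E. Some w \<notin> insert \<bb> (cusp_strip (M \<bb>) (a \<bb>) (\<epsilon> \<bb>))"
    using assms(2) by (simp only: eventually_ball_finite_distrib) blast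
  moreover have "\<forall>\<^sub>F w in nhds x. Some w \<in> U"
    using *(1,2) x by (auto simp: openin_P1C)
  ultimately show ?thesis
    by eventually_elim (use *(4) in blast)
qed

lemma excised_nbhd_eventually_cusp:
  assumes "excised_nbhd E \<Omega>" "finite E" "E \<subseteq> P1Q" "P1_act M None \<in> E"
  shows "\<forall>\<^sub>F \<tau> in at_cusp. Some (sl2z_act M \<tau>) \<in> \<Omega>"
proof -
  obtain U K a \<epsilon> where *: "openin P1C U" "Some ` upper_half \<union> P1R \<subseteq> U"
    "\<And>\<aa>. \<aa> \<in> E \<Longrightarrow> P1_act (K \<aa>) None = \<aa> \<and> a \<aa> > 0 \<and> \<epsilon> \<aa> > 0"
    "\<And>z. z \<in> U \<Longrightarrow> (\<And>\<aa>. \<aa> \<in> E \<Longrightarrow> z \<notin> insert \<aa> (cusp_strip (K \<aa>) (a \<aa>) (\<epsilon> \<aa>))) \<Longrightarrow> z \<in> \<Omega>"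
    using excised_nbhdE[OF assms(1)] by blast
  have ev: "\<forall>\<^sub>F \<tau> in at_cusp. P1_act M (Some \<tau>) \<in> V" if "openin P1C V" "P1_act M None \<in> V" for V
    using openin_P1_act_vimage[OF that(1), of M] that(2) at_cusp_le_at_infinity
    by (auto simp: openin_P1C le_filter_def)
  have MR: "P1_act M None \<in> P1R" using assms(3,4) P1Q_subset_P1R by blast
  have "\<forall>\<^sub>F \<tau> in at_cusp. P1_act M (Some \<tau>) \<notin> insert \<bb> (cusp_strip (K \<bb>) (a \<bb>) (\<epsilon> \<bb>))" if b: "\<bb> \<in> E" for \<bb>
  proof (cases "\<bb> = P1_act M None")
    case False
    let ?V = "P1_act (sl2z_inv (K \<bb>)) -` (Some ` {w. \<bar>Im w\<bar> < \<epsilon> \<bb>})"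
    have "P1_act M None \<in> ?V"
      using P1_act_in_horizontal_strip[OF MR, of "K \<bb>" "\<epsilon> \<bb>"] *(3)[OF b] False by auto
    moreover have "openin P1C ?V" by (intro openin_P1_act_vimage openin_P1C_horizontal_strip)
    ultimately have "\<forall>\<^sub>F \<tau> in at_cusp. P1_act M (Some \<tau>) \<in> ?V" by (intro ev)
    thus ?thesis
      by eventually_elim (use horizontal_strip_avoids_cusp_strip *(3)[OF b] in blast)
  next
    case True
    \<comment> \<open>Both matrices send infinity to the same cusp, so as maps they differ by a
      translation, and the strip for \<open>K \<bb>\<close> lies in the strip for \<open>M\<close>
      widened by \<open>c\<close>.\<close>
    have "P1_act M None = P1_act (K \<bb>) None" using True *(3)[OF b] by simp
    then obtain c where c: "c \<ge> 0" "cusp_strip (K \<bb>) (a \<bb>) (\<epsilon> \<bb>) \<subseteq> cusp_strip M (a \<bb> + c) (\<epsilon> \<bb>)"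
      using cusp_strip_subset by blast
    show ?thesis unfolding eventually_at_cusp
    proof (intro exI[of _ "a \<bb> + c"] conjI allI impI notI)
      show "0 < a \<bb> + c" using *(3)[OF b] c(1) by simp
      fix \<tau> assume \<tau>: "a \<bb> + c < \<bar>Re \<tau>\<bar> \<or> a \<bb> + c < Im \<tau>"
        and "P1_act M (Some \<tau>) \<in> insert \<bb> (cusp_strip (K \<bb>) (a \<bb>) (\<epsilon> \<bb>))"
      hence "P1_act M (Some \<tau>) \<in> cusp_strip M (a \<bb> + c) (\<epsilon> \<bb>)"
        using c(2) True by (auto simp: inj_P1_act)
      hence "Im \<tau> < - \<epsilon> \<bb>" "\<bar>Re \<tau>\<bar> \<le> a \<bb> + c" by (auto simp: cusp_strip_def inj_P1_act)
      thus False using \<tau> *(3)[OF b] c(1) by linarith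
    qed
  qed
  hence "\<forall>\<^sub>F \<tau> in at_cusp. \<forall>\<bb>\<in>E. P1_act M (Some \<tau>) \<notin> insert \<bb> (cusp_strip (K \<bb>) (a \<bb>) (\<epsilon> \<bb>))"
    using assms(2) by (simp only: eventually_ball_finite_distrib) blast
  moreover have "\<forall>\<^sub>F \<tau> in at_cusp. P1_act M (Some \<tau>) \<in> U"
    by (rule ev[OF *(1)]) (use *(2) MR in blast)
  ultimately show ?thesis using eventually_at_cusp_autfac_nonzero[of M]
  proof eventually_elim
    case (elim \<tau>)
    have "P1_act M (Some \<tau>) \<in> \<Omega>" using elim *(4) by blast
    thus ?case using elim by (simp add: P1_act_def)
  qed
qed

section \<open>Germs and the slash action\<close>

lemma excised_nbhd_mono: "excised_nbhd E \<Omega> \<Longrightarrow> \<Omega> \<subseteq> \<Omega>' \<Longrightarrow> excised_nbhd E \<Omega>'"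
  unfolding excised_nbhd_def by (meson order_trans)

lemma excised_nbhd_cusp:
  assumes "excised_nbhd E \<Omega>" "\<aa> \<in> E" shows "\<exists>M. P1_act M None = \<aa>"
proof -
  from assms(1) obtain M :: "complex option \<Rightarrow> sl2z" and a \<epsilon> :: "complex option \<Rightarrow> real"
    where "\<forall>\<aa>\<in>E. P1_act (M \<aa>) None = \<aa> \<and> a \<aa> > 0 \<and> \<epsilon> \<aa> > 0"
    unfolding excised_nbhd_def by (elim exE conjE)
  thus ?thesis using assms(2) by blast
qed

text \<open>This is what permits branch cuts: a vertical ray going down from a point of the lower
  half-plane lies in such a closed half-strip, and excising infinity allows the whole half-strip to
  be removed.\<close>

lemma excised_nbhd_compl_lower_strip:
  assumes "\<epsilon> > 0"
  shows "excised_nbhd {None} (Some ` (- {\<tau>. \<bar>Re \<tau>\<bar> \<le> a \<and> Im \<tau> \<le> - \<epsilon>}))"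
proof (rule excised_nbhdI_local)
  show "upper_half \<subseteq> - {\<tau>. \<bar>Re \<tau>\<bar> \<le> a \<and> Im \<tau> \<le> - \<epsilon>}" using assms by (auto simp: upper_half_def)
  show "\<forall>\<^sub>F w in nhds x. w \<in> - {\<tau>. \<bar>Re \<tau>\<bar> \<le> a \<and> Im \<tau> \<le> - \<epsilon>}" if "x \<in> \<real>" for x
  proof (rule eventually_mono)
    have "open {w. Im w > - \<epsilon>}" by (rule open_halfspace_Im_gt)
    moreover have "x \<in> {w. Im w > - \<epsilon>}" using that assms by (simp add: complex_is_Real_iff)
    ultimately show "\<forall>\<^sub>F w in nhds x. w \<in> {w. Im w > - \<epsilon>}" by (rule eventually_nhds_in_open)
  qed auto
  have "\<forall>\<^sub>F \<tau> in at_cusp. sl2z_act 1 \<tau> \<in> - {\<tau>. \<bar>Re \<tau>\<bar> \<le> a \<and> Im \<tau> \<le> - \<epsilon>}"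
    unfolding eventually_at_cusp
    by (rule exI[of _ "\<bar>a\<bar> + 1"]) (use assms in \<open>auto simp: sl2z_act_def autfac_def\<close>)
  thus "\<exists>M. P1_act M None = \<aa> \<and> (\<forall>\<^sub>F \<tau> in at_cusp. sl2z_act M \<tau> \<in> - {\<tau>. \<bar>Re \<tau>\<bar> \<le> a \<and> Im \<tau> \<le> - \<epsilon>})"
    if "\<aa> \<in> {None}" for \<aa> using that by (intro exI[of _ 1]) auto
qed simp

lemma i_plus_powr_nonzero: "\<not> (Re \<tau> = 0 \<and> Im \<tau> \<le> -1) \<Longrightarrow> i_plus_powr s \<tau> \<noteq> 0"
proof -
  assume "\<not> (Re \<tau> = 0 \<and> Im \<tau> \<le> -1)"
  hence "1 - \<i> * \<tau> \<noteq> 0" by (auto simp: complex_eq_iff)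
  thus ?thesis by (simp add: i_plus_powr_def powr_eq_0_iff)
qed

lemma i_plus_powr_holomorphic: "i_plus_powr s holomorphic_on - {\<tau>. Re \<tau> = 0 \<and> Im \<tau> \<le> -1}"
  unfolding i_plus_powr_def
  by (intro holomorphic_intros) (auto simp: complex_nonpos_Reals_iff)

text \<open>The power of \<i> + \<tau> is holomorphic and nonzero off the ray below -\<i>. Once
  infinity is among the excised cusps, this ray may be removed from the domain, so that holomorphy
  of \<open>h\<close> alone suffices, for every weight.\<close>

lemma D_modI:
  assumes "finite E" "E \<subseteq> P1Q" "excised_nbhd E (Some ` S)" "open S" "h holomorphic_on S"
  shows "abs_germ h \<in> D_mod \<kappa>"
proof -
  define S' where "S' = S - {\<tau>. Re \<tau> = 0 \<and> Im \<tau> \<le> -1}"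
  \<comment> \<open>The value 0 at infinity is never read, because the domain consists of finite
    points.\<close>
  define g where "g = case_option 0 (\<lambda>\<tau>. i_plus_powr \<kappa> \<tau> * h \<tau>)"
  have "excised_nbhd (E \<union> {None}) (Some ` S \<inter> Some ` (- {\<tau>. \<bar>Re \<tau>\<bar> \<le> 0 \<and> Im \<tau> \<le> - 1}))"
    by (intro excised_nbhd_Int assms excised_nbhd_compl_lower_strip) simp
  also have "Some ` S \<inter> Some ` (- {\<tau>. \<bar>Re \<tau>\<bar> \<le> 0 \<and> Im \<tau> \<le> - 1}) = Some ` S'"
    by (auto simp: S'_def)
  finally have exc: "excised_nbhd (E \<union> {None}) (Some ` S')" .
  have "closed {\<tau>. Re \<tau> = 0 \<and> Im \<tau> \<le> -1}"
    by (intro closed_Collect_conj closed_Collect_eq closed_Collect_le continuous_intros)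
  hence op: "open S'" unfolding S'_def using assms(4) by (rule open_Diff[rotated])
  have "(\<lambda>\<tau>. i_plus_powr \<kappa> \<tau> * h \<tau>) holomorphic_on S'"
    by (intro holomorphic_intros holomorphic_on_subset[OF i_plus_powr_holomorphic]
        holomorphic_on_subset[OF assms(5)]) (auto simp: S'_def)
  hence hol: "(\<lambda>\<tau>. g (Some \<tau>)) holomorphic_on S'" by (simp add: g_def)
  have "((\<lambda>\<tau>. g (Some \<tau>)) \<circ> (\<lambda>w. 1 / w)) holomorphic_on {w. w \<noteq> 0 \<and> 1 / w \<in> S'}"
    by (rule holomorphic_on_compose_gen[OF _ hol]) (auto intro!: holomorphic_intros)
  hence "(\<lambda>w. g (if w = 0 then None else Some (1 / w))) holomorphic_on {w. w \<noteq> 0 \<and> 1 / w \<in> S'}"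
    by (rule holomorphic_transform) auto
  moreover have "{w. (if w = 0 then None else Some (1 / w)) \<in> Some ` S'} = {w. w \<noteq> 0 \<and> 1 / w \<in> S'}"
    by auto
  ultimately have "P1_holomorphic_on g (Some ` S')"
    using hol by (simp add: P1_holomorphic_on_def Let_def inj_image_mem_iff)
  hence "abs_germ h \<in> D_exc \<kappa> (E \<union> {None})"
    unfolding D_exc_def using exc openin_P1C_Some[OF op]
    by (intro CollectI exI[of _ h] conjI exI[of _ "Some ` S'"] exI[of _ g])
       (auto simp: S'_def g_def)
  moreover have "finite (E \<union> {None})" "E \<union> {None} \<subseteq> P1Q" using assms(1,2) by (auto simp: P1Q_def)
  ultimately show ?thesis unfolding D_mod_def by blast
qed

text \<open>Converse of \<open>D_modI\<close>: after removal of infinity and of the ray below -\<i>,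
  dividing by the power of \<i> + \<tau> recovers a holomorphic representative.\<close>

lemma D_modE:
  assumes "\<gamma> \<in> D_mod \<kappa>"
  obtains E S h where "finite E" "E \<subseteq> P1Q" "None \<in> E" "excised_nbhd E (Some ` S)" "open S"
    "h holomorphic_on S" "\<gamma> = abs_germ h"
proof -
  obtain E \<Omega> g h where *: "finite E" "E \<subseteq> P1Q" "openin P1C \<Omega>" "excised_nbhd E \<Omega>"
    "P1_holomorphic_on g \<Omega>" "\<And>\<tau>. Some \<tau> \<in> \<Omega> \<Longrightarrow> i_plus_powr \<kappa> \<tau> * h \<tau> = g (Some \<tau>)" "\<gamma> = abs_germ h"
    using assms unfolding D_mod_def D_exc_def by blast
  define S where "S = {\<tau>. Some \<tau> \<in> \<Omega>} - {\<tau>. Re \<tau> = 0 \<and> Im \<tau> \<le> -1}"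
  have "excised_nbhd (E \<union> {None}) (\<Omega> \<inter> Some ` (- {\<tau>. \<bar>Re \<tau>\<bar> \<le> 0 \<and> Im \<tau> \<le> - 1}))"
    by (intro excised_nbhd_Int * excised_nbhd_compl_lower_strip) simp
  also have "\<Omega> \<inter> Some ` (- {\<tau>. \<bar>Re \<tau>\<bar> \<le> 0 \<and> Im \<tau> \<le> - 1}) = Some ` S"
    by (auto simp: S_def)
  finally have exc: "excised_nbhd (E \<union> {None}) (Some ` S)" .
  have "closed {\<tau>. Re \<tau> = 0 \<and> Im \<tau> \<le> -1}"
    by (intro closed_Collect_conj closed_Collect_eq closed_Collect_le continuous_intros)
  moreover have "open {\<tau>. Some \<tau> \<in> \<Omega>}"
    by (subst open_subopen) (use *(3) in \<open>force simp: openin_P1C eventually_nhds\<close>)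
  ultimately have op: "open S" unfolding S_def by (intro open_Diff)
  have "(\<lambda>\<tau>. g (Some \<tau>)) holomorphic_on S"
    using *(5) by (auto simp: P1_holomorphic_on_def S_def intro: holomorphic_on_subset)
  hence "(\<lambda>\<tau>. g (Some \<tau>) / i_plus_powr \<kappa> \<tau>) holomorphic_on S"
    by (intro holomorphic_on_divide holomorphic_on_subset[OF i_plus_powr_holomorphic])
       (auto simp: S_def i_plus_powr_nonzero)
  hence "h holomorphic_on S"
    by (rule holomorphic_transform) (use *(6)[symmetric] i_plus_powr_nonzero in \<open>auto simp: S_def\<close>)
  moreover have "finite (E \<union> {None})" "E \<union> {None} \<subseteq> P1Q" using *(1,2) by (auto simp: P1Q_def)
  ultimately show thesis using that[of "E \<union> {None}" S h] exc op *(7) by blast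
qed

lemma germ_upper_abs_germ: "germ_upper (abs_germ h) = res_upper h"
  by (rule germ_upper.abs_eq)

section \<open>The identity theorem for germs\<close>

lemma connected_cusp_region: "connected {\<tau>. R < \<bar>Re \<tau>\<bar> \<or> R < Im \<tau>}"
proof -
  have "connected ({\<tau>. Re \<tau> > R} \<union> {\<tau>. Im \<tau> > R} \<union> {\<tau>. Re \<tau> < - R})"
  proof (intro connected_Un)
    have "Complex (R + 1) (R + 1) \<in> {\<tau>. Re \<tau> > R} \<inter> {\<tau>. Im \<tau> > R}" by simp
    thus "{\<tau>. Re \<tau> > R} \<inter> {\<tau>. Im \<tau> > R} \<noteq> {}" by blast
    have "Complex (- R - 1) (R + 1) \<in> ({\<tau>. Re \<tau> > R} \<union> {\<tau>. Im \<tau> > R}) \<inter> {\<tau>. Re \<tau> < - R}" by simp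
    thus "({\<tau>. Re \<tau> > R} \<union> {\<tau>. Im \<tau> > R}) \<inter> {\<tau>. Re \<tau> < - R} \<noteq> {}" by blast
  qed (intro convex_connected convex_halfspace_Re_gt convex_halfspace_Im_gt convex_halfspace_Re_lt)+
  also have "{\<tau>. Re \<tau> > R} \<union> {\<tau>. Im \<tau> > R} \<union> {\<tau>. Re \<tau> < - R} = {\<tau>. R < \<bar>Re \<tau>\<bar> \<or> R < Im \<tau>}" by auto
  finally show ?thesis .
qed

lemma connected_upper_half: "connected upper_half"
  unfolding upper_half_def by (intro convex_connected convex_halfspace_Im_gt)

text \<open>Pieces of the domain that do not hang together with the upper half-plane can be
  discarded: a small ball around a real point and the image of a cusp region are connected and meet
  the upper half-plane, hence lie in the component of \<i>.\<close>

lemma excised_nbhd_connected_component: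
  assumes "finite E" "E \<subseteq> P1Q" "None \<in> E" "excised_nbhd E (Some ` S)"
  shows "excised_nbhd E (Some ` connected_component_set S \<i>)"
proof (rule excised_nbhdI_local)
  define C where "C = connected_component_set S \<i>"
  have i: "\<i> \<in> upper_half" by (simp add: upper_half_def)
  have upS: "upper_half \<subseteq> S" using excised_nbhd_upper[OF assms(4,2)] by blast
  show upC: "upper_half \<subseteq> connected_component_set S \<i>"
    using i connected_upper_half upS by (rule connected_component_maximal)
  have grow: "A \<subseteq> C" if A: "connected A" "A \<subseteq> S" "A \<inter> upper_half \<noteq> {}" for A
  proof -
    have "connected (A \<union> upper_half)" using A connected_upper_half by (intro connected_Un) auto
    hence "A \<union> upper_half \<subseteq> C" unfolding C_def
      using A upS i by (intro connected_component_maximal) auto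
    thus ?thesis by blast
  qed
  show "\<forall>\<^sub>F w in nhds x. w \<in> connected_component_set S \<i>" if x: "x \<in> \<real>" "Some x \<notin> E" for x
  proof -
    have "\<forall>\<^sub>F w in nhds x. Some w \<in> Some ` S"
      by (rule excised_nbhd_eventually_real[OF assms(4,1) x])
    then obtain e where e: "e > 0" "ball x e \<subseteq> S"
      unfolding eventually_nhds_metric by (metis (no_types, lifting) dist_commute imageE mem_ball option.inject subsetI)
    have "x + \<i> * of_real (e / 2) \<in> ball x e \<inter> upper_half"
      using e x by (auto simp: upper_half_def dist_norm norm_mult complex_is_Real_iff)
    hence "ball x e \<subseteq> C" using e by (intro grow) auto
    thus ?thesis
      unfolding C_def using e(1) by (intro eventually_mono[OF eventually_nhds_ball[OF e(1)]]) auto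
  qed
  show "\<exists>M. P1_act M None = \<aa> \<and> (\<forall>\<^sub>F \<tau> in at_cusp. sl2z_act M \<tau> \<in> connected_component_set S \<i>)"
    if "\<aa> \<in> E" for \<aa>
  proof -
    from excised_nbhd_cusp[OF assms(4) that] obtain M where M: "P1_act M None = \<aa>" ..
    have "\<forall>\<^sub>F \<tau> in at_cusp. Some (sl2z_act M \<tau>) \<in> Some ` S"
      by (rule excised_nbhd_eventually_cusp[OF assms(4,1,2)]) (use M that in simp)
    hence "\<forall>\<^sub>F \<tau> in at_cusp. autfac M \<tau> \<noteq> 0 \<and> sl2z_act M \<tau> \<in> S"
      using eventually_at_cusp_autfac_nonzero[of M] by eventually_elim auto
    then obtain R where R: "R > 0"
      "\<And>\<tau>. \<tau> \<in> {\<tau>. R < \<bar>Re \<tau>\<bar> \<or> R < Im \<tau>} \<Longrightarrow> autfac M \<tau> \<noteq> 0 \<and> sl2z_act M \<tau> \<in> S"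
      unfolding eventually_at_cusp by blast
    let ?A = "{\<tau>. R < \<bar>Re \<tau>\<bar> \<or> R < Im \<tau>}"
    have "sl2z_act M ` ?A \<subseteq> C"
    proof (rule grow)
      show "connected (sl2z_act M ` ?A)"
      proof (rule connected_continuous_image[OF _ connected_cusp_region])
        have "continuous_on ?A (\<lambda>\<tau>. (of_int (ea M) * \<tau> + of_int (eb M)) / autfac M \<tau>)"
          using R(2) unfolding autfac_def by (intro continuous_intros) blast
        thus "continuous_on ?A (sl2z_act M)" by (simp add: sl2z_act_def[abs_def])
      qed
      show "sl2z_act M ` ?A \<subseteq> S" using R(2) by blast
      have "Complex 0 (R + 1) \<in> ?A \<inter> upper_half" using R(1) by (simp add: upper_half_def)
      thus "sl2z_act M ` ?A \<inter> upper_half \<noteq> {}" using sl2z_act_upper by blast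
    qed
    thus ?thesis using M R(1) unfolding eventually_at_cusp C_def by blast
  qed
qed (rule assms(3))

text \<open>The common domain of two representatives may be disconnected, but equality of germs only
  has to be checked on some excised neighbourhood. The component containing the upper half-plane is
  one, and there analytic continuation is unique.\<close>

lemma D_mod_eqI:
  assumes "\<gamma> \<in> D_mod \<kappa>" "\<gamma>' \<in> D_mod \<kappa>'"
    and "\<And>\<tau>. \<tau> \<in> upper_half \<Longrightarrow> germ_upper \<gamma> \<tau> = germ_upper \<gamma>' \<tau>"
  shows "\<gamma> = \<gamma>'"
proof -
  obtain E S h where 1: "finite E" "E \<subseteq> P1Q" "None \<in> E" "excised_nbhd E (Some ` S)" "open S"
    "h holomorphic_on S" "\<gamma> = abs_germ h" using D_modE[OF assms(1)] .
  obtain E' S' h' where 2: "finite E'" "E' \<subseteq> P1Q" "None \<in> E'" "excised_nbhd E' (Some ` S')" "open S'"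
    "h' holomorphic_on S'" "\<gamma>' = abs_germ h'" using D_modE[OF assms(2)] .
  define C where "C = connected_component_set (S \<inter> S') \<i>"
  have "excised_nbhd (E \<union> E') (Some ` S \<inter> Some ` S')" by (rule excised_nbhd_Int[OF 1(4) 2(4)])
  hence "excised_nbhd (E \<union> E') (Some ` (S \<inter> S'))" by (simp add: image_Int)
  hence exc: "excised_nbhd (E \<union> E') (Some ` C)"
    unfolding C_def using 1 2 by (intro excised_nbhd_connected_component) auto
  have sub: "C \<subseteq> S" "C \<subseteq> S'" unfolding C_def using connected_component_subset by blast+
  have "open C" unfolding C_def using 1(5) 2(5) by (intro open_connected_component open_Int)
  have up: "upper_half \<subseteq> C"
    using excised_nbhd_upper[OF exc] 1(2) 2(2) by blast
  have "h z = h' z" if "z \<in> C" for z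
  proof (rule analytic_continuation_open[of upper_half C h h'])
    show "open upper_half" by (simp add: upper_half_def open_halfspace_Im_gt)
    show "upper_half \<noteq> {}" by (auto simp: upper_half_def intro: exI[of _ \<i>])
    show "connected C" by (simp add: C_def)
    show "h holomorphic_on C" "h' holomorphic_on C"
      using 1(6) 2(6) sub by (auto intro: holomorphic_on_subset)
    show "h z = h' z" if "z \<in> upper_half" for z
      using assms(3)[OF that] that by (simp add: 1(7) 2(7) germ_upper_abs_germ res_upper_def)
  qed fact+
  hence "germ_eq h h'"
    unfolding germ_eq_def using exc 1(1,2) 2(1,2)
    by (intro exI[of _ "E \<union> E'"] exI[of _ "Some ` C"]) auto
  thus ?thesis by (simp add: 1(7) 2(7) germ.abs_eq_iff)
qed

section \<open>Stability of the module under addition and under the slash action\<close>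

lemma
  assumes "\<gamma> \<in> D_mod \<kappa>" "\<gamma>' \<in> D_mod \<kappa>"
  shows D_mod_add: "\<gamma> + \<gamma>' \<in> D_mod \<kappa>" and D_mod_diff: "\<gamma> - \<gamma>' \<in> D_mod \<kappa>"
proof -
  obtain E S h where 1: "finite E" "E \<subseteq> P1Q" "None \<in> E" "excised_nbhd E (Some ` S)" "open S"
    "h holomorphic_on S" "\<gamma> = abs_germ h" using D_modE[OF assms(1)] .
  obtain E' S' h' where 2: "finite E'" "E' \<subseteq> P1Q" "None \<in> E'" "excised_nbhd E' (Some ` S')" "open S'"
    "h' holomorphic_on S'" "\<gamma>' = abs_germ h'" using D_modE[OF assms(2)] .
  have exc: "excised_nbhd (E \<union> E') (Some ` (S \<inter> S'))"
    using excised_nbhd_Int[OF 1(4) 2(4)] by (simp add: image_Int)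
  have hol: "h holomorphic_on S \<inter> S'" "h' holomorphic_on S \<inter> S'"
    using 1(6) 2(6) by (auto intro: holomorphic_on_subset)
  have "abs_germ (\<lambda>\<tau>. h \<tau> + h' \<tau>) \<in> D_mod \<kappa>"
    by (rule D_modI[OF _ _ exc]) (use 1 2 hol in \<open>auto intro!: holomorphic_intros\<close>)
  thus "\<gamma> + \<gamma>' \<in> D_mod \<kappa>" by (simp add: 1(7) 2(7) plus_germ.abs_eq)
  have "abs_germ (\<lambda>\<tau>. h \<tau> - h' \<tau>) \<in> D_mod \<kappa>"
    by (rule D_modI[OF _ _ exc]) (use 1 2 hol in \<open>auto intro!: holomorphic_intros\<close>)
  thus "\<gamma> - \<gamma>' \<in> D_mod \<kappa>" by (simp add: 1(7) 2(7) minus_germ.abs_eq)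
qed

lemma zero_in_D_mod: "0 \<in> D_mod \<kappa>"
proof -
  have "excised_nbhd {None} (Some ` UNIV)"
    by (rule excised_nbhd_mono[OF excised_nbhd_compl_lower_strip[of 1 0]]) auto
  thus ?thesis
    unfolding zero_germ.abs_eq by (intro D_modI[of "{None}" UNIV]) (auto simp: P1Q_def)
qed

text \<open>The ray going down from -d/c, the preimage of infinity under \<open>M\<close>. The
  factors \<i> and -\<i> in \<open>sqrt_autfac\<close> turn the principal cut into this ray for
  either sign of c; for c = 0 the root is constant and there is nothing to cut.\<close>

definition sqrt_cut :: "sl2z \<Rightarrow> complex set" where
  "sqrt_cut M = {\<tau>. ec M \<noteq> 0 \<and> Re (autfac M \<tau>) = 0 \<and> Im \<tau> \<le> 0}"

lemma closed_sqrt_cut: "closed (sqrt_cut M)"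
  unfolding sqrt_cut_def autfac_def
  by (intro closed_Collect_conj closed_Collect_const closed_Collect_eq closed_Collect_le continuous_intros)

lemma sqrt_autfac_holomorphic_off_cut: "sqrt_autfac M holomorphic_on - sqrt_cut M"
proof -
  consider "ec M > 0" | "ec M < 0" | "ec M = 0" by linarith
  thus ?thesis
  proof cases
    case 1
    have "(\<lambda>\<tau>. csqrt \<i> * csqrt (- \<i> * autfac M \<tau>)) holomorphic_on - sqrt_cut M"
      unfolding autfac_def
      by (intro holomorphic_intros)
         (use 1 in \<open>auto simp: sqrt_cut_def autfac_def complex_nonpos_Reals_iff mult_le_0_iff\<close>)
    thus ?thesis using 1 by (simp add: sqrt_autfac_def[abs_def])
  next
    case 2
    have "(\<lambda>\<tau>. csqrt (- \<i>) * csqrt (\<i> * autfac M \<tau>)) holomorphic_on - sqrt_cut M"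
      unfolding autfac_def
      by (intro holomorphic_intros)
         (use 2 in \<open>auto simp: sqrt_cut_def autfac_def complex_nonpos_Reals_iff zero_le_mult_iff\<close>)
    thus ?thesis using 2 by (simp add: sqrt_autfac_def[abs_def])
  next
    case 3
    thus ?thesis by (simp add: sqrt_autfac_def[abs_def])
  qed
qed

lemma sqrt_autfac_nonzero: "autfac M \<tau> \<noteq> 0 \<Longrightarrow> sqrt_autfac M \<tau> \<noteq> 0"
  using sqrt_autfac_square[of M \<tau>] by auto

lemma eventually_at_cusp_Re_autfac:
  assumes "ec M \<noteq> 0" shows "\<forall>\<^sub>F \<tau> in at_cusp. Re (autfac M \<tau>) \<noteq> 0 \<or> Im \<tau> > 0"
  unfolding eventually_at_cusp
proof (intro exI[of _ "1 + \<bar>of_int (ed M) / of_int (ec M)\<bar>"] conjI allI impI)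
  fix \<tau> assume \<tau>: "1 + \<bar>real_of_int (ed M) / of_int (ec M)\<bar> < \<bar>Re \<tau>\<bar> \<or> 1 + \<bar>real_of_int (ed M) / of_int (ec M)\<bar> < Im \<tau>"
  show "Re (autfac M \<tau>) \<noteq> 0 \<or> Im \<tau> > 0"
  proof (rule ccontr)
    assume *: "\<not> (Re (autfac M \<tau>) \<noteq> 0 \<or> Im \<tau> > 0)"
    hence "Re \<tau> = - (of_int (ed M) / of_int (ec M))"
      using assms by (simp add: autfac_def field_simps)
    moreover have "0 \<le> \<bar>real_of_int (ed M) / of_int (ec M)\<bar>" by simp
    ultimately show False using \<tau> * by linarith
  qed
qed (simp add: add_pos_nonneg)

text \<open>The cut runs into the cusp \<open>M\<^sup>-\<^sup>1(\<infinity>)\<close> inside the strip excised there, and leaves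
  through the strip excised at infinity.\<close>

lemma excised_nbhd_sqrt_cut:
  "excised_nbhd {None, P1_act (sl2z_inv M) None} (Some ` (- sqrt_cut M))"
proof (rule excised_nbhdI_local)
  show "upper_half \<subseteq> - sqrt_cut M" by (auto simp: upper_half_def sqrt_cut_def)
next
  fix x assume x: "x \<in> \<real>" "Some x \<notin> {None, P1_act (sl2z_inv M) None}"
  have "x \<in> - sqrt_cut M"
  proof (cases "ec M = 0")
    case False
    have "autfac M x \<noteq> 0"
    proof
      assume "autfac M x = 0"
      hence "P1_act M (Some x) = None" by (simp add: P1_act_def)
      hence "Some x = P1_act (sl2z_inv M) None" by (metis P1_act_inv(1))
      thus False using x by simp
    qed
    moreover have "Im (autfac M x) = 0" using x(1) by (simp add: autfac_def complex_is_Real_iff)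
    ultimately show ?thesis by (auto simp: sqrt_cut_def complex_eq_iff)
  qed (simp add: sqrt_cut_def)
  thus "\<forall>\<^sub>F w in nhds x. w \<in> - sqrt_cut M"
    using closed_sqrt_cut by (intro eventually_nhds_in_open) (auto simp: open_Compl)
next
  fix \<aa> assume "\<aa> \<in> {None, P1_act (sl2z_inv M) None}"
  then consider "\<aa> = P1_act 1 None" | "\<aa> = P1_act (sl2z_inv M) None" by auto
  thus "\<exists>K. P1_act K None = \<aa> \<and> (\<forall>\<^sub>F \<tau> in at_cusp. sl2z_act K \<tau> \<in> - sqrt_cut M)"
  proof cases
    case 1
    have "\<forall>\<^sub>F \<tau> in at_cusp. sl2z_act 1 \<tau> \<in> - sqrt_cut M"
    proof (cases "ec M = 0")
      case False
      show ?thesis using eventually_at_cusp_Re_autfac[OF False]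
        by eventually_elim (auto simp: sqrt_cut_def sl2z_act_def autfac_def)
    qed (simp add: sqrt_cut_def)
    thus ?thesis using 1 by blast
  next
    case 2
    have "\<forall>\<^sub>F \<tau> in at_cusp. sl2z_act (sl2z_inv M) \<tau> \<in> - sqrt_cut M"
    proof (cases "ec M = 0")
      case False
      hence "ec (sl2z_inv M) \<noteq> 0" by simp
      from eventually_at_cusp_Re_autfac[OF this] eventually_at_cusp_autfac_nonzero[of "sl2z_inv M"]
      show ?thesis
      proof eventually_elim
        case (elim \<tau>)
        let ?w = "sl2z_act (sl2z_inv M) \<tau>" and ?j = "autfac (sl2z_inv M) \<tau>"
        \<comment> \<open>At the point ?w, c\<tau> + d is the inverse of the automorphy factor of
          the inverse matrix, and inversion preserves non-vanishing of the real part. So avoiding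
          the cut near its starting point amounts to avoiding the cut of the inverse matrix far
          out.\<close>
        have "autfac M ?w * ?j = 1"
          using autfac_mult[OF elim(2), of M] by (simp add: autfac_def[of 1])
        hence w: "autfac M ?w = inverse ?j" using elim(2) by (simp add: field_simps)
        have "Im ?w > 0" if "Im \<tau> > 0" using that elim(2) by (simp add: Im_sl2z_act)
        moreover have "Re (autfac M ?w) \<noteq> 0" if "Re ?j \<noteq> 0"
        proof -
          have "Re ?j ^ 2 + Im ?j ^ 2 \<noteq> 0" using that by (simp add: sum_power2_eq_zero_iff)
          thus ?thesis using that by (simp add: w)
        qed
        ultimately show ?case using elim(1) by (auto simp: sqrt_cut_def)
      qed
    qed (simp add: sqrt_cut_def)
    thus ?thesis using 2 by blast
  qed
qed simp

text \<open>The strips of the given germ move to the preimages of its cusps, and the branch cut of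
  the automorphy factor adds its two ends, infinity and the preimage of infinity. The weights of
  slash operator and module may differ, since by \<open>D_modI\<close> the module condition reduces
  to holomorphy.\<close>

lemma D_mod_slash:
  assumes "\<gamma> \<in> D_mod \<kappa>"
  shows "germ_slash \<kappa>' \<rho> \<gamma> M \<in> D_mod \<kappa>"
proof -
  obtain E S h where 1: "finite E" "E \<subseteq> P1Q" "None \<in> E" "excised_nbhd E (Some ` S)" "open S"
    "h holomorphic_on S" "\<gamma> = abs_germ h" using D_modE[OF assms] .
  define A where "A = {\<tau>. autfac M \<tau> \<noteq> 0}"
  define S' where "S' = (A \<inter> sl2z_act M -` S) \<inter> - sqrt_cut M"
  define E' where "E' = insert None (P1_act M -` E) \<union> {None, P1_act (sl2z_inv M) None}"
  have opA: "open A" unfolding A_def autfac_def by (intro open_Collect_neq continuous_intros)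
  have act: "sl2z_act M holomorphic_on A"
    unfolding sl2z_act_def autfac_def A_def by (intro holomorphic_intros) (simp add: autfac_def)
  have "open (A \<inter> sl2z_act M -` S)"
    using continuous_open_preimage[OF holomorphic_on_imp_continuous_on[OF act] opA 1(5)] .
  hence op: "open S'" unfolding S'_def using closed_sqrt_cut[of M] by (rule open_Int[OF _ open_Compl])
  have "finite (P1_act M -` E)"
    by (intro finite_vimageI 1(1) inj_on_inverseI[where g = "P1_act (sl2z_inv M)"]) simp
  hence fin: "finite E'" by (simp add: E'_def)
  have N: "None \<in> P1Q" by (simp add: P1Q_def)
  have "P1_act M -` E \<subseteq> P1Q"
    using P1_act_P1Q[of "P1_act M _" "sl2z_inv M"] 1(2) by auto
  moreover have "P1_act (sl2z_inv M) None \<in> P1Q" using N by (rule P1_act_P1Q)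
  ultimately have E'Q: "E' \<subseteq> P1Q" using N by (auto simp: E'_def)
  have "excised_nbhd (insert (P1_act 1 None) (P1_act M -` E)) (P1_act M -` (Some ` S) - {P1_act 1 None})"
    by (intro excised_nbhd_remove excised_nbhd_vimage 1(4))
  hence "excised_nbhd E' ((P1_act M -` (Some ` S) - {P1_act 1 None}) \<inter> Some ` (- sqrt_cut M))"
    unfolding E'_def using excised_nbhd_sqrt_cut[of M] by (intro excised_nbhd_Int) auto
  hence exc: "excised_nbhd E' (Some ` S')"
    by (rule excised_nbhd_mono) (auto simp: S'_def A_def P1_act_def split: if_splits)
  have "(h \<circ> sl2z_act M) holomorphic_on S'"
    by (rule holomorphic_on_compose_gen[OF holomorphic_on_subset[OF act] 1(6)]) (auto simp: S'_def)
  hence "slash \<kappa>' \<rho> h M holomorphic_on S'"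
    unfolding slash_def[abs_def]
    by (intro holomorphic_intros holomorphic_on_subset[OF sqrt_autfac_holomorphic_off_cut])
       (auto simp: S'_def o_def A_def sqrt_autfac_nonzero)
  thus ?thesis
    unfolding 1(7) germ_slash.abs_eq by (intro D_modI[OF fin E'Q exc op])
qed

lemma abs_germ_exhaust: obtains h where "\<gamma> = abs_germ h"
  by (induction \<gamma> rule: germ.abs_induct) blast

lemma germ_upper_slash:
  assumes "\<tau> \<in> upper_half"
  shows "germ_upper (germ_slash \<kappa> \<rho> \<gamma> M) \<tau> = slash \<kappa> \<rho> (germ_upper \<gamma>) M \<tau>"
proof -
  obtain h where h: "\<gamma> = abs_germ h" by (rule abs_germ_exhaust)
  show ?thesis
    using assms sl2z_act_upper[OF assms, of M]
    by (simp add: h germ_slash.abs_eq germ_upper_abs_germ res_upper_def slash_def)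
qed

lemma germ_upper_add: "germ_upper (\<gamma> + \<gamma>') \<tau> = germ_upper \<gamma> \<tau> + germ_upper \<gamma>' \<tau>"
  and germ_upper_diff: "germ_upper (\<gamma> - \<gamma>') \<tau> = germ_upper \<gamma> \<tau> - germ_upper \<gamma>' \<tau>"
proof -
  obtain h h' where h: "\<gamma> = abs_germ h" "\<gamma>' = abs_germ h'" by (metis abs_germ_exhaust)
  show "germ_upper (\<gamma> + \<gamma>') \<tau> = germ_upper \<gamma> \<tau> + germ_upper \<gamma>' \<tau>"
    "germ_upper (\<gamma> - \<gamma>') \<tau> = germ_upper \<gamma> \<tau> - germ_upper \<gamma>' \<tau>"
    by (simp_all add: h plus_germ.abs_eq minus_germ.abs_eq germ_upper_abs_germ res_upper_def)
qed

lemma germ_upper_zero: "germ_upper 0 \<tau> = 0"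
  by (simp add: zero_germ.abs_eq germ_upper_abs_germ res_upper_def)

section \<open>The incomplete gamma function\<close>

lemma norm_powr_of_real: "norm (z powr of_real r) = norm z powr r" for z :: complex
  by (simp add: norm_powr_real_powr')

lemma has_field_derivative_powr_of_real:
  "z \<notin> \<real>\<^sub>\<le>\<^sub>0 \<Longrightarrow> ((\<lambda>z. z powr of_real s) has_field_derivative of_real s * z powr of_real (s - 1)) (at z)"
  for z :: complex
  by (auto intro!: derivative_eq_intros)

lemma not_nonpos_Reals_add_nonneg: "z \<notin> \<real>\<^sub>\<le>\<^sub>0 \<Longrightarrow> 0 \<le> s \<Longrightarrow> z + of_real s \<notin> \<real>\<^sub>\<le>\<^sub>0" for z :: complex
  by (auto simp: complex_nonpos_Reals_iff)

text \<open>The slit plane is starlike, so every holomorphic function on it has a primitive.\<close>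

lemma slit_primitive:
  assumes "f holomorphic_on - \<real>\<^sub>\<le>\<^sub>0"
  shows "\<exists>g. \<forall>z. z \<notin> \<real>\<^sub>\<le>\<^sub>0 \<longrightarrow> (g has_field_derivative f z) (at z)"
proof -
  have eq: "(- \<real>\<^sub>\<le>\<^sub>0 :: complex set) = - (complex_of_real ` {..0})"
    by (auto simp: nonpos_Reals_def image_iff)
  have op: "open (- \<real>\<^sub>\<le>\<^sub>0 :: complex set)" using closed_nonpos_Reals_complex by (simp add: open_Compl)
  have "starlike (- \<real>\<^sub>\<le>\<^sub>0 :: complex set)" unfolding eq by (rule starlike_slotted_complex_plane_left)
  hence "\<exists>g. \<forall>z\<in>- \<real>\<^sub>\<le>\<^sub>0. (g has_field_derivative f z) (at z)"
    using assms op
    by (intro holomorphic_starlike_primitive[where k = "{}"] holomorphic_on_imp_continuous_on)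
       (auto simp: holomorphic_on_open field_differentiable_def)
  thus ?thesis by blast
qed

text \<open>The incomplete gamma function \<open>\<Gamma>(1 - \<kappa>, z)\<close> on the slit plane.\<close>

definition upper_gamma :: "real \<Rightarrow> complex \<Rightarrow> complex" where
  "upper_gamma \<kappa> z = z powr of_real (1 - \<kappa>) * expint_slit \<kappa> z"

text \<open>\<open>expint_slit\<close> is a \<open>SOME\<close>, so nothing is known about it until
  an admissible function has been produced. \<open>G\<close> is an arbitrary primitive of the
  integrand of the incomplete gamma function, from which that function will be built.\<close>

context
  fixes \<kappa> :: real and G :: "complex \<Rightarrow> complex"
  assumes \<kappa>: "\<kappa> \<ge> 0"
    and G: "\<And>z. z \<notin> \<real>\<^sub>\<le>\<^sub>0 \<Longrightarrow> (G has_field_derivative - (z powr of_real (- \<kappa>) * exp (- z))) (at z)"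
begin

text \<open>Along the ray to the right the derivative has norm at most \<delta>^(-\<kappa>) exp(-Re
  z - s), because \<kappa> is nonnegative and \<delta> bounds the distance from 0 from below. The
  right-hand side is the integral of this bound.\<close>

lemma gamma_primitive_horizontal:
  assumes "z \<notin> \<real>\<^sub>\<le>\<^sub>0" "\<delta> > 0" "\<And>s. s \<ge> 0 \<Longrightarrow> \<delta> \<le> norm (z + of_real s)" "L \<ge> 0"
  shows "norm (G (z + of_real L) - G z) \<le> \<delta> powr (- \<kappa>) * exp (- Re z) - \<delta> powr (- \<kappa>) * exp (- Re z - L)"
proof (cases "L = 0")
  case False
  define f where "f s = - ((z + of_real s) powr of_real (- \<kappa>) * exp (- (z + of_real s)))" for s
  have der: "((\<lambda>s. G (z + of_real s)) has_vector_derivative f s) (at s)" if "s \<ge> 0" for s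
  proof -
    have "(G has_field_derivative f s) (at (z + of_real s))"
      unfolding f_def by (rule G[OF not_nonpos_Reals_add_nonneg[OF assms(1) that]])
    moreover have "((\<lambda>s. z + of_real s) has_vector_derivative 1) (at s)"
      by (auto intro!: derivative_eq_intros)
    ultimately have "((G \<circ> (\<lambda>s. z + of_real s)) has_vector_derivative 1 * f s) (at s)"
      by (rule field_vector_diff_chain_at[rotated])
    thus ?thesis by (simp add: o_def)
  qed
  have "norm (G (z + of_real L) - G (z + of_real 0))
      \<le> - (\<delta> powr (- \<kappa>) * exp (- Re z - L)) - - (\<delta> powr (- \<kappa>) * exp (- Re z - 0))"
  proof (rule differentiable_bound_general[where f' = f and \<phi>' = "\<lambda>s. \<delta> powr (- \<kappa>) * exp (- Re z - s)"])
    show "0 < L" using False assms(4) by simp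
    show "continuous_on {0..L} (\<lambda>s. G (z + of_real s))"
      using der by (intro continuous_at_imp_continuous_on ballI has_vector_derivative_continuous) auto
    show "norm (f s) \<le> \<delta> powr (- \<kappa>) * exp (- Re z - s)" if "0 < s" for s
    proof -
      have "norm (z + of_real s) powr (- \<kappa>) \<le> \<delta> powr (- \<kappa>)"
        using assms(2,3) \<kappa> that by (intro powr_mono2') auto
      thus ?thesis by (simp add: f_def norm_mult norm_powr_of_real del: of_real_minus)
    qed
    show "((\<lambda>s. - (\<delta> powr (- \<kappa>) * exp (- Re z - s))) has_vector_derivative \<delta> powr (- \<kappa>) * exp (- Re z - s)) (at s)" for s
      unfolding has_real_derivative_iff_has_vector_derivative[symmetric]
      by (auto intro!: derivative_eq_intros)
  qed (use der in \<open>auto intro!: continuous_intros\<close>)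
  thus ?thesis by simp
qed simp

lemma gamma_primitive_vertical:
  assumes "Re z \<ge> 1"
  shows "norm (G z - G (of_real (Re z))) \<le> exp (- Re z) * \<bar>Im z\<bar>"
proof -
  define S where "S = {w. Re w \<ge> Re z} \<inter> {w. Re w \<le> Re z}"
  have "norm (G z - G (of_real (Re z))) \<le> exp (- Re z) * norm (z - of_real (Re z))"
  proof (rule field_differentiable_bound)
    show "convex S" by (simp add: S_def convex_Int convex_halfspace_Re_ge convex_halfspace_Re_le)
    fix w assume w: "w \<in> S"
    show "(G has_field_derivative - (w powr of_real (- \<kappa>) * exp (- w))) (at w within S)"
      by (rule has_field_derivative_at_within[OF G]) 
         (use w assms in \<open>auto simp: S_def complex_nonpos_Reals_iff\<close>)
    have "1 \<le> norm w" using w assms complex_Re_le_cmod[of w] by (simp add: S_def)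
    hence "norm w powr (- \<kappa>) \<le> 1 powr (- \<kappa>)" using \<kappa> by (intro powr_mono2') auto
    moreover have "Re w = Re z" using w by (simp add: S_def)
    ultimately show "norm (- (w powr of_real (- \<kappa>) * exp (- w))) \<le> exp (- Re z)"
      by (simp add: norm_mult norm_powr_of_real del: of_real_minus)
  qed (auto simp: S_def)
  also have "norm (z - of_real (Re z)) = \<bar>Im z\<bar>" by (simp add: cmod_def)
  finally show ?thesis .
qed

text \<open>A vertical move to the real axis costs at most |Im z| exp(-Re z); along the real axis
  the horizontal estimate makes \<open>G\<close> Cauchy at infinity.\<close>

lemma gamma_primitive_limit:
  "\<exists>l. \<forall>z. Re z \<ge> 1 \<longrightarrow> norm (G z - l) \<le> (1 + \<bar>Im z\<bar>) * exp (- Re z)"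
proof -
  have bd: "norm (G (of_real y) - G (of_real x)) \<le> exp (- x)" if "1 \<le> x" "x \<le> y" for x y
  proof -
    have "norm (G (of_real x + of_real (y - x)) - G (of_real x))
       \<le> 1 powr (- \<kappa>) * exp (- Re (of_real x)) - 1 powr (- \<kappa>) * exp (- Re (of_real x) - (y - x))"
    proof (rule gamma_primitive_horizontal)
      show "1 \<le> norm (complex_of_real x + of_real s)" if "s \<ge> 0" for s
        using that \<open>1 \<le> x\<close> by (simp flip: of_real_add)
    qed (use that in \<open>auto simp: complex_nonpos_Reals_iff\<close>)
    also have "\<dots> \<le> exp (- x)" by simp
    finally show ?thesis by simp
  qed
  define X where "X n = G (of_real (1 + real n))" for n
  have "Cauchy X"
  proof (rule metric_CauchyI)
    fix e :: real assume e: "e > 0"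
    have "(\<lambda>n. exp (- (1 + real n))) \<longlonglongrightarrow> 0" by real_asymp
    hence "\<forall>\<^sub>F n in sequentially. exp (- (1 + real n)) < e / 2"
      by (rule order_tendstoD) (use e in simp)
    then obtain N where N: "exp (- (1 + real N)) < e / 2" by (auto simp: eventually_sequentially)
    have "norm (X n - X N) < e / 2" if "n \<ge> N" for n
      using bd[of "1 + real N" "1 + real n"] N that by (simp add: X_def)
    hence "dist (X n) (X N) < e / 2" if "n \<ge> N" for n using that by (simp add: dist_norm)
    thus "\<exists>M. \<forall>m\<ge>M. \<forall>n\<ge>M. dist (X m) (X n) < e"
      by (intro exI[of _ N]) (metis dist_triangle_half_l)
  qed
  then obtain l where l: "X \<longlonglongrightarrow> l" using Cauchy_convergent convergent_def by blast
  have real: "norm (G (of_real x) - l) \<le> exp (- x)" if "1 \<le> x" for x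
  proof (rule tendsto_upperbound)
    show "((\<lambda>n. norm (G (of_real x) - X n)) \<longlongrightarrow> norm (G (of_real x) - l)) sequentially"
      by (intro tendsto_intros l)
    show "\<forall>\<^sub>F n in sequentially. norm (G (of_real x) - X n) \<le> exp (- x)"
      using eventually_ge_at_top[of "nat \<lceil>x\<rceil>"]
    proof eventually_elim
      case (elim n)
      hence "x \<le> 1 + real n" by linarith
      thus ?case using bd[OF that, of "1 + real n"] by (simp add: X_def norm_minus_commute)
    qed
  qed simp
  show ?thesis
  proof (intro exI[of _ l] allI impI)
    fix z :: complex assume z: "Re z \<ge> 1"
    have "norm (G z - l) \<le> norm (G z - G (of_real (Re z))) + norm (G (of_real (Re z)) - l)"
      using norm_triangle_ineq[of "G z - G (of_real (Re z))" "G (of_real (Re z)) - l"] by simp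
    also have "\<dots> \<le> exp (- Re z) * \<bar>Im z\<bar> + exp (- Re z)"
      by (intro add_mono gamma_primitive_vertical real z)
    finally show "norm (G z - l) \<le> (1 + \<bar>Im z\<bar>) * exp (- Re z)" by (simp add: algebra_simps)
  qed
qed

text \<open>The constant of integration is now fixed by the requirement that the limit at plus
  infinity be 0. This singles out \<Gamma>(1 - \<kappa>, z).\<close>

context
  assumes lim: "\<And>z. Re z \<ge> 1 \<Longrightarrow> norm (G z) \<le> (1 + \<bar>Im z\<bar>) * exp (- Re z)"
begin

text \<open>Let L tend to infinity in the horizontal estimate. The bound also covers Re z < 0, where
  the ray to the right passes the origin at distance at least \<delta>.\<close>

lemma gamma_primitive_bound:
  assumes "z \<notin> \<real>\<^sub>\<le>\<^sub>0" "\<delta> > 0" "\<And>s. s \<ge> 0 \<Longrightarrow> \<delta> \<le> norm (z + of_real s)"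
  shows "norm (G z) \<le> \<delta> powr (- \<kappa>) * exp (- Re z)"
proof (rule tendsto_lowerbound)
  have "((\<lambda>L. \<delta> powr (- \<kappa>) * exp (- Re z) + (1 + \<bar>Im z\<bar>) * exp (- Re z - L))
      \<longlongrightarrow> \<delta> powr (- \<kappa>) * exp (- Re z) + (1 + \<bar>Im z\<bar>) * 0) at_top"
  proof (intro tendsto_intros)
    show "((\<lambda>L. exp (- Re z - L)) \<longlongrightarrow> 0) at_top" by real_asymp
  qed
  thus "((\<lambda>L. \<delta> powr (- \<kappa>) * exp (- Re z) + (1 + \<bar>Im z\<bar>) * exp (- Re z - L))
      \<longlongrightarrow> \<delta> powr (- \<kappa>) * exp (- Re z)) at_top" by simp
  show "\<forall>\<^sub>F L in at_top. norm (G z) \<le> \<delta> powr (- \<kappa>) * exp (- Re z) + (1 + \<bar>Im z\<bar>) * exp (- Re z - L)"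
    using eventually_ge_at_top[of "\<bar>Re z\<bar> + 1"]
  proof eventually_elim
    case (elim L)
    have "norm (G z) \<le> norm (G (z + of_real L) - G z) + norm (G (z + of_real L))"
      by (metis add.commute norm_minus_commute norm_triangle_sub)
    also have "norm (G (z + of_real L) - G z) \<le> \<delta> powr (- \<kappa>) * exp (- Re z) - \<delta> powr (- \<kappa>) * exp (- Re z - L)"
      by (rule gamma_primitive_horizontal[OF assms]) (use elim in auto)
    also have "\<dots> \<le> \<delta> powr (- \<kappa>) * exp (- Re z)" by simp
    also have "norm (G (z + of_real L)) \<le> (1 + \<bar>Im z\<bar>) * exp (- Re z - L)"
      using lim[of "z + of_real L"] elim by auto
    finally show ?case by simp
  qed
qed simp

text \<open>By the substitution zt, the function \<open>H\<close> is a primitive of the integrand: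
  the factor \<open>z powr (\<kappa> - 1)\<close> cancels the z from the chain rule and the z in the
  power. Dominated convergence passes from [1, 1 + n] to the half-line.\<close>

lemma gamma_primitive_integral:
  assumes z: "Re z > 0"
  shows "((\<lambda>t. exp (- z * of_real t) * of_real (t powr (- \<kappa>))) has_integral z powr of_real (\<kappa> - 1) * G z) {1..}"
proof -
  define f where "f t = exp (- z * of_real t) * of_real (t powr (- \<kappa>))" for t :: real
  define H where "H t = - (z powr of_real (\<kappa> - 1) * G (z * of_real t))" for t :: real
  have z0: "z \<noteq> 0" using z by auto
  have zt: "z * of_real t \<notin> \<real>\<^sub>\<le>\<^sub>0" if "t > 0" for t
    using that z by (auto simp: complex_nonpos_Reals_iff mult_le_0_iff)
  have powr_zt: "(z * of_real t) powr s = z powr s * of_real t powr s" if "t > 0" for t s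
    using that powr_times_real_left[of "of_real t" z s] by (simp add: mult.commute)
  have der: "(H has_vector_derivative f t) (at t)" if t: "t > 0" for t
  proof -
    have "((\<lambda>w. - (z powr of_real (\<kappa> - 1) * G (z * w))) has_field_derivative
       z powr of_real (\<kappa> - 1) * ((z * of_real t) powr of_real (- \<kappa>) * exp (- (z * of_real t)) * z)) (at (of_real t))"
    proof -
      have "((\<lambda>w. G (z * w)) has_field_derivative
          - ((z * of_real t) powr of_real (- \<kappa>) * exp (- (z * of_real t))) * z) (at (of_real t))"
        by (rule DERIV_chain2[where f = G and g = "\<lambda>w. z * w", OF G[OF zt[OF t]]])
           (auto intro!: derivative_eq_intros)
      from DERIV_minus[OF DERIV_cmult[OF this, of "z powr of_real (\<kappa> - 1)"]]
      show ?thesis by (simp only: mult_minus_left mult_minus_right minus_minus)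
    qed
    also have "z powr of_real (\<kappa> - 1) * ((z * of_real t) powr of_real (- \<kappa>) * exp (- (z * of_real t)) * z) =
        (z powr of_real (\<kappa> - 1) * z powr of_real (- \<kappa>) * z) * (of_real t powr of_real (- \<kappa>)) * exp (- (z * of_real t))"
      by (subst powr_zt[OF t]) (simp only: mult_ac)
    also have "z powr of_real (\<kappa> - 1) * z powr of_real (- \<kappa>) * z = 1"
      using z0 by (simp add: powr_minus powr_diff)
    also have "of_real t powr of_real (- \<kappa>) = complex_of_real (t powr (- \<kappa>))"
      using t by (simp only: powr_of_real less_imp_le)
    finally show ?thesis
      unfolding H_def[abs_def] f_def
      by (intro has_vector_derivative_real_field) (simp add: mult_ac)
  qed
  have fin: "(f has_integral H (1 + real n) - H 1) {1..1 + real n}" for n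
    by (rule fundamental_theorem_of_calculus) (auto intro!: has_vector_derivative_at_within der)
  have "(f has_integral 0 - H 1) {1..}"
  proof (rule has_integral_dominated_convergence)
    show "((\<lambda>t. if t \<in> {1..1 + real n} then f t else 0) has_integral H (1 + real n) - H 1) {1..}" for n
      by (subst has_integral_restrict) (use fin in auto)
    show "(\<lambda>t. exp (- Re z * t)) integrable_on {1..}"
      using has_integral_exp_minus_to_infinity[OF z, of 1] by (auto simp: integrable_on_def)
    have "norm (f t) \<le> exp (- Re z * t)" if "t \<ge> 1" for t
    proof -
      have "t powr (- \<kappa>) \<le> 1 powr (- \<kappa>)" using that \<kappa> by (intro powr_mono2') auto
      thus ?thesis by (simp add: f_def norm_mult)
    qed
    thus "\<forall>t\<in>{1..}. norm (if t \<in> {1..1 + real n} then f t else 0) \<le> exp (- Re z * t)" for n by auto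
    show "\<forall>t\<in>{1..}. (\<lambda>n. if t \<in> {1..1 + real n} then f t else 0) \<longlonglongrightarrow> f t"
    proof
      fix t :: real
      assume "t \<in> {1..}"
      have "\<forall>\<^sub>F n in sequentially. (if t \<in> {1..1 + real n} then f t else 0) = f t"
        using eventually_ge_at_top[of "nat \<lceil>t\<rceil>"]
      proof eventually_elim
        case (elim n)
        hence "t \<le> 1 + real n" by linarith
        thus ?case using \<open>t \<in> {1..}\<close> by simp
      qed
      thus "(\<lambda>n. if t \<in> {1..1 + real n} then f t else 0) \<longlonglongrightarrow> f t" by (rule tendsto_eventually)
    qed
    have "(\<lambda>n. G (z * of_real (1 + real n))) \<longlonglongrightarrow> 0"
    proof (rule Lim_null_comparison)
      show "\<forall>\<^sub>F n in sequentially. norm (G (z * of_real (1 + real n)))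
          \<le> (1 + \<bar>Im z\<bar> * (1 + real n)) * exp (- (Re z * (1 + real n)))"
        using eventually_ge_at_top[of "nat \<lceil>1 / Re z\<rceil>"]
      proof eventually_elim
        case (elim n)
        hence "1 / Re z \<le> 1 + real n" by linarith
        hence "1 \<le> Re z * (1 + real n)" using z by (simp add: field_simps)
        thus ?case using lim[of "z * of_real (1 + real n)"] by (simp add: abs_mult)
      qed
      show "(\<lambda>n. (1 + \<bar>Im z\<bar> * (1 + real n)) * exp (- (Re z * (1 + real n)))) \<longlonglongrightarrow> 0"
        using z by real_asymp
    qed
    hence "(\<lambda>n. - (z powr of_real (\<kappa> - 1) * G (z * of_real (1 + real n))) - H 1)
       \<longlonglongrightarrow> - (z powr of_real (\<kappa> - 1) * 0) - H 1"
      by (intro tendsto_intros)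
    thus "(\<lambda>n. H (1 + real n) - H 1) \<longlonglongrightarrow> 0 - H 1" by (simp add: H_def)
  qed
  thus ?thesis by (simp add: f_def[abs_def] H_def)
qed

text \<open>Resolves the \<open>SOME\<close> in \<open>expint_slit\<close>: \<open>g\<close> is an
  admissible choice, and any two admissible choices agree for Re z > 0, hence on the connected slit
  plane.\<close>

lemma gamma_primitive_eq_upper_gamma:
  assumes "z \<notin> \<real>\<^sub>\<le>\<^sub>0"
  shows "upper_gamma \<kappa> z = G z"
proof -
  define g where "g z = z powr of_real (\<kappa> - 1) * G z" for z
  have Ghol: "G holomorphic_on - \<real>\<^sub>\<le>\<^sub>0"
    by (intro holomorphic_onI) (use G in \<open>auto simp: field_differentiable_def intro: DERIV_subset\<close>)
  have ghol: "g holomorphic_on - \<real>\<^sub>\<le>\<^sub>0"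
    unfolding g_def by (intro holomorphic_intros Ghol) auto
  have gint: "g z = integral {1..} (\<lambda>t. exp (- z * of_real t) * of_real (t powr (- \<kappa>)))" if "Re z > 0" for z
    using gamma_primitive_integral[OF that] by (simp add: g_def integral_unique)
  have *: "expint_slit \<kappa> holomorphic_on (- \<real>\<^sub>\<le>\<^sub>0) \<and>
     (\<forall>z. Re z > 0 \<longrightarrow> expint_slit \<kappa> z = integral {1..} (\<lambda>t. exp (- z * of_real t) * of_real (t powr (- \<kappa>))))"
    unfolding expint_slit_def by (rule someI[of _ g]) (use ghol gint in blast)
  have "expint_slit \<kappa> z = g z"
  proof (rule analytic_continuation_open[of "{z. Re z > 0}" "- \<real>\<^sub>\<le>\<^sub>0" "expint_slit \<kappa>" g])
    show "open {z. Re z > 0}" by (rule open_halfspace_Re_gt)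
    show "open (- \<real>\<^sub>\<le>\<^sub>0 :: complex set)" by (simp add: open_Compl)
    have "1 \<in> {z. Re z > 0}" by simp
    thus "{z. Re z > 0} \<noteq> {}" by blast
    have "(- \<real>\<^sub>\<le>\<^sub>0 :: complex set) = - (complex_of_real ` {..0})"
      by (auto simp: nonpos_Reals_def image_iff)
    thus "connected (- \<real>\<^sub>\<le>\<^sub>0 :: complex set)"
      using starlike_imp_connected[OF starlike_slotted_complex_plane_left[of 0]] by simp
    show "{z. Re z > 0} \<subseteq> - \<real>\<^sub>\<le>\<^sub>0" by (auto simp: complex_nonpos_Reals_iff)
  qed (use * ghol gint assms in auto)
  moreover have "z \<noteq> 0" using assms by auto
  ultimately show ?thesis
    by (simp add: upper_gamma_def g_def powr_diff)
qed

end
end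

lemma upper_gamma:
  assumes "\<kappa> \<ge> 0"
  shows has_field_derivative_upper_gamma: "z \<notin> \<real>\<^sub>\<le>\<^sub>0 \<Longrightarrow>
      (upper_gamma \<kappa> has_field_derivative - (z powr of_real (- \<kappa>) * exp (- z))) (at z)"
    and upper_gamma_bound: "z \<notin> \<real>\<^sub>\<le>\<^sub>0 \<Longrightarrow> \<delta> > 0 \<Longrightarrow> (\<And>s. s \<ge> 0 \<Longrightarrow> \<delta> \<le> norm (z + of_real s)) \<Longrightarrow>
      norm (upper_gamma \<kappa> z) \<le> \<delta> powr (- \<kappa>) * exp (- Re z)"
    and upper_gamma_integral: "Re z > 0 \<Longrightarrow>
      ((\<lambda>t. exp (- z * of_real t) * of_real (t powr (- \<kappa>))) has_integral expint_slit \<kappa> z) {1..}"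
proof -
  have "(\<lambda>z. - (z powr of_real (- \<kappa>) * exp (- z))) holomorphic_on - \<real>\<^sub>\<le>\<^sub>0"
    by (intro holomorphic_intros) auto
  from slit_primitive[OF this] obtain G0 where G0: "\<And>z :: complex. z \<notin> \<real>\<^sub>\<le>\<^sub>0 \<Longrightarrow>
      (G0 has_field_derivative - (z powr of_real (- \<kappa>) * exp (- z))) (at z)" by metis
  from gamma_primitive_limit[OF assms G0]
  obtain l where l: "\<And>z. Re z \<ge> 1 \<Longrightarrow> norm (G0 z - l) \<le> (1 + \<bar>Im z\<bar>) * exp (- Re z)" by metis
  define G where "G z = G0 z - l" for z
  have G: "(G has_field_derivative - (z powr of_real (- \<kappa>) * exp (- z))) (at z)" if "z \<notin> \<real>\<^sub>\<le>\<^sub>0" for z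
    unfolding G_def[abs_def] using G0[OF that] by (auto intro!: derivative_eq_intros)
  have lim: "norm (G z) \<le> (1 + \<bar>Im z\<bar>) * exp (- Re z)" if "Re z \<ge> 1" for z
    using l[OF that] by (simp add: G_def)
  have eq: "upper_gamma \<kappa> z = G z" if "z \<notin> \<real>\<^sub>\<le>\<^sub>0" for z
    using gamma_primitive_eq_upper_gamma[OF assms G lim] that by blast
  show "(upper_gamma \<kappa> has_field_derivative - (z powr of_real (- \<kappa>) * exp (- z))) (at z)" if z: "z \<notin> \<real>\<^sub>\<le>\<^sub>0"
    by (rule has_field_derivative_transform_within_open[where S = "- \<real>\<^sub>\<le>\<^sub>0", OF G[OF z]])
       (use z eq in \<open>auto simp: open_Compl\<close>)
  show "norm (upper_gamma \<kappa> z) \<le> \<delta> powr (- \<kappa>) * exp (- Re z)"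
    if "z \<notin> \<real>\<^sub>\<le>\<^sub>0" "\<delta> > 0" "\<And>s. s \<ge> 0 \<Longrightarrow> \<delta> \<le> norm (z + of_real s)"
    using gamma_primitive_bound[of \<kappa> G z \<delta>] assms G lim that eq[OF that(1)] by simp
  show "((\<lambda>t. exp (- z * of_real t) * of_real (t powr (- \<kappa>))) has_integral expint_slit \<kappa> z) {1..}"
    if "Re z > 0"
  proof -
    have "z \<notin> \<real>\<^sub>\<le>\<^sub>0" "z \<noteq> 0" using that by (auto simp: complex_nonpos_Reals_iff)
    hence "z powr of_real (\<kappa> - 1) * G z = expint_slit \<kappa> z"
      by (simp add: eq[symmetric] upper_gamma_def powr_diff)
    thus ?thesis using gamma_primitive_integral[of \<kappa> G z] assms G lim that by simp
  qed
qed

section \<open>The functions \<open>W_fun\<close> as restrictions of primitives to the positive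
  axis\<close>

lemma powr_of_real_pos_mult: "a > 0 \<Longrightarrow> (of_real a * z) powr w = of_real a powr w * z powr w" for z w :: complex
  by (rule powr_times_real_left) auto

lemma powr_uminus_lower:
  fixes y w :: complex
  assumes "Im y < 0"
  shows "(- y) powr w = exp (\<i> * of_real pi * w) * y powr w"
proof -
  have "y \<noteq> 0" using assms by auto
  moreover have "Ln (- y) = Ln y + \<i> * of_real pi" using assms \<open>y \<noteq> 0\<close> by (simp add: Ln_minus)
  ultimately show ?thesis by (simp add: powr_def exp_add[symmetric] algebra_simps)
qed

lemma powr_of_real_neg:
  assumes "r > 0"
  shows "of_real (- r) powr w = exp (\<i> * of_real pi * w) * of_real r powr w"
proof -
  have "Ln (- complex_of_real r) = Ln (of_real r) + \<i> * of_real pi" using assms by (simp add: Ln_minus)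
  thus ?thesis using assms by (simp add: powr_def exp_add[symmetric] algebra_simps)
qed

text \<open>The integrand is real for positive r, so taking the real part in \<open>W_fun\<close>
  changes nothing here.\<close>

lemma expint_real_pos:
  assumes "r > 0" "\<kappa> \<ge> 0"
  shows "of_real (Re (expint \<kappa> (of_real r))) = expint_slit \<kappa> (of_real r)"
proof -
  have "((\<lambda>t. Im (exp (- of_real r * of_real t) * of_real (t powr (- \<kappa>)))) has_integral
      Im (expint_slit \<kappa> (of_real r))) {1..}"
    using has_integral_linear[OF upper_gamma_integral[of \<kappa> "of_real r"] bounded_linear_Im] assms
    by (simp add: o_def)
  moreover have "Im (exp (- of_real r * of_real t) * of_real (t powr (- \<kappa>))) = 0" for t
  proof -
    have "exp (- of_real r * of_real t) * of_real (t powr (- \<kappa>)) = complex_of_real (exp (- r * t) * t powr (- \<kappa>))"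
      by (simp flip: exp_of_real)
    thus ?thesis by (simp only: Im_complex_of_real)
  qed
  ultimately have "((\<lambda>t. 0) has_integral Im (expint_slit \<kappa> (of_real r))) {1::real..}" by (simp only:)
  hence "Im (expint_slit \<kappa> (of_real r)) = 0" using has_integral_unique has_integral_0 by blast
  moreover have "of_real r \<notin> (\<real>\<^sub>\<le>\<^sub>0 :: complex set)" using assms by (simp add: complex_nonpos_Reals_iff)
  ultimately show ?thesis by (simp add: expint_def complex_eq_iff)
qed

lemma W_fun_neg:
  assumes "x < 0" "\<kappa> \<ge> 0"
  shows "W_fun \<kappa> x = upper_gamma \<kappa> (of_real (- 2 * x))"
  using expint_real_pos[of "- 2 * x" \<kappa>] assms by (simp add: W_fun_def upper_gamma_def)

text \<open>On the negative axis \<open>W_fun\<close> involves the boundary values of the exponential integral from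
  above; taking the real part removes the constant by which the two boundary values differ.\<close>

lemma W_fun_pos:
  assumes "\<kappa> \<ge> 0" and K: "\<And>y. y \<notin> \<real>\<^sub>\<le>\<^sub>0 \<Longrightarrow> (K has_field_derivative y powr of_real (- \<kappa>) * exp y) (at y)"
  shows "\<exists>C. \<forall>x>0. W_fun \<kappa> x = exp (- (\<i> * of_real (pi * \<kappa>))) * (K (of_real (2 * x)) + C)"
proof -
  let ?e = "exp (\<i> * of_real pi * of_real (\<kappa> - 1)) :: complex"
  \<comment> \<open>For Im y < 0 the argument of -y is that of y plus \<pi>, so (-y)^(-\<kappa>)
    equals \<omega> times y^(-\<kappa>).\<close>
  define \<omega> where "\<omega> = exp (- (\<i> * of_real (pi * \<kappa>)))"
  have \<omega>1: "?e * \<omega> = -1"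
  proof -
    have "?e * \<omega> = exp (- (\<i> * of_real pi))"
      unfolding \<omega>_def exp_add[symmetric] by (simp add: algebra_simps)
    thus ?thesis by (simp add: exp_minus exp_pi_i')
  qed
  have \<omega>2: "exp (\<i> * of_real pi * of_real (1 - \<kappa>)) = - \<omega>"
  proof -
    have "exp (\<i> * of_real pi * of_real (1 - \<kappa>)) = exp (\<i> * of_real pi) * \<omega>"
      unfolding \<omega>_def exp_add[symmetric] by (simp add: algebra_simps)
    thus ?thesis by (simp add: exp_pi_i')
  qed
  define L where "L = {y. Im y < 0}"
  have Lslit: "y \<notin> \<real>\<^sub>\<le>\<^sub>0" "- y \<notin> \<real>\<^sub>\<le>\<^sub>0" if "y \<in> L" for y
    using that by (auto simp: L_def complex_nonpos_Reals_iff)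
  \<comment> \<open>In the lower half-plane neither y nor -y meets the cut, and the two functions
    have the same derivative there; \<open>C1\<close> is their difference.\<close>
  have const: "((\<lambda>y. upper_gamma \<kappa> (- y) - \<omega> * K y) has_field_derivative 0) (at y within L)" if y: "y \<in> L" for y
  proof -
    have "((\<lambda>y. upper_gamma \<kappa> (- y)) has_field_derivative
        - ((- y) powr of_real (- \<kappa>) * exp (- (- y))) * (- 1)) (at y)"
      by (rule DERIV_chain2[where f = "upper_gamma \<kappa>" and g = "\<lambda>y. - y",
            OF has_field_derivative_upper_gamma[OF assms(1) Lslit(2)[OF y]]])
         (auto intro!: derivative_eq_intros)
    moreover have "((\<lambda>y. \<omega> * K y) has_field_derivative \<omega> * (y powr of_real (- \<kappa>) * exp y)) (at y)"
      by (rule DERIV_cmult[OF K[OF Lslit(1)[OF y]]])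
    ultimately have "((\<lambda>y. upper_gamma \<kappa> (- y) - \<omega> * K y) has_field_derivative
        - ((- y) powr of_real (- \<kappa>) * exp (- (- y))) * (- 1) - \<omega> * (y powr of_real (- \<kappa>) * exp y)) (at y)"
      by (rule DERIV_diff)
    moreover have "(- y) powr of_real (- \<kappa>) = \<omega> * y powr of_real (- \<kappa>)"
      using powr_uminus_lower[of y "of_real (- \<kappa>)"] y by (simp add: L_def \<omega>_def mult_ac)
    ultimately have "((\<lambda>y. upper_gamma \<kappa> (- y) - \<omega> * K y) has_field_derivative 0) (at y)" by simp
    thus ?thesis by (rule has_field_derivative_at_within)
  qed
  have "convex L" unfolding L_def by (rule convex_halfspace_Im_lt)
  from has_field_derivative_zero_constant[OF this const]
  obtain C1 where C1: "\<And>y. y \<in> L \<Longrightarrow> upper_gamma \<kappa> (- y) - \<omega> * K y = C1" by blast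
  define C2 where "C2 = ?e * C1"
  \<comment> \<open>The derivative of \<open>K\<close> is real on the positive axis. Hence the real
    part of K(r) is K(r) - \<i> Im K(1), which rewrites the real part in \<open>W_fun\<close> in
    terms of the holomorphic function \<open>K\<close> itself.\<close>
  have Kreal: "Im (K (of_real r)) = Im (K 1)" if "r > 0" for r :: real
  proof -
    have "((\<lambda>r. Im (K (of_real r))) has_field_derivative 0) (at r within {0<..})" if "r \<in> {0<..}" for r :: real
    proof -
      have "complex_of_real r \<notin> \<real>\<^sub>\<le>\<^sub>0" using that by (simp add: complex_nonpos_Reals_iff)
      from has_vector_derivative_real_field[OF K[OF this]]
      have "((\<lambda>r. K (of_real r)) has_vector_derivative of_real r powr of_real (- \<kappa>) * exp (of_real r)) (at r)" .
      from bounded_linear.has_vector_derivative[OF bounded_linear_Im this]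
      have "((\<lambda>r. Im (K (of_real r))) has_vector_derivative Im (of_real r powr of_real (- \<kappa>) * exp (of_real r))) (at r)" .
      moreover have "of_real r powr of_real (- \<kappa>) = complex_of_real (r powr (- \<kappa>))"
        using that by (simp only: powr_of_real less_imp_le greaterThan_iff)
      ultimately have "((\<lambda>r. Im (K (of_real r))) has_vector_derivative 0) (at r)"
        by (simp only: exp_of_real flip: of_real_mult) simp
      thus ?thesis
        by (simp only: has_real_derivative_iff_has_vector_derivative) (rule has_vector_derivative_at_within)
    qed
    hence "\<exists>c. \<forall>r\<in>{0<..}. Im (K (of_real r)) = c"
      by (intro has_field_derivative_zero_constant) auto
    then obtain c where "\<And>r. r > 0 \<Longrightarrow> Im (K (of_real r)) = c" by auto
    from this[OF that] this[of 1] show ?thesis by simp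
  qed
  have "W_fun \<kappa> x = \<omega> * (K (of_real (2 * x)) + (- (\<i> * of_real (Im (K 1))) - of_real (Re C2)))" if x: "x > 0" for x
  proof -
    define r where "r = 2 * x"
    have r: "r > 0" "-2 * x = - r" using x by (simp_all add: r_def)
    have rs: "complex_of_real r \<notin> \<real>\<^sub>\<le>\<^sub>0" using r by (simp add: complex_nonpos_Reals_iff)
    \<comment> \<open>The point -r + \<i>s above the cut is -y for y = r - \<i>s in the lower
      half-plane, so the boundary value from above is the limit as y tends to r, where
      \<open>K\<close> is continuous.\<close>
    let ?y = "\<lambda>s. of_real r - \<i> * complex_of_real s"
    have eq: "expint_slit \<kappa> (of_real (- r) + \<i> * of_real s) =
       ?e * (?y s) powr of_real (\<kappa> - 1)
        * (\<omega> * K (?y s) + C1)" if s: "s > 0" for s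
    proof -
      define y where "y = of_real r - \<i> * complex_of_real s"
      have y: "Im y < 0" "y \<in> L" "y \<noteq> 0" using s r by (auto simp: y_def L_def complex_eq_iff)
      have "upper_gamma \<kappa> (- y) = \<omega> * K y + C1" using C1[OF y(2)] by (simp add: algebra_simps)
      moreover have "expint_slit \<kappa> (- y) = (- y) powr of_real (\<kappa> - 1) * upper_gamma \<kappa> (- y)"
        using y(3) by (simp add: upper_gamma_def powr_diff)
      ultimately show ?thesis
        using powr_uminus_lower[OF y(1)] by (simp add: y_def algebra_simps)
    qed
    have lim: "(?y \<longlongrightarrow> of_real r) (at_right 0)"
      by (auto intro!: tendsto_eq_intros)
    have "isCont K (of_real r)" using K[OF rs] by (rule DERIV_isCont)
    hence limK: "((\<lambda>s. K (?y s)) \<longlongrightarrow> K (of_real r)) (at_right 0)"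
      by (rule isCont_tendsto_compose[OF _ lim])
    have "isCont (\<lambda>z. z powr of_real (\<kappa> - 1)) (complex_of_real r)"
      using has_field_derivative_powr_of_real[OF rs] by (rule DERIV_isCont)
    hence limp: "((\<lambda>s. (?y s) powr of_real (\<kappa> - 1)) \<longlongrightarrow> of_real r powr of_real (\<kappa> - 1)) (at_right 0)"
      by (rule isCont_tendsto_compose[OF _ lim])
    have "((\<lambda>s. ?e * (?y s) powr of_real (\<kappa> - 1)
        * (\<omega> * K (?y s) + C1)) \<longlongrightarrow>
        ?e * of_real r powr of_real (\<kappa> - 1) * (\<omega> * K (of_real r) + C1)) (at_right 0)"
      by (intro tendsto_intros limK limp)
    moreover have "\<forall>\<^sub>F s in at_right 0. ?e * (?y s) powr of_real (\<kappa> - 1)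
        * (\<omega> * K (?y s) + C1) = expint_slit \<kappa> (of_real (- r) + \<i> * of_real s)"
      using eventually_at_right_less[of 0] by eventually_elim (rule eq[symmetric])
    ultimately have "((\<lambda>s. expint_slit \<kappa> (of_real (- r) + \<i> * of_real s)) \<longlongrightarrow>
        ?e * of_real r powr of_real (\<kappa> - 1) * (\<omega> * K (of_real r) + C1)) (at_right 0)"
      by (rule Lim_transform_eventually)
    hence "Lim (at_right 0) (\<lambda>s. expint_slit \<kappa> (of_real (- r) + \<i> * of_real s)) =
        ?e * of_real r powr of_real (\<kappa> - 1) * (\<omega> * K (of_real r) + C1)"
      by (intro tendsto_Lim) auto
    moreover have "complex_of_real (- r) \<in> \<real>\<^sub>\<le>\<^sub>0" using r by (simp add: complex_nonpos_Reals_iff)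
    ultimately have "expint \<kappa> (of_real (- r)) =
        of_real r powr of_real (\<kappa> - 1) * ((?e * \<omega>) * K (of_real r) + C2)"
      by (simp only: expint_def if_True C2_def) (simp only: algebra_simps)
    also have "of_real r powr of_real (\<kappa> - 1) = complex_of_real (r powr (\<kappa> - 1))"
      using r by (simp only: powr_of_real less_imp_le)
    finally have "expint \<kappa> (of_real (- r)) = of_real (r powr (\<kappa> - 1)) * ((- 1) * K (of_real r) + C2)"
      by (simp only: \<omega>1)
    hence "Re (expint \<kappa> (of_real (- r))) = r powr (\<kappa> - 1) * (- Re (K (of_real r)) + Re C2)"
      by simp
    hence "W_fun \<kappa> x = of_real (- r) powr of_real (1 - \<kappa>) * of_real (r powr (\<kappa> - 1) * (- Re (K (of_real r)) + Re C2))"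
      by (simp add: W_fun_def r(2)[simplified])
    also have "of_real (- r) powr of_real (1 - \<kappa>) = - \<omega> * of_real (r powr (1 - \<kappa>))"
      unfolding powr_of_real_neg[OF r(1)] \<omega>2 using r by (simp only: powr_of_real less_imp_le)
    also have "- \<omega> * of_real (r powr (1 - \<kappa>)) * of_real (r powr (\<kappa> - 1) * (- Re (K (of_real r)) + Re C2))
       = - \<omega> * of_real (r powr (1 - \<kappa>) * r powr (\<kappa> - 1)) * of_real (- Re (K (of_real r)) + Re C2)"
      by simp
    also have "r powr (1 - \<kappa>) * r powr (\<kappa> - 1) = 1" using r by (simp flip: powr_add)
    also have "complex_of_real (- Re (K (of_real r)) + Re C2) = - (K (of_real r) - \<i> * of_real (Im (K 1))) + of_real (Re C2)"
      using Kreal[OF r(1)] by (simp add: complex_eq_iff)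
    finally show ?thesis by (simp add: r_def algebra_simps)
  qed
  thus ?thesis unfolding \<omega>_def by blast
qed

text \<open>The first clause leaves an additive constant free, and the second fixes it by comparison
  with the expansion of a harmonic Maass form. The decay in the third clause makes the series of
  these functions converge; it is asked for negative n only, since all but finitely many terms of
  that series have negative index.\<close>

definition is_fourier_primitive :: "real \<Rightarrow> real \<Rightarrow> (complex \<Rightarrow> complex) \<Rightarrow> complex \<Rightarrow> bool" where
  "is_fourier_primitive \<kappa> n T \<beta> \<longleftrightarrow>
     (\<forall>y. y \<notin> \<real>\<^sub>\<le>\<^sub>0 \<longrightarrow>
        (T has_field_derivative y powr of_real (- \<kappa>) * exp (of_real (2 * pi * n) * y)) (at y)) \<and>
     (if n = 0 then \<forall>v>0. T (of_real (2 * v)) = \<beta> * of_real (v powr (1 - \<kappa>))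
      else \<forall>v>0. T (of_real (2 * v)) = \<beta> * W_fun \<kappa> (2 * pi * n * v)) \<and>
     (n < 0 \<longrightarrow> (\<forall>y \<delta>. y \<notin> \<real>\<^sub>\<le>\<^sub>0 \<longrightarrow> \<delta> > 0 \<longrightarrow> (\<forall>s\<ge>0. \<delta> \<le> norm (y + of_real s)) \<longrightarrow>
        norm (T y) \<le> \<delta> powr (- \<kappa>) * exp (2 * pi * n * Re y) / (2 * pi * \<bar>n\<bar>)))"

lemma fourier_primitive:
  assumes "\<kappa> > 1"
  shows "\<exists>T \<beta>. is_fourier_primitive \<kappa> n T \<beta>"
proof -
  have scale: "of_real a * y \<notin> \<real>\<^sub>\<le>\<^sub>0" if "a > 0" "y \<notin> \<real>\<^sub>\<le>\<^sub>0" for a and y :: complex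
    using that by (auto simp: complex_nonpos_Reals_iff mult_le_0_iff)
  \<comment> \<open>Replacing y by ay produces a^(-\<kappa>) from the power and a from the chain
    rule; the factor a^(\<kappa> - 1) compensates both.\<close>
  have rescale: "((\<lambda>y. of_real (a powr (\<kappa> - 1)) * H (of_real a * y)) has_field_derivative
      c * (y powr of_real (- \<kappa>) * exp (e * (of_real a * y)))) (at y)"
    if a: "a > 0" and y: "y \<notin> \<real>\<^sub>\<le>\<^sub>0"
      and H: "\<And>y :: complex. y \<notin> \<real>\<^sub>\<le>\<^sub>0 \<Longrightarrow> (H has_field_derivative c * (y powr of_real (- \<kappa>) * exp (e * y))) (at y)"
    for a and H :: "complex \<Rightarrow> complex" and c e y :: complex
  proof -
    have "((\<lambda>y. H (of_real a * y)) has_field_derivative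
        c * ((of_real a * y) powr of_real (- \<kappa>) * exp (e * (of_real a * y))) * of_real a) (at y)"
      by (rule DERIV_chain2[where f = H and g = "\<lambda>y. of_real a * y", OF H[OF scale[OF a y]]])
         (auto intro!: derivative_eq_intros)
    from DERIV_cmult[OF this, of "of_real (a powr (\<kappa> - 1))"]
    have "((\<lambda>y. of_real (a powr (\<kappa> - 1)) * H (of_real a * y)) has_field_derivative
        of_real (a powr (\<kappa> - 1)) * (c * ((of_real a * y) powr of_real (- \<kappa>) * exp (e * (of_real a * y))) * of_real a)) (at y)" .
    also have "(of_real a * y) powr of_real (- \<kappa>) = of_real (a powr (- \<kappa>)) * y powr of_real (- \<kappa>)"
      using a by (simp only: powr_of_real_pos_mult) (simp only: powr_of_real less_imp_le)
    also have "of_real (a powr (\<kappa> - 1)) * (c * (of_real (a powr (- \<kappa>)) * y powr of_real (- \<kappa>) * exp (e * (of_real a * y))) * of_real a)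
       = of_real (a powr (\<kappa> - 1) * a powr (- \<kappa>) * a) * (c * (y powr of_real (- \<kappa>) * exp (e * (of_real a * y))))"
      by (simp add: mult_ac)
    also have "a powr (\<kappa> - 1) * a powr (- \<kappa>) * a = 1"
      using a by (simp add: powr_diff powr_minus)
    finally show ?thesis by simp
  qed
  consider "n = 0" | "n < 0" | "n > 0" by linarith
  thus ?thesis
  proof cases
    case 1
    define T where "T y = y powr of_real (1 - \<kappa>) / of_real (1 - \<kappa>)" for y :: complex
    have "(T has_field_derivative y powr of_real (- \<kappa>)) (at y)" if "y \<notin> \<real>\<^sub>\<le>\<^sub>0" for y
    proof -
      have "(T has_field_derivative of_real (1 - \<kappa>) * y powr of_real (1 - \<kappa> - 1) / of_real (1 - \<kappa>)) (at y)"
        unfolding T_def[abs_def] by (rule DERIV_cdivide[OF has_field_derivative_powr_of_real[OF that]])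
      moreover have "complex_of_real (1 - \<kappa>) \<noteq> 0" using assms by (simp only: of_real_eq_0_iff)
      ultimately show ?thesis by simp
    qed
    moreover have "T (of_real (2 * v)) = of_real (2 powr (1 - \<kappa>) / (1 - \<kappa>)) * of_real (v powr (1 - \<kappa>))" if "v > 0" for v
    proof -
      have "T (of_real (2 * v)) = of_real ((2 * v) powr (1 - \<kappa>) / (1 - \<kappa>))"
        using that unfolding T_def by (simp only: powr_of_real of_real_divide mult_nonneg_nonneg less_imp_le zero_le_numeral)
      thus ?thesis using that by (simp add: powr_mult)
    qed
    ultimately show ?thesis
      unfolding is_fourier_primitive_def using 1 by (intro exI[of _ T] exI[of _ "of_real (2 powr (1 - \<kappa>) / (1 - \<kappa>))"]) auto
  next
    case 2
    define a where "a = 2 * pi * \<bar>n\<bar>"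
    have "0 < 2 * pi * \<bar>n\<bar>" by (rule mult_pos_pos) (use 2 in auto)
    hence a: "a > 0" "2 * pi * n = - a" using 2 by (simp_all only: a_def abs_of_neg mult_minus_right minus_minus)
    define T where "T y = - (of_real (a powr (\<kappa> - 1)) * upper_gamma \<kappa> (of_real a * y))" for y
    have "(T has_field_derivative y powr of_real (- \<kappa>) * exp (of_real (2 * pi * n) * y)) (at y)" if "y \<notin> \<real>\<^sub>\<le>\<^sub>0" for y
    proof -
      have "((\<lambda>y. of_real (a powr (\<kappa> - 1)) * upper_gamma \<kappa> (of_real a * y)) has_field_derivative
        (-1) * (y powr of_real (- \<kappa>) * exp ((-1) * (of_real a * y)))) (at y)"
        by (rule rescale[OF a(1) that]) (use has_field_derivative_upper_gamma[of \<kappa>] assms in simp)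
      from DERIV_minus[OF this] show ?thesis unfolding T_def[abs_def] a(2) by simp
    qed
    moreover have "T (of_real (2 * v)) = - of_real (a powr (\<kappa> - 1)) * W_fun \<kappa> (2 * pi * n * v)" if "v > 0" for v
    proof -
      have "W_fun \<kappa> (2 * pi * n * v) = upper_gamma \<kappa> (of_real (- 2 * (2 * pi * n * v)))"
      proof (rule W_fun_neg)
        have "2 * pi * n < 0" using a by simp
        thus "2 * pi * n * v < 0" using that by (rule mult_neg_pos)
      qed (use assms in simp)
      also have "- 2 * (2 * pi * n * v) = a * (2 * v)" unfolding a(2) by simp
      finally show ?thesis by (simp add: T_def)
    qed
    moreover have "norm (T y) \<le> \<delta> powr (- \<kappa>) * exp (2 * pi * n * Re y) / (2 * pi * \<bar>n\<bar>)"
      if y: "y \<notin> \<real>\<^sub>\<le>\<^sub>0" "\<delta> > 0" "\<forall>s\<ge>0. \<delta> \<le> norm (y + of_real s)" for y \<delta>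
    proof -
      have "norm (upper_gamma \<kappa> (of_real a * y)) \<le> (a * \<delta>) powr (- \<kappa>) * exp (- Re (of_real a * y))"
      proof (rule upper_gamma_bound)
        show "a * \<delta> \<le> norm (of_real a * y + of_real s)" if "s \<ge> 0" for s
        proof -
          have "of_real a * y + of_real s = of_real a * (y + of_real (s / a))" using a by (simp add: field_simps)
          moreover have "\<delta> \<le> norm (y + of_real (s / a))" using that a by (intro y(3)[rule_format]) simp
          ultimately show ?thesis using a by (simp add: norm_mult)
        qed
      qed (use assms a y scale in auto)
      hence "norm (T y) \<le> a powr (\<kappa> - 1) * ((a * \<delta>) powr (- \<kappa>) * exp (- Re (of_real a * y)))"
        using a by (simp add: T_def norm_mult)
      also have "\<dots> = \<delta> powr (- \<kappa>) * exp (2 * pi * n * Re y) * (a powr (\<kappa> - 1) * a powr (- \<kappa>))"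
        using a y(2) by (simp add: powr_mult mult_ac)
      also have "a powr (\<kappa> - 1) * a powr (- \<kappa>) = 1 / a"
        using a by (simp add: powr_diff powr_minus field_simps)
      finally show ?thesis by (simp add: a_def)
    qed
    ultimately show ?thesis
      unfolding is_fourier_primitive_def using 2 by (intro exI[of _ T] exI[of _ "- of_real (a powr (\<kappa> - 1))"]) auto
  next
    case 3
    define a where "a = 2 * pi * n"
    have a: "a > 0" using 3 by (auto simp: a_def)
    have "(\<lambda>y :: complex. y powr of_real (- \<kappa>) * exp y) holomorphic_on - \<real>\<^sub>\<le>\<^sub>0"
      by (intro holomorphic_intros) auto
    from slit_primitive[OF this] obtain K where K: "\<And>y :: complex. y \<notin> \<real>\<^sub>\<le>\<^sub>0 \<Longrightarrow>
        (K has_field_derivative y powr of_real (- \<kappa>) * exp y) (at y)" by metis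
    \<comment> \<open>The constant for which \<open>K + C\<close>, and not \<open>K\<close>,
      restricts to a multiple of \<open>W_fun\<close> on the positive axis.\<close>
    obtain C where C: "\<And>x. x > 0 \<Longrightarrow> W_fun \<kappa> x = exp (- (\<i> * of_real (pi * \<kappa>))) * (K (of_real (2 * x)) + C)"
      using W_fun_pos[of \<kappa> K] K assms by auto
    define T where "T y = of_real (a powr (\<kappa> - 1)) * (K (of_real a * y) + C)" for y
    have KC: "((\<lambda>y. K y + C) has_field_derivative 1 * (y powr of_real (- \<kappa>) * exp (1 * y))) (at y)"
      if "y \<notin> \<real>\<^sub>\<le>\<^sub>0" for y
      using K[OF that] by (auto intro!: derivative_eq_intros)
    have "(T has_field_derivative y powr of_real (- \<kappa>) * exp (of_real (2 * pi * n) * y)) (at y)" if "y \<notin> \<real>\<^sub>\<le>\<^sub>0" for y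
      using rescale[OF a that, of "\<lambda>y. K y + C" 1 1, OF KC] by (simp add: T_def[abs_def] a_def)
    moreover have "T (of_real (2 * v)) = of_real (a powr (\<kappa> - 1)) * exp (\<i> * of_real (pi * \<kappa>)) * W_fun \<kappa> (2 * pi * n * v)"
      if "v > 0" for v
    proof -
      have "W_fun \<kappa> (2 * pi * n * v) = exp (- (\<i> * of_real (pi * \<kappa>))) * (K (of_real (2 * (a * v))) + C)"
        using C[OF mult_pos_pos[OF a that]] by (simp only: a_def)
      moreover have "2 * (a * v) = a * (2 * v)" by simp
      ultimately have "W_fun \<kappa> (2 * pi * n * v) = exp (- (\<i> * of_real (pi * \<kappa>))) * (K (of_real a * of_real (2 * v)) + C)"
        by (simp only: of_real_mult)
      moreover have "exp (\<i> * of_real (pi * \<kappa>)) * exp (- (\<i> * of_real (pi * \<kappa>))) = (1 :: complex)"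
        by (simp flip: exp_add)
      ultimately show ?thesis by (simp only: T_def mult.assoc) (simp only: mult.assoc[symmetric] mult_1_left)
    qed
    ultimately show ?thesis unfolding is_fourier_primitive_def using 3
      by (intro exI[of _ T] exI[of _ "of_real (a powr (\<kappa> - 1)) * exp (\<i> * of_real (pi * \<kappa>))"]) auto
  qed
qed

section \<open>Fourier expansions\<close>

lemma e_fun_add: "e_fun (m + n) \<tau> = e_fun m \<tau> * e_fun n \<tau>"
  by (simp add: exp_add[symmetric] algebra_simps)

lemma e_fun_add_arg: "e_fun n (\<tau> + w) = e_fun n \<tau> * e_fun n w"
  by (simp add: exp_add[symmetric] algebra_simps)

lemma e_fun_minus: "e_fun (- n) \<tau> * e_fun n \<tau> = 1"
  by (simp add: exp_add[symmetric])

lemma norm_e_fun: "norm (e_fun n \<tau>) = exp (- (2 * pi * n * Im \<tau>))"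
  by (simp add: norm_exp_eq_Re)

lemma e_fun_of_nat: "e_fun (real j) \<tau> = e_fun 1 \<tau> ^ j"
  by (simp add: exp_of_nat_mult[symmetric] mult_ac)

lemma exp_growthD:
  assumes "exp_growth h"
  shows "\<exists>C K Y. K > 0 \<and> (\<forall>\<tau>. Im \<tau> \<ge> Y \<longrightarrow> norm (h \<tau>) \<le> K * exp (C * Im \<tau>))"
proof -
  obtain C where "h \<in> O[filtercomap Im at_top](\<lambda>\<tau>. of_real (exp (C * Im \<tau>)))"
    using assms unfolding exp_growth_def by blast
  then obtain K where K: "K > 0" "\<forall>\<^sub>F \<tau> in filtercomap Im at_top. norm (h \<tau>) \<le> K * exp (C * Im \<tau>)"
    by (auto elim!: landau_o.bigE)
  then obtain Y where "\<forall>\<tau>. Y \<le> Im \<tau> \<longrightarrow> norm (h \<tau>) \<le> K * exp (C * Im \<tau>)"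
    unfolding eventually_filtercomap_at_top_linorder by auto
  with K(1) show ?thesis by blast
qed

lemma exp_growthI:
  assumes "\<And>\<tau>. Im \<tau> \<ge> Y \<Longrightarrow> norm (h \<tau>) \<le> K * exp (C * Im \<tau>)"
  shows "exp_growth h"
  unfolding exp_growth_def
proof (intro exI[of _ C] landau_o.bigI[of "\<bar>K\<bar> + 1"])
  show "\<forall>\<^sub>F \<tau> in filtercomap Im at_top. norm (h \<tau>) \<le> (\<bar>K\<bar> + 1) * norm (complex_of_real (exp (C * Im \<tau>)))"
    unfolding eventually_filtercomap_at_top_linorder
  proof (intro exI[of _ Y] allI impI)
    fix \<tau> assume "Y \<le> Im \<tau>"
    hence "norm (h \<tau>) \<le> K * exp (C * Im \<tau>)" by (rule assms)
    also have "\<dots> \<le> (\<bar>K\<bar> + 1) * exp (C * Im \<tau>)" by (intro mult_right_mono) auto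
    finally show "norm (h \<tau>) \<le> (\<bar>K\<bar> + 1) * norm (complex_of_real (exp (C * Im \<tau>)))" by simp
  qed
qed simp

lemma periodic_of_int:
  assumes per: "\<And>\<tau>. \<tau> \<in> upper_half \<Longrightarrow> g (\<tau> + 1) = g \<tau>" and "\<tau> \<in> upper_half"
  shows "g (\<tau> + of_int n) = (g \<tau> :: complex)"
proof -
  have nat: "g (\<tau> + of_nat n) = g \<tau>" if "\<tau> \<in> upper_half" for n :: nat and \<tau>
  proof (induction n)
    case (Suc n)
    have "\<tau> + of_nat n \<in> upper_half" using that by (simp add: upper_half_def)
    from per[OF this] Suc show ?case by (simp add: algebra_simps)
  qed simp
  show ?thesis
  proof (cases "n \<ge> 0")
    case True
    thus ?thesis using nat[OF assms(2), of "nat n"] by simp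
  next
    case False
    have "\<tau> + of_int n \<in> upper_half" using assms(2) by (simp add: upper_half_def)
    from nat[OF this, of "nat (- n)"] False show ?thesis by simp
  qed
qed

text \<open>The definition by the principal logarithm jumps across the negative axis by a period,
  which \<open>g\<close> does not see. Holomorphy is therefore local, and near each point another
  branch of the logarithm may be used.\<close>

lemma periodic_factors_through_exp:
  assumes hol: "g holomorphic_on upper_half"
    and per: "\<And>\<tau>. \<tau> \<in> upper_half \<Longrightarrow> g (\<tau> + 1) = g \<tau>"
  shows "\<exists>G. G holomorphic_on ball 0 1 - {0} \<and> (\<forall>\<tau>\<in>upper_half. G (e_fun 1 \<tau>) = g \<tau>)"
proof (intro exI conjI ballI)
  define G where "G q = g (Ln q / (2 * of_real pi * \<i>))" for q
  show *: "G (e_fun 1 \<tau>) = g \<tau>" if "\<tau> \<in> upper_half" for \<tau>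
  proof -
    have "exp (Ln (e_fun 1 \<tau>)) = e_fun 1 \<tau>" by (rule exp_Ln) simp
    then obtain n :: int where "Ln (e_fun 1 \<tau>) = 2 * of_real pi * \<i> * \<tau> + (of_int (2 * n) * pi) * \<i>"
      unfolding exp_eq by auto
    hence "Ln (e_fun 1 \<tau>) / (2 * of_real pi * \<i>) = \<tau> + of_int n"
      by (simp add: field_simps)
    thus ?thesis unfolding G_def using periodic_of_int[of g, OF per that] by simp
  qed
  have "G analytic_on ball 0 1 - {0}"
    unfolding analytic_on_analytic_at[of G "ball 0 1 - {0}"]
  proof
    fix q0 :: complex assume q0: "q0 \<in> ball 0 1 - {0}"
    define B where "B = ball q0 (norm q0) \<inter> ball 0 1"
    \<comment> \<open>A branch of \<tau> as a function of q near q0: on \<open>B\<close> the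
      quotient q/q0 has positive real part, so its principal logarithm is holomorphic.\<close>
    define t where "t q = (Ln (q / q0) + Ln q0) / (2 * of_real pi * \<i>)" for q
    have slit: "q / q0 \<notin> \<real>\<^sub>\<le>\<^sub>0" "q \<noteq> 0" if "q \<in> B" for q
    proof -
      have "norm (q - q0) < norm q0" using that by (simp add: B_def dist_norm norm_minus_commute)
      moreover have "q / q0 - 1 = (q - q0) / q0" using q0 by (simp add: field_simps)
      ultimately have "norm (q / q0 - 1) < 1" using q0 by (simp add: norm_divide)
      hence "Re (q / q0) > 0" using complex_Re_le_cmod[of "1 - q / q0"] by (simp add: norm_minus_commute)
      thus "q / q0 \<notin> \<real>\<^sub>\<le>\<^sub>0" by (auto simp: complex_nonpos_Reals_iff)
      thus "q \<noteq> 0" by auto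
    qed
    have et: "e_fun 1 (t q) = q" if "q \<in> B" for q
      using slit[OF that] q0 by (simp add: t_def exp_add)
    have t_upper: "t q \<in> upper_half" if "q \<in> B" for q
    proof -
      have "norm (e_fun 1 (t q)) < 1" using et[OF that] that by (simp add: B_def)
      thus ?thesis unfolding norm_e_fun by (simp add: upper_half_def zero_less_mult_iff)
    qed
    have "t holomorphic_on B"
      unfolding t_def by (intro holomorphic_intros) (use slit q0 in auto)
    hence "(g \<circ> t) holomorphic_on B"
      by (rule holomorphic_on_compose_gen[OF _ hol]) (use t_upper in auto)
    hence "G holomorphic_on B"
      by (rule holomorphic_transform) (metis * comp_apply et t_upper)
    moreover have "open B" "q0 \<in> B" using q0 by (auto simp: B_def)
    ultimately show "G analytic_on {q0}" by (meson analytic_at)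
  qed
  thus "G holomorphic_on ball 0 1 - {0}" by (rule analytic_imp_holomorphic)
qed

text \<open>Multiplication by a suitable exponential makes \<open>h\<close> periodic and bounded at
  the cusp. As a function of q the product then has a removable singularity at 0, so a Taylor series
  takes the place of a Laurent series.\<close>

lemma fourier_expansion:
  assumes hol: "h holomorphic_on upper_half"
    and per: "\<And>\<tau>. \<tau> \<in> upper_half \<Longrightarrow> h (\<tau> + 1) = c * h \<tau>"
    and "norm c = 1" and "exp_growth h"
  shows "\<exists>a m0. e_fun m0 1 = c \<and> (\<forall>\<tau>\<in>upper_half.
    summable (\<lambda>j. norm (a j * e_fun (m0 + real j) \<tau>)) \<and> (\<lambda>j. a j * e_fun (m0 + real j) \<tau>) sums h \<tau>)"
proof -
  from exp_growthD[OF assms(4)]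
  obtain C K Y where K: "K > 0" "\<And>\<tau>. Im \<tau> \<ge> Y \<Longrightarrow> norm (h \<tau>) \<le> K * exp (C * Im \<tau>)" by auto
  \<comment> \<open>\<open>Arg c / (2 * pi)\<close> is one exponent with multiplier c. It is lowered
    by the integer \<open>N\<close> until 2\<pi> m0 \<le> -C, so that the growth exp(C Im \<tau>) is
    absorbed.\<close>
  define N where "N = nat \<lceil>\<bar>Arg c / (2 * pi) + C / (2 * pi)\<bar>\<rceil>"
  define m0 where "m0 = Arg c / (2 * pi) - real N"
  have m0: "2 * pi * m0 \<le> - C"
  proof -
    have "Arg c / (2 * pi) + C / (2 * pi) \<le> real N" unfolding N_def by linarith
    hence "m0 \<le> - C / (2 * pi)" by (simp add: m0_def)
    thus ?thesis by (simp add: field_simps)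
  qed
  have c: "e_fun m0 1 = c"
  proof -
    have "e_fun m0 1 * e_fun (real N) 1 = e_fun (Arg c / (2 * pi)) 1"
      using e_fun_add[of m0 "real N" 1] by (simp add: m0_def)
    moreover have "e_fun (real N) 1 = 1"
      unfolding e_fun_of_nat by (simp add: exp_two_pi_i)
    moreover have "e_fun (Arg c / (2 * pi)) 1 = exp (\<i> * of_real (Arg c))"
      by (rule arg_cong[of _ _ exp]) (simp add: field_simps)
    moreover have "exp (\<i> * of_real (Arg c)) = c"
    proof -
      have "c \<noteq> 0" using assms(3) by auto
      from Arg_eq[OF this] show ?thesis using assms(3) by simp
    qed
    ultimately show ?thesis by simp
  qed
  define g where "g \<tau> = h \<tau> * e_fun (- m0) \<tau>" for \<tau>
  have ghol: "g holomorphic_on upper_half" unfolding g_def by (intro holomorphic_intros hol)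
  have gper: "g (\<tau> + 1) = g \<tau>" if "\<tau> \<in> upper_half" for \<tau>
  proof -
    have "e_fun (- m0) 1 * c = 1" using e_fun_minus[of m0 1] by (simp only: c)
    thus ?thesis unfolding g_def per[OF that] e_fun_add_arg[of "- m0"] by (simp add: mult_ac)
  qed
  from periodic_factors_through_exp[OF ghol gper]
  obtain G where G: "G holomorphic_on ball 0 1 - {0}" "\<And>\<tau>. \<tau> \<in> upper_half \<Longrightarrow> G (e_fun 1 \<tau>) = g \<tau>"
    by auto
  have "\<forall>\<^sub>F q in at 0. norm (G q) \<le> K"
    unfolding eventually_at
  proof (intro exI[of _ "exp (- (2 * pi * max Y 1))"] conjI ballI impI)
    fix q :: complex assume q: "q \<noteq> 0 \<and> dist q 0 < exp (- (2 * pi * max Y 1))"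
    define \<tau> where "\<tau> = Ln q / (2 * of_real pi * \<i>)"
    have e: "e_fun 1 \<tau> = q" using q by (simp add: \<tau>_def)
    hence "norm (e_fun 1 \<tau>) < exp (- (2 * pi * max Y 1))" using q by simp
    hence Im: "Im \<tau> > max Y 1" unfolding norm_e_fun by simp
    hence up: "\<tau> \<in> upper_half" by (simp add: upper_half_def)
    have "norm (G q) = norm (g \<tau>)" using G(2)[OF up] e by simp
    also have "\<dots> = norm (h \<tau>) * exp (2 * pi * m0 * Im \<tau>)" by (simp add: g_def norm_mult norm_e_fun)
    also have "\<dots> \<le> (K * exp (C * Im \<tau>)) * exp (2 * pi * m0 * Im \<tau>)"
      using K(2)[of \<tau>] Im by (intro mult_right_mono) auto
    also have "\<dots> = K * exp ((C + 2 * pi * m0) * Im \<tau>)" by (simp add: exp_add[symmetric] algebra_simps)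
    also have "\<dots> \<le> K * exp 0"
      using m0 Im K(1) by (intro mult_left_mono) (auto simp: mult_nonpos_nonneg)
    finally show "norm (G q) \<le> K" by simp
  qed simp
  hence "\<exists>B. \<forall>\<^sub>F q in at 0. norm (G q) \<le> B" by blast
  hence "\<exists>G'. G' holomorphic_on ball 0 1 \<and> (\<forall>q\<in>ball 0 1 - {0}. G' q = G q)"
    using holomorphic_on_extend_bounded[OF G(1)] by simp
  then obtain G' where G': "G' holomorphic_on ball 0 1" "\<And>q. q \<in> ball 0 1 - {0} \<Longrightarrow> G' q = G q" by blast
  define a where "a j = (deriv ^^ j) G' 0 / fact j" for j
  have ser: "(\<lambda>j. a j * q ^ j) sums G' q" if "q \<in> ball 0 1" for q
    using holomorphic_power_series[OF G'(1) that] by (simp add: a_def)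
  have qb: "e_fun 1 \<tau> \<in> ball 0 1 - {0}" if "\<tau> \<in> upper_half" for \<tau>
    using that norm_e_fun[of 1 \<tau>] by (simp add: upper_half_def)
  have summand: "a j * e_fun (m0 + real j) \<tau> = e_fun m0 \<tau> * (a j * e_fun 1 \<tau> ^ j)" for j \<tau>
    unfolding e_fun_add[of m0] e_fun_of_nat by (simp only: mult_ac)
  show ?thesis
  proof (intro exI[of _ m0] exI[of _ a] conjI ballI)
    fix \<tau> assume \<tau>: "\<tau> \<in> upper_half"
    have "G' (e_fun 1 \<tau>) = g \<tau>" using G'(2)[OF qb[OF \<tau>]] G(2)[OF \<tau>] by simp
    hence "(\<lambda>j. a j * e_fun 1 \<tau> ^ j) sums g \<tau>" using ser[of "e_fun 1 \<tau>"] qb[OF \<tau>] by simp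
    hence "(\<lambda>j. e_fun m0 \<tau> * (a j * e_fun 1 \<tau> ^ j)) sums (e_fun m0 \<tau> * g \<tau>)" by (rule sums_mult)
    moreover have "e_fun m0 \<tau> * g \<tau> = (e_fun (- m0) \<tau> * e_fun m0 \<tau>) * h \<tau>"
      unfolding g_def by (simp only: mult_ac)
    ultimately show "(\<lambda>j. a j * e_fun (m0 + real j) \<tau>) sums h \<tau>"
      unfolding summand e_fun_minus by simp
    have "norm (e_fun 1 \<tau>) < 1" using qb[OF \<tau>] by simp
    then obtain r where r: "norm (e_fun 1 \<tau>) < r" "r < 1" using dense by blast
    hence r0: "0 < r" using norm_ge_zero[of "e_fun 1 \<tau>"] by linarith
    have "summable (\<lambda>j. a j * of_real r ^ j)" using ser[of "of_real r"] r r0 by (auto simp: sums_iff)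
    hence "summable (\<lambda>j. norm (a j * e_fun 1 \<tau> ^ j))"
      by (rule powser_insidea) (use r r0 in simp)
    hence "summable (\<lambda>j. norm (e_fun m0 \<tau>) * norm (a j * e_fun 1 \<tau> ^ j))" by (rule summable_mult)
    thus "summable (\<lambda>j. norm (a j * e_fun (m0 + real j) \<tau>))" unfolding summand by (simp only: norm_mult)
  qed (rule c)
qed

section \<open>Uniqueness of Fourier coefficients\<close>

lemma integral_e_fun:
  assumes "e_fun n 1 = 1" "n \<noteq> 0"
  shows "((\<lambda>u. e_fun n (of_real u)) has_integral 0) {0..1}"
proof -
  have "((\<lambda>w. e_fun n w / (2 * of_real pi * \<i> * of_real n)) has_field_derivative e_fun n w) (at w)" for w
    using assms(2) by (auto intro!: derivative_eq_intros)
  hence "((\<lambda>u. e_fun n (of_real u) / (2 * of_real pi * \<i> * of_real n)) has_vector_derivative e_fun n (of_real u)) (at u within {0..1})" for u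
    using has_vector_derivative_at_within has_vector_derivative_real_field by blast
  hence "((\<lambda>u. e_fun n (of_real u)) has_integral
     e_fun n (of_real 1) / (2 * of_real pi * \<i> * of_real n) - e_fun n (of_real 0) / (2 * of_real pi * \<i> * of_real n)) {0..1}"
    by (intro fundamental_theorem_of_calculus) auto
  thus ?thesis using assms(1) by simp
qed

text \<open>Unordered summability at u = 0 is absolute summability of \<open>A\<close>, so the tails
  are small uniformly in u. A finite partial sum is then uniformly small and can be integrated
  against the exponential of index -n0. All indices lie in one coset of the integers, which gives
  orthogonality on [0, 1].\<close>

lemma fourier_coeffs_unique:
  assumes sum: "\<And>u::real. ((\<lambda>n. A n * e_fun n (of_real u)) has_sum 0) {n. e_fun n 1 = c}"
    and "e_fun n0 1 = c"
  shows "A n0 = (0 :: complex)"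
proof -
  define I where "I = {n. e_fun n 1 = c}"
  have n0: "n0 \<in> I" using assms(2) by (simp add: I_def)
  have unit: "norm (e_fun n (of_real u)) = 1" for n u by (simp add: norm_e_fun)
  have "A summable_on I" using sum[of 0] by (auto simp: I_def summable_on_def)
  hence "(\<lambda>n. norm (A n)) summable_on I" by (simp add: summable_on_iff_abs_summable_on_complex)
  then obtain S where S: "((\<lambda>n. norm (A n)) has_sum S) I" by (auto simp: summable_on_def)
  have "norm (A n0) \<le> \<epsilon>" if \<epsilon>: "\<epsilon> > 0" for \<epsilon>
  proof -
    obtain F0 where F0: "finite F0" "F0 \<subseteq> I" "dist (\<Sum>n\<in>F0. norm (A n)) S \<le> \<epsilon>"
      using has_sum_finite_approximation[OF S \<epsilon>] by blast
    define F where "F = insert n0 F0"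
    have F: "finite F" "F \<subseteq> I" using F0 n0 by (auto simp: F_def)
    have "(\<Sum>n\<in>F0. norm (A n)) \<le> (\<Sum>n\<in>F. norm (A n))"
      using F by (intro sum_mono2) (auto simp: F_def)
    hence SF: "S - (\<Sum>n\<in>F. norm (A n)) \<le> \<epsilon>" using F0(3) by (simp add: dist_real_def)
    \<comment> \<open>As the full sum is 0, the partial sum is the negative of its tail, and the
      tail is dominated by the tail of the norms, whatever u is.\<close>
    have bound: "norm (\<Sum>n\<in>F. A n * e_fun n (of_real u)) \<le> \<epsilon>" for u
    proof -
      have "((\<lambda>n. A n * e_fun n (of_real u)) has_sum 0 - (\<Sum>n\<in>F. A n * e_fun n (of_real u))) (I - F)"
        using sum[of u] F by (intro has_sum_Diff) (auto simp: I_def intro: has_sum_finite)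
      moreover have "((\<lambda>n. norm (A n * e_fun n (of_real u))) has_sum S - (\<Sum>n\<in>F. norm (A n))) (I - F)"
        unfolding norm_mult unit mult_1_right using S F by (intro has_sum_Diff) (auto intro: has_sum_finite)
      ultimately have "norm (0 - (\<Sum>n\<in>F. A n * e_fun n (of_real u))) \<le> S - (\<Sum>n\<in>F. norm (A n))"
        by (rule norm_has_sum_bound[rotated])
      thus ?thesis using SF by simp
    qed
    have "((\<lambda>u. \<Sum>n\<in>F. A n * e_fun (n - n0) (of_real u)) has_integral (\<Sum>n\<in>F. if n = n0 then A n else 0)) {0..1}"
    proof (rule has_integral_sum[OF F(1)])
      fix n assume n: "n \<in> F"
      show "((\<lambda>u. A n * e_fun (n - n0) (of_real u)) has_integral (if n = n0 then A n else 0)) {0..1}"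
      proof (cases "n = n0")
        case True
        thus ?thesis using has_integral_const_real[of "A n" 0 1] by simp
      next
        case False
        have "e_fun n 1 = c" using n F by (auto simp: I_def)
        moreover have "e_fun n 1 = e_fun (n - n0) 1 * e_fun n0 1" using e_fun_add[of "n - n0" n0 1] by simp
        ultimately have "e_fun (n - n0) 1 = 1" using assms(2) by auto
        from has_integral_mult_right[OF integral_e_fun[OF this], of "A n"] False show ?thesis by simp
      qed
    qed
    moreover have "(\<Sum>n\<in>F. if n = n0 then A n else 0) = A n0" using F(1) by (simp add: F_def)
    ultimately have int: "((\<lambda>u. \<Sum>n\<in>F. A n * e_fun (n - n0) (of_real u)) has_integral A n0) {0..1}" by simp
    have "norm (\<Sum>n\<in>F. A n * e_fun (n - n0) (of_real u)) \<le> \<epsilon>" for u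
    proof -
      have "(\<Sum>n\<in>F. A n * e_fun (n - n0) (of_real u)) = e_fun (- n0) (of_real u) * (\<Sum>n\<in>F. A n * e_fun n (of_real u))"
        unfolding sum_distrib_left by (intro sum.cong refl) (simp add: exp_add[symmetric] algebra_simps)
      thus ?thesis using bound[of u] by (simp only: norm_mult unit mult_1_left)
    qed
    hence "norm (A n0) \<le> \<epsilon> * (1 - 0)"
      using has_integral_bound_real[OF less_imp_le[OF \<epsilon>] finite.emptyI int] by simp
    thus ?thesis by simp
  qed
  hence "norm (A n0) \<le> 0" by (rule field_le_epsilon[of _ 0, simplified])
  thus ?thesis by simp
qed

text \<open>Passes from the series over natural numbers delivered by the Fourier expansion to the
  unordered sum over real indices in \<open>maass_expansion\<close>.\<close>

lemma has_sum_of_sequence: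
  fixes f :: "real \<Rightarrow> complex" and \<phi> :: "nat \<Rightarrow> real"
  assumes "inj \<phi>" "range \<phi> \<subseteq> I" "\<And>n. n \<in> I - range \<phi> \<Longrightarrow> f n = 0"
    and "summable (\<lambda>j. norm (f (\<phi> j)))" "(\<lambda>j. f (\<phi> j)) sums S"
  shows "(f has_sum S) I"
proof -
  have "((\<lambda>j. f (\<phi> j)) has_sum S) UNIV" by (rule norm_summable_imp_has_sum) fact+
  hence "(f has_sum S) (range \<phi>)" using has_sum_reindex[of \<phi> UNIV f S] assms(1) by (simp add: o_def)
  moreover have "(f has_sum S) (range \<phi>) \<longleftrightarrow> (f has_sum S) I"
    by (rule has_sum_cong_neutral) (use assms(2,3) in auto)
  ultimately show ?thesis by simp
qed

section \<open>The Eichler integral\<close>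

text \<open>The numbers |y + s| with s \<ge> 0 are the distances from y to the points of the slit.
  One \<delta> for a whole ball makes the decay estimate locally uniform.\<close>

lemma slit_ball:
  assumes "y0 \<notin> \<real>\<^sub>\<le>\<^sub>0"
  obtains \<delta> where "\<delta> > 0" "\<And>y :: complex. y \<in> ball y0 \<delta> \<Longrightarrow> y \<notin> \<real>\<^sub>\<le>\<^sub>0 \<and> (\<forall>s\<ge>0. \<delta> \<le> norm (y + of_real s))"
proof -
  have "open (- \<real>\<^sub>\<le>\<^sub>0 :: complex set)" by (simp add: open_Compl)
  then obtain e where e: "e > 0" "ball y0 e \<subseteq> - \<real>\<^sub>\<le>\<^sub>0" using assms open_contains_ball_eq by blast
  show thesis
  proof (rule that[of "e / 2"])
    fix y assume y: "y \<in> ball y0 (e / 2)"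
    have "e / 2 \<le> norm (y + of_real s)" if "s \<ge> 0" for s
    proof -
      have "- complex_of_real s \<in> \<real>\<^sub>\<le>\<^sub>0" using that by (simp add: complex_nonpos_Reals_iff)
      hence "- complex_of_real s \<notin> ball y0 e" using e by blast
      hence "e \<le> norm (y0 + of_real s)" by (simp add: dist_norm)
      also have "\<dots> \<le> norm (y0 - y) + norm (y + of_real s)"
        using norm_triangle_ineq[of "y0 - y" "y + of_real s"] by simp
      finally show ?thesis using y by (simp add: dist_norm)
    qed
    moreover have "y \<notin> \<real>\<^sub>\<le>\<^sub>0" using y e by (auto simp: subset_iff)
    ultimately show "y \<notin> \<real>\<^sub>\<le>\<^sub>0 \<and> (\<forall>s\<ge>0. e / 2 \<le> norm (y + of_real s))" by blast
  qed (use e in simp)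
qed

lemma cnj_e_fun: "cnj (e_fun n w) = e_fun (- n) (cnj w)"
  by (simp add: exp_cnj)

lemma rotate_difference_slit:
  assumes "Im w < Im \<tau>" shows "\<i> * (w - \<tau>) \<notin> \<real>\<^sub>\<le>\<^sub>0"
  using assms by (auto simp: complex_nonpos_Reals_iff)

text \<open>Choosing the primitives \<open>T n\<close> regularises the second endpoint of the Eichler integral \<open>X\<close>: the
  integral diverges there if \<open>f\<close> has a pole at the cusp.\<close>

locale eichler_integral =
  fixes \<kappa> :: real and T :: "real \<Rightarrow> complex \<Rightarrow> complex" and \<beta> :: "real \<Rightarrow> complex"
    and a :: "nat \<Rightarrow> complex" and m0 :: real and f :: "complex \<Rightarrow> complex"
  assumes \<kappa>: "\<kappa> > 1"
    and T: "is_fourier_primitive \<kappa> n (T n) (\<beta> n)"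
    and f_holomorphic: "f holomorphic_on upper_half"
    and f_summable: "z \<in> upper_half \<Longrightarrow> summable (\<lambda>j. norm (a j * e_fun (m0 + real j) z))"
    and f_sums: "z \<in> upper_half \<Longrightarrow> (\<lambda>j. a j * e_fun (m0 + real j) z) sums f z"
begin

lemma T_deriv: "y \<notin> \<real>\<^sub>\<le>\<^sub>0 \<Longrightarrow>
    (T n has_field_derivative y powr of_real (- \<kappa>) * exp (of_real (2 * pi * n) * y)) (at y)"
  using T[of n] unfolding is_fourier_primitive_def by blast

lemma T_0: "v > 0 \<Longrightarrow> T 0 (of_real (2 * v)) = \<beta> 0 * of_real (v powr (1 - \<kappa>))"
  using T[of 0] unfolding is_fourier_primitive_def by simp

lemma T_W: "n \<noteq> 0 \<Longrightarrow> v > 0 \<Longrightarrow> T n (of_real (2 * v)) = \<beta> n * W_fun \<kappa> (2 * pi * n * v)"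
  using T[of n] unfolding is_fourier_primitive_def by simp

lemma T_bound: "n < 0 \<Longrightarrow> y \<notin> \<real>\<^sub>\<le>\<^sub>0 \<Longrightarrow> \<delta> > 0 \<Longrightarrow> (\<And>s. s \<ge> 0 \<Longrightarrow> \<delta> \<le> norm (y + of_real s)) \<Longrightarrow>
    norm (T n y) \<le> \<delta> powr (- \<kappa>) * exp (2 * pi * n * Re y) / (2 * pi * \<bar>n\<bar>)"
  using T[of n] unfolding is_fourier_primitive_def by simp

text \<open>The substitution y = \<i>(w - \<tau>) turns a primitive in w of the j-th term of
  \<open>cnj (f (cnj w))\<close> times the kernel into \<open>T\<close>. With \<i>(w - \<tau>) as
  base of the power, the cut in \<tau> is the vertical ray below w, and at
  \<open>w = cnj \<tau>\<close> the argument is the positive number 2 Im \<tau>.\<close>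

definition X_term :: "nat \<Rightarrow> complex \<Rightarrow> complex \<Rightarrow> complex" where
  "X_term j \<tau> w = cnj (a j) * e_fun (- (m0 + real j)) \<tau> * T (- (m0 + real j)) (\<i> * (w - \<tau>))"

definition X :: "complex \<Rightarrow> complex \<Rightarrow> complex" where
  "X \<tau> w = (\<Sum>j. X_term j \<tau> w)"

lemma eventually_index_ge_1: "\<forall>\<^sub>F j in sequentially. 1 \<le> m0 + real j"
  using eventually_ge_at_top[of "nat \<lceil>1 - m0\<rceil>"] by eventually_elim linarith

text \<open>The exponential in \<tau> and the decay of \<open>T\<close> combine to an expression in
  w alone: \<tau> enters only through \<delta>. Convergence of \<open>X\<close> is thus the absolute
  convergence of the expansion of \<open>f\<close> at \<open>cnj w\<close>. Index at least 1 ensures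
  that the denominator in the decay estimate may be dropped.\<close>

lemma X_term_bound:
  assumes "1 \<le> m0 + real j" "\<i> * (w - \<tau>) \<notin> \<real>\<^sub>\<le>\<^sub>0" "\<delta> > 0"
    and "\<And>s. s \<ge> 0 \<Longrightarrow> \<delta> \<le> norm (\<i> * (w - \<tau>) + of_real s)"
  shows "norm (X_term j \<tau> w) \<le> \<delta> powr (- \<kappa>) * norm (a j * e_fun (m0 + real j) (cnj w))"
proof -
  define n where "n = - (m0 + real j)"
  have n: "n \<le> -1" using assms(1) by (simp add: n_def)
  have "1 * 1 \<le> (2 * pi) * \<bar>n\<bar>" using n pi_ge_two by (intro mult_mono) auto
  hence n1: "1 \<le> 2 * pi * \<bar>n\<bar>" by simp
  have "norm (T n (\<i> * (w - \<tau>))) \<le> \<delta> powr (- \<kappa>) * exp (2 * pi * n * Re (\<i> * (w - \<tau>))) / (2 * pi * \<bar>n\<bar>)"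
    using n assms by (intro T_bound) auto
  also have "\<dots> \<le> \<delta> powr (- \<kappa>) * exp (2 * pi * n * Re (\<i> * (w - \<tau>))) / 1"
    using n1 by (intro divide_left_mono) auto
  finally have "norm (X_term j \<tau> w) \<le> norm (a j) * exp (- (2 * pi * n * Im \<tau>)) *
      (\<delta> powr (- \<kappa>) * exp (2 * pi * n * Re (\<i> * (w - \<tau>))))"
    unfolding X_term_def n_def[symmetric] norm_mult norm_e_fun complex_mod_cnj by (intro mult_left_mono) auto
  also have "\<dots> = \<delta> powr (- \<kappa>) * (norm (a j) * exp (- (2 * pi * n * Im \<tau>) + 2 * pi * n * Re (\<i> * (w - \<tau>))))"
    by (simp only: exp_add mult_ac)
  \<comment> \<open>The real part of \<i>(w - \<tau>) is Im \<tau> - Im w, so the contributions of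
    Im \<tau> cancel.\<close>
  also have "- (2 * pi * n * Im \<tau>) + 2 * pi * n * Re (\<i> * (w - \<tau>)) = - (2 * pi * (m0 + real j) * Im (cnj w))"
    by (simp add: n_def algebra_simps)
  finally show ?thesis by (simp only: norm_mult norm_e_fun)
qed

lemma summable_f_cnj: "Im w < 0 \<Longrightarrow> summable (\<lambda>j. norm (a j * e_fun (m0 + real j) (cnj w)))"
  by (rule f_summable) (simp add: upper_half_def)

lemma X_term_summable:
  assumes "Im w < 0" "\<i> * (w - \<tau>) \<notin> \<real>\<^sub>\<le>\<^sub>0"
  shows "summable (\<lambda>j. norm (X_term j \<tau> w))"
proof -
  obtain \<delta> where \<delta>: "\<delta> > 0" "\<And>y. y \<in> ball (\<i> * (w - \<tau>)) \<delta> \<Longrightarrow> y \<notin> \<real>\<^sub>\<le>\<^sub>0 \<and> (\<forall>s\<ge>0. \<delta> \<le> norm (y + of_real s))"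
    using slit_ball[OF assms(2)] by metis
  show ?thesis
  proof (rule summable_comparison_test_ev)
    show "\<forall>\<^sub>F j in sequentially. norm (norm (X_term j \<tau> w)) \<le> \<delta> powr (- \<kappa>) * norm (a j * e_fun (m0 + real j) (cnj w))"
      using eventually_index_ge_1
    proof eventually_elim
      case (elim j)
      have "norm (X_term j \<tau> w) \<le> \<delta> powr (- \<kappa>) * norm (a j * e_fun (m0 + real j) (cnj w))"
        by (rule X_term_bound[OF elim assms(2) \<delta>(1)]) (use \<delta> in auto)
      thus ?case by simp
    qed
    show "summable (\<lambda>j. \<delta> powr (- \<kappa>) * norm (a j * e_fun (m0 + real j) (cnj w)))"
      by (intro summable_mult summable_f_cnj assms(1))
  qed
qed

lemma X_sums:
  "Im w < 0 \<Longrightarrow> \<i> * (w - \<tau>) \<notin> \<real>\<^sub>\<le>\<^sub>0 \<Longrightarrow> (\<lambda>j. X_term j \<tau> w) sums X \<tau> w"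
  unfolding X_def by (intro summable_sums summable_norm_cancel[OF X_term_summable])

lemma T_holomorphic: "T n holomorphic_on - \<real>\<^sub>\<le>\<^sub>0"
proof (rule holomorphic_onI)
  fix y :: complex assume "y \<in> - \<real>\<^sub>\<le>\<^sub>0"
  hence "y \<notin> \<real>\<^sub>\<le>\<^sub>0" by simp
  from has_field_derivative_at_within[OF T_deriv[OF this]]
  show "T n field_differentiable at y within - \<real>\<^sub>\<le>\<^sub>0" unfolding field_differentiable_def by blast
qed

lemma open_slit_left: "open {\<tau>. \<i> * (w - \<tau>) \<notin> \<real>\<^sub>\<le>\<^sub>0}"
proof -
  have "open ((\<lambda>\<tau>. \<i> * (w - \<tau>)) -` (- \<real>\<^sub>\<le>\<^sub>0))"
    by (intro open_vimage continuous_intros) (simp add: open_Compl)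
  thus ?thesis by (simp add: vimage_def)
qed

lemma X_holomorphic:
  assumes w: "Im w < 0"
  shows "(\<lambda>\<tau>. X \<tau> w) holomorphic_on {\<tau>. \<i> * (w - \<tau>) \<notin> \<real>\<^sub>\<le>\<^sub>0}"
proof -
  define S where "S = {\<tau>. \<i> * (w - \<tau>) \<notin> \<real>\<^sub>\<le>\<^sub>0}"
  have op: "open S" unfolding S_def by (rule open_slit_left)
  have term_hol: "(\<lambda>\<tau>. X_term j \<tau> w) holomorphic_on S" for j
  proof -
    have "(T (- (m0 + real j)) \<circ> (\<lambda>\<tau>. \<i> * (w - \<tau>))) holomorphic_on S"
      by (rule holomorphic_on_compose_gen[OF _ T_holomorphic]) (auto simp: S_def intro!: holomorphic_intros)
    thus ?thesis unfolding X_term_def o_def by (intro holomorphic_intros)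
  qed
  have "\<exists>g g'. \<forall>\<tau>\<in>S. ((\<lambda>j. X_term j \<tau> w) sums g \<tau>) \<and>
      ((\<lambda>j. deriv (\<lambda>\<tau>. X_term j \<tau> w) \<tau>) sums g' \<tau>) \<and> (g has_field_derivative g' \<tau>) (at \<tau>)"
  proof (rule series_and_derivative_comparison_complex[OF op])
    show "((\<lambda>\<tau>. X_term j \<tau> w) has_field_derivative deriv (\<lambda>\<tau>. X_term j \<tau> w) \<tau>) (at \<tau>)" if "\<tau> \<in> S" for j \<tau>
      using term_hol op that by (rule holomorphic_derivI)
    fix \<tau>0 assume "\<tau>0 \<in> S"
    then obtain \<delta> where \<delta>: "\<delta> > 0"
      "\<And>y. y \<in> ball (\<i> * (w - \<tau>0)) \<delta> \<Longrightarrow> y \<notin> \<real>\<^sub>\<le>\<^sub>0 \<and> (\<forall>s\<ge>0. \<delta> \<le> norm (y + of_real s))"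
      using slit_ball[of "\<i> * (w - \<tau>0)"] unfolding S_def by blast
    define h where "h j = complex_of_real (\<delta> powr (- \<kappa>) * norm (a j * e_fun (m0 + real j) (cnj w)))" for j
    have "summable h" unfolding h_def by (intro summable_of_real summable_mult summable_f_cnj w)
    moreover have "range h \<subseteq> \<real>\<^sub>\<ge>\<^sub>0" by (auto simp: h_def complex_nonneg_Reals_iff)
    moreover have "\<forall>\<^sub>F j in sequentially. \<forall>\<tau>\<in>ball \<tau>0 \<delta> \<inter> S. norm (X_term j \<tau> w) \<le> norm (h j)"
      using eventually_index_ge_1
    proof eventually_elim
      case (elim j)
      show ?case
      proof
        fix \<tau> assume "\<tau> \<in> ball \<tau>0 \<delta> \<inter> S"
        hence "\<i> * (w - \<tau>) \<in> ball (\<i> * (w - \<tau>0)) \<delta>"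
          by (simp add: dist_norm right_diff_distrib[symmetric] norm_mult norm_minus_commute)
        from \<delta>(2)[OF this] have "norm (X_term j \<tau> w) \<le> \<delta> powr (- \<kappa>) * norm (a j * e_fun (m0 + real j) (cnj w))"
          by (intro X_term_bound[OF elim _ \<delta>(1)]) auto
        also have "\<dots> = norm (h j)" unfolding h_def norm_of_real by (rule abs_of_nonneg[symmetric]) simp
        finally show "norm (X_term j \<tau> w) \<le> norm (h j)" .
      qed
    qed
    ultimately show "\<exists>d (h :: nat \<Rightarrow> complex). 0 < d \<and> summable h \<and> range h \<subseteq> \<real>\<^sub>\<ge>\<^sub>0 \<and>
       (\<forall>\<^sub>F j in sequentially. \<forall>\<tau>\<in>ball \<tau>0 d \<inter> S. norm (X_term j \<tau> w) \<le> norm (h j))"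
      using \<delta>(1) by blast
  qed
  then obtain g g' where g: "\<And>\<tau>. \<tau> \<in> S \<Longrightarrow> (\<lambda>j. X_term j \<tau> w) sums g \<tau>"
    "\<And>\<tau>. \<tau> \<in> S \<Longrightarrow> (g has_field_derivative g' \<tau>) (at \<tau>)" by blast
  have "g holomorphic_on S"
    by (rule holomorphic_onI) (use g(2) in \<open>auto simp: field_differentiable_def intro: DERIV_subset\<close>)
  hence "(\<lambda>\<tau>. X \<tau> w) holomorphic_on S"
  proof (rule holomorphic_transform)
    show "g \<tau> = X \<tau> w" if "\<tau> \<in> S" for \<tau>
      using g(1)[OF that] by (simp add: X_def sums_iff)
  qed
  thus ?thesis by (simp add: S_def)
qed

lemma has_field_derivative_X:
  assumes \<tau>: "\<tau> \<in> upper_half" and w: "Im w < 0"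
  shows "(X \<tau> has_field_derivative \<i> * (\<i> * (w - \<tau>)) powr of_real (- \<kappa>) * cnj (f (cnj w))) (at w)"
proof -
  define S where "S = {w. Im w < 0}"
  have op: "open S" unfolding S_def by (rule open_halfspace_Im_lt)
  have slit: "\<i> * (w - \<tau>) \<notin> \<real>\<^sub>\<le>\<^sub>0" if "w \<in> S" for w
    using that \<tau> by (intro rotate_difference_slit) (simp add: S_def upper_half_def)
  define D where "D j w = \<i> * (\<i> * (w - \<tau>)) powr of_real (- \<kappa>) * (cnj (a j) * e_fun (- (m0 + real j)) w)" for j w
  have "\<exists>g g'. \<forall>w\<in>S. ((\<lambda>j. X_term j \<tau> w) sums g w) \<and>
      ((\<lambda>j. D j w) sums g' w) \<and> (g has_field_derivative g' w) (at w)"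
  proof (rule series_and_derivative_comparison_complex[OF op])
    fix j w assume w: "w \<in> S"
    define n where "n = - (m0 + real j)"
    have "((\<lambda>w. T n (\<i> * (w - \<tau>))) has_field_derivative
       (\<i> * (w - \<tau>)) powr of_real (- \<kappa>) * exp (of_real (2 * pi * n) * (\<i> * (w - \<tau>))) * \<i>) (at w)"
      by (rule DERIV_chain2[where f = "T n" and g = "\<lambda>w. \<i> * (w - \<tau>)", OF T_deriv[OF slit[OF w]]])
         (auto intro!: derivative_eq_intros)
    from DERIV_cmult[OF this, of "cnj (a j) * e_fun n \<tau>"]
    have "(X_term j \<tau> has_field_derivative cnj (a j) * e_fun n \<tau> *
       ((\<i> * (w - \<tau>)) powr of_real (- \<kappa>) * exp (of_real (2 * pi * n) * (\<i> * (w - \<tau>))) * \<i>)) (at w)"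
      by (simp only: X_term_def[abs_def] n_def)
    moreover have "e_fun n \<tau> * exp (of_real (2 * pi * n) * (\<i> * (w - \<tau>))) = e_fun n w"
      unfolding exp_add[symmetric] by (rule arg_cong[of _ _ exp]) (simp add: algebra_simps)
    moreover have "cnj (a j) * e_fun n \<tau> *
       ((\<i> * (w - \<tau>)) powr of_real (- \<kappa>) * exp (of_real (2 * pi * n) * (\<i> * (w - \<tau>))) * \<i>) =
       \<i> * (\<i> * (w - \<tau>)) powr of_real (- \<kappa>) *
         (cnj (a j) * (e_fun n \<tau> * exp (of_real (2 * pi * n) * (\<i> * (w - \<tau>)))))"
      by (simp only: mult_ac)
    ultimately have "(X_term j \<tau> has_field_derivative
        \<i> * (\<i> * (w - \<tau>)) powr of_real (- \<kappa>) * (cnj (a j) * e_fun n w)) (at w)"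
      by (simp only:)
    thus "(X_term j \<tau> has_field_derivative D j w) (at w)" by (simp only: D_def n_def)
  next
    fix w0 assume w0: "w0 \<in> S"
    then obtain \<delta> where \<delta>: "\<delta> > 0"
      "\<And>y. y \<in> ball (\<i> * (w0 - \<tau>)) \<delta> \<Longrightarrow> y \<notin> \<real>\<^sub>\<le>\<^sub>0 \<and> (\<forall>s\<ge>0. \<delta> \<le> norm (y + of_real s))"
      using slit_ball[OF slit[OF w0]] by blast
    \<comment> \<open>Within distance \<open>v0\<close> of w0 the height of \<open>cnj w\<close> is
      still at least \<open>v0\<close>; this yields a majorant that does not depend on w.\<close>
    define v0 where "v0 = - Im w0 / 2"
    have v0: "v0 > 0" using w0 by (simp add: v0_def S_def)
    define h where "h j = complex_of_real (\<delta> powr (- \<kappa>) * norm (a j * e_fun (m0 + real j) (\<i> * of_real v0)))" for j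
    have "summable h" unfolding h_def
      by (intro summable_of_real summable_mult f_summable) (simp add: upper_half_def v0)
    moreover have "range h \<subseteq> \<real>\<^sub>\<ge>\<^sub>0" by (auto simp: h_def complex_nonneg_Reals_iff)
    moreover have "\<forall>\<^sub>F j in sequentially. \<forall>w\<in>ball w0 (min \<delta> v0) \<inter> S. norm (X_term j \<tau> w) \<le> norm (h j)"
      using eventually_index_ge_1
    proof eventually_elim
      case (elim j)
      show ?case
      proof
        fix w assume w: "w \<in> ball w0 (min \<delta> v0) \<inter> S"
        hence "\<i> * (w - \<tau>) \<in> ball (\<i> * (w0 - \<tau>)) \<delta>"
          by (simp add: dist_norm right_diff_distrib[symmetric] norm_mult)
        from \<delta>(2)[OF this] have "norm (X_term j \<tau> w) \<le> \<delta> powr (- \<kappa>) * norm (a j * e_fun (m0 + real j) (cnj w))"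
          by (intro X_term_bound[OF elim _ \<delta>(1)]) auto
        moreover have "norm (e_fun (m0 + real j) (cnj w)) \<le> norm (e_fun (m0 + real j) (\<i> * of_real v0))"
        proof -
          have "\<bar>Im (w0 - w)\<bar> < v0" using w abs_Im_le_cmod[of "w0 - w"] by (simp add: dist_norm)
          hence "v0 \<le> Im (cnj w)" by (simp add: v0_def)
          hence "2 * pi * (m0 + real j) * v0 \<le> 2 * pi * (m0 + real j) * Im (cnj w)"
            using elim by (intro mult_left_mono) auto
          thus ?thesis unfolding norm_e_fun by simp
        qed
        hence "\<delta> powr (- \<kappa>) * norm (a j * e_fun (m0 + real j) (cnj w))
            \<le> \<delta> powr (- \<kappa>) * norm (a j * e_fun (m0 + real j) (\<i> * of_real v0))"
          unfolding norm_mult by (intro mult_left_mono) auto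
        moreover have "norm (h j) = \<delta> powr (- \<kappa>) * norm (a j * e_fun (m0 + real j) (\<i> * of_real v0))"
          unfolding h_def norm_of_real by (rule abs_of_nonneg) simp
        ultimately show "norm (X_term j \<tau> w) \<le> norm (h j)" by linarith
      qed
    qed
    ultimately show "\<exists>d (h :: nat \<Rightarrow> complex). 0 < d \<and> summable h \<and> range h \<subseteq> \<real>\<^sub>\<ge>\<^sub>0 \<and>
       (\<forall>\<^sub>F j in sequentially. \<forall>w\<in>ball w0 d \<inter> S. norm (X_term j \<tau> w) \<le> norm (h j))"
      using \<delta>(1) v0 by (intro exI[of _ "min \<delta> v0"] exI[of _ h]) auto
  qed
  then obtain g g' where g: "\<And>w. w \<in> S \<Longrightarrow> (\<lambda>j. X_term j \<tau> w) sums g w" "\<And>w. w \<in> S \<Longrightarrow> (\<lambda>j. D j w) sums g' w"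
    "\<And>w. w \<in> S \<Longrightarrow> (g has_field_derivative g' w) (at w)" by blast
  have wS: "w \<in> S" using w by (simp add: S_def)
  have "(X \<tau> has_field_derivative g' w) (at w)"
  proof (rule has_field_derivative_transform_within_open[OF g(3)[OF wS] op wS])
    show "g x = X \<tau> x" if "x \<in> S" for x using g(1)[OF that] by (simp add: X_def sums_iff)
  qed
  have "(\<lambda>j. D j w) sums (\<i> * (\<i> * (w - \<tau>)) powr of_real (- \<kappa>) * cnj (f (cnj w)))"
  proof -
    have "(\<lambda>j. cnj (a j * e_fun (m0 + real j) (cnj w))) sums cnj (f (cnj w))"
      unfolding sums_cnj by (rule f_sums) (use w in \<open>simp add: upper_half_def\<close>)
    moreover have "cnj (a j * e_fun (m0 + real j) (cnj w)) = cnj (a j) * e_fun (- (m0 + real j)) w" for j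
      unfolding complex_cnj_mult cnj_e_fun by simp
    ultimately have "(\<lambda>j. cnj (a j) * e_fun (- (m0 + real j)) w) sums cnj (f (cnj w))" by (simp only:)
    thus ?thesis unfolding D_def by (rule sums_mult)
  qed
  from sums_unique2[OF g(2)[OF wS] this] \<open>(X \<tau> has_field_derivative g' w) (at w)\<close>
  show ?thesis by simp
qed

end

section \<open>Harmonic Maass forms\<close>

lemma exp_growth_add:
  assumes "exp_growth g" "exp_growth h"
  shows "exp_growth (\<lambda>\<tau>. g \<tau> + h \<tau>)"
proof -
  obtain C K Y where 1: "K > 0" "\<And>\<tau>. Im \<tau> \<ge> Y \<Longrightarrow> norm (g \<tau>) \<le> K * exp (C * Im \<tau>)"
    using exp_growthD[OF assms(1)] by auto
  obtain C' K' Y' where 2: "K' > 0" "\<And>\<tau>. Im \<tau> \<ge> Y' \<Longrightarrow> norm (h \<tau>) \<le> K' * exp (C' * Im \<tau>)"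
    using exp_growthD[OF assms(2)] by auto
  show ?thesis
  proof (rule exp_growthI)
    fix \<tau> assume \<tau>: "Im \<tau> \<ge> max 0 (max Y Y')"
    have "K * exp (C * Im \<tau>) \<le> K * exp (max C C' * Im \<tau>)"
      using \<tau> 1(1) by (intro mult_left_mono) (auto intro!: mult_right_mono)
    hence "norm (g \<tau>) \<le> K * exp (max C C' * Im \<tau>)" using 1(2)[of \<tau>] \<tau> by simp
    moreover have "K' * exp (C' * Im \<tau>) \<le> K' * exp (max C C' * Im \<tau>)"
      using \<tau> 2(1) by (intro mult_left_mono) (auto intro!: mult_right_mono)
    hence "norm (h \<tau>) \<le> K' * exp (max C C' * Im \<tau>)" using 2(2)[of \<tau>] \<tau> by simp
    ultimately show "norm (g \<tau> + h \<tau>) \<le> (K + K') * exp (max C C' * Im \<tau>)"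
      using norm_triangle_ineq[of "g \<tau>" "h \<tau>"] by (simp add: distrib_right)
  qed
qed

lemma exp_growth_cmult:
  assumes "exp_growth g"
  shows "exp_growth (\<lambda>\<tau>. c * g \<tau>)"
proof -
  obtain C K Y where 1: "K > 0" "\<And>\<tau>. Im \<tau> \<ge> Y \<Longrightarrow> norm (g \<tau>) \<le> K * exp (C * Im \<tau>)"
    using exp_growthD[OF assms(1)] by auto
  show ?thesis
  proof (rule exp_growthI)
    fix \<tau> assume "Im \<tau> \<ge> Y"
    from mult_left_mono[OF 1(2)[OF this], of "norm c"]
    show "norm (c * g \<tau>) \<le> (norm c * K) * exp (C * Im \<tau>)" by (simp add: norm_mult mult.assoc)
  qed
qed

lemma exp_growth_sum:
  assumes "\<And>j. j \<in> J \<Longrightarrow> exp_growth (g j)"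
  shows "exp_growth (\<lambda>\<tau>. \<Sum>j\<in>J. g j \<tau>)"
proof -
  have zero: "exp_growth (\<lambda>_. 0)" by (rule exp_growthI[of 0 _ 0 0]) simp
  show ?thesis
  proof (cases "finite J")
    case True
    thus ?thesis using assms by (induction J rule: finite_induct) (auto simp: zero intro: exp_growth_add)
  qed (simp add: zero)
qed

lemma has_sum_add_zero:
  fixes g :: "real \<Rightarrow> complex"
  assumes "(g has_sum S) (I - {0})" "0 \<notin> I \<Longrightarrow> g 0 = 0"
  shows "(g has_sum (g 0 + S)) I"
proof (cases "0 \<in> I")
  case True
  have "(g has_sum (g 0 + S)) (insert 0 (I - {0}))"
    by (rule has_sum_insert) (use assms(1) in auto)
  thus ?thesis using True by (simp add: insert_absorb)
qed (use assms in simp)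

lemma has_sum_remove_zero:
  fixes g :: "real \<Rightarrow> complex"
  assumes "(g has_sum S) I" "0 \<notin> I \<Longrightarrow> g 0 = 0"
  shows "(g has_sum (S - g 0)) (I - {0})"
proof (cases "0 \<in> I")
  case True
  hence "(g has_sum (S - g 0)) (I - {0})"
    using assms(1) has_sum_finite[of "{0}" g] by (intro has_sum_Diff) auto
  thus ?thesis .
qed (use assms in simp)

context eichler_integral
begin

lemma diagonal: "\<i> * (cnj \<tau> - \<tau>) = of_real (2 * Im \<tau>)"
  by (simp add: complex_eq_iff)

text \<open>For the finitely many terms to which \<open>X_term_bound\<close> does not apply a crude
  estimate is enough: the derivative of \<open>T n\<close> on the positive axis is at most exp(By),
  integrated from y = 2, the value of 2 Im \<tau> at height 1.\<close>

lemma exp_growth_X_term: "exp_growth (\<lambda>\<tau>. X_term j \<tau> (cnj \<tau>))"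
proof -
  define n where "n = - (m0 + real j)"
  \<comment> \<open>The summand 1 keeps \<open>B\<close> positive even for n = 0, so that exp(By)/B
    is a primitive.\<close>
  define B where "B = 2 * pi * \<bar>n\<bar> + 1"
  have B: "B \<ge> 1" "2 * pi * n \<le> B" "- (2 * pi * n) \<le> B"
  proof -
    have "2 * pi * n \<le> 2 * pi * \<bar>n\<bar>" "2 * pi * (- n) \<le> 2 * pi * \<bar>n\<bar>" by (intro mult_left_mono; simp)+
    moreover have "0 \<le> 2 * pi * \<bar>n\<bar>" by simp
    ultimately show "B \<ge> 1" "2 * pi * n \<le> B" "- (2 * pi * n) \<le> B"
      unfolding B_def mult_minus_right by linarith+
  qed
  have slit: "complex_of_real y \<notin> \<real>\<^sub>\<le>\<^sub>0" if "y > 0" for y using that by (simp add: complex_nonpos_Reals_iff)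
  have Tn: "norm (T n (of_real y)) \<le> (norm (T n 2) + 1) * exp (B * y)" if y: "y \<ge> 2" for y
  proof (cases "y = 2")
    case True
    have "norm (T n 2) * 1 \<le> (norm (T n 2) + 1) * exp (B * 2)"
      using B by (intro mult_mono) auto
    thus ?thesis using True by simp
  next
    case False
    define g where "g y = of_real y powr of_real (- \<kappa>) * exp (complex_of_real (2 * pi * n) * of_real y)" for y :: real
    have der: "((\<lambda>y. T n (of_real y)) has_vector_derivative g y) (at y)" if "y > 0" for y
      using has_vector_derivative_real_field[OF T_deriv[OF slit[OF that]]] by (simp only: g_def)
    have "norm (T n (of_real y) - T n (of_real 2)) \<le> exp (B * y) / B - exp (B * 2) / B"
    proof (rule differentiable_bound_general[where f' = g and \<phi>' = "\<lambda>y. exp (B * y)"])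
      show "2 < y" using y False by simp
      show "continuous_on {2..y} (\<lambda>y. T n (of_real y))"
        by (intro continuous_at_imp_continuous_on ballI has_vector_derivative_continuous[OF der]) auto
      show "continuous_on {2..y} (\<lambda>y. exp (B * y) / B)" using B by (intro continuous_intros) auto
      show "((\<lambda>y. exp (B * y) / B) has_vector_derivative exp (B * x)) (at x)" for x
        unfolding has_real_derivative_iff_has_vector_derivative[symmetric]
        using B by (auto intro!: derivative_eq_intros)
      show "norm (g x) \<le> exp (B * x)" if "2 < x" for x
      proof -
        have "norm (g x) = x powr (- \<kappa>) * exp (2 * pi * n * x)"
          using that unfolding g_def norm_mult norm_powr_of_real norm_exp_eq_Re by simp
        also have "\<dots> \<le> 1 * exp (B * x)"
        proof (rule mult_mono)
          have "x powr (- \<kappa>) \<le> 1 powr (- \<kappa>)" using that \<kappa> by (intro powr_mono2') auto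
          thus "x powr (- \<kappa>) \<le> 1" by simp
          show "exp (2 * pi * n * x) \<le> exp (B * x)" using B that by (simp add: mult_right_mono)
        qed auto
        finally show ?thesis by simp
      qed
    qed (use der in auto)
    also have "\<dots> \<le> exp (B * y) / B" using B by simp
    also have "\<dots> \<le> exp (B * y) / 1" using B by (intro divide_left_mono) auto
    finally have "norm (T n (of_real y)) \<le> norm (T n 2) * 1 + exp (B * y)"
      using norm_triangle_sub[of "T n (of_real y)" "T n 2"] by simp
    also have "\<dots> \<le> norm (T n 2) * exp (B * y) + exp (B * y)"
      using B y by (intro add_right_mono mult_left_mono) auto
    finally show ?thesis by (simp add: distrib_right)
  qed
  show ?thesis
  proof (rule exp_growthI)
    fix \<tau> assume \<tau>: "Im \<tau> \<ge> 1"
    have "norm (X_term j \<tau> (cnj \<tau>)) = norm (a j) * exp (- (2 * pi * n) * Im \<tau>) * norm (T n (of_real (2 * Im \<tau>)))"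
      unfolding X_term_def diagonal norm_mult norm_e_fun by (simp add: n_def)
    also have "\<dots> \<le> norm (a j) * exp (B * Im \<tau>) * ((norm (T n 2) + 1) * exp (B * (2 * Im \<tau>)))"
    proof (intro mult_mono Tn)
      have "- (2 * pi * n) * Im \<tau> \<le> B * Im \<tau>" using B \<tau> by (intro mult_right_mono) auto
      thus "exp (- (2 * pi * n) * Im \<tau>) \<le> exp (B * Im \<tau>)" by simp
    qed (use \<tau> in auto)
    also have "\<dots> = (norm (a j) * (norm (T n 2) + 1)) * exp (3 * B * Im \<tau>)"
      by (simp add: exp_add[symmetric] algebra_simps)
    finally show "norm (X_term j \<tau> (cnj \<tau>)) \<le> (norm (a j) * (norm (T n 2) + 1)) * exp (3 * B * Im \<tau>)" .
  qed
qed

text \<open>From index \<open>J\<close> on, the terms are bounded for Im \<tau> \<ge> 1 by the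
  corresponding terms of the expansion of \<open>f\<close> at \<i>, because the exponentials of
  positive index decrease with the height. The terms before \<open>J\<close> are estimated one by
  one.\<close>

lemma exp_growth_X: "exp_growth (\<lambda>\<tau>. X \<tau> (cnj \<tau>))"
proof -
  obtain J where J: "\<And>j. j \<ge> J \<Longrightarrow> 1 \<le> m0 + real j"
    using eventually_index_ge_1 by (auto simp: eventually_sequentially)
  define M where "M j = norm (a j * e_fun (m0 + real j) \<i>)" for j
  have "summable M" unfolding M_def by (rule f_summable) (simp add: upper_half_def)
  hence sumM: "summable (\<lambda>j. M (j + J))" by (simp only: summable_iff_shift)
  have tail: "exp_growth (\<lambda>\<tau>. \<Sum>j. X_term (j + J) \<tau> (cnj \<tau>))"
  proof (rule exp_growthI)
    fix \<tau> assume \<tau>: "Im \<tau> \<ge> 1"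
    have bd: "norm (X_term (j + J) \<tau> (cnj \<tau>)) \<le> M (j + J)" for j
    proof -
      have idx: "1 \<le> m0 + real (j + J)" by (rule J) simp
      have "norm (X_term (j + J) \<tau> (cnj \<tau>)) \<le> 1 powr (- \<kappa>) * norm (a (j + J) * e_fun (m0 + real (j + J)) (cnj (cnj \<tau>)))"
      proof (rule X_term_bound[OF idx])
        show "1 \<le> norm (\<i> * (cnj \<tau> - \<tau>) + of_real s)" if "s \<ge> 0" for s
          unfolding diagonal of_real_add[symmetric] norm_of_real using that \<tau> by simp
      qed (use \<tau> in \<open>auto intro!: rotate_difference_slit\<close>)
      also have "\<dots> \<le> M (j + J)"
      proof -
        have "2 * pi * (m0 + real (j + J)) * 1 \<le> 2 * pi * (m0 + real (j + J)) * Im \<tau>"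
          using idx \<tau> by (intro mult_left_mono) auto
        thus ?thesis unfolding M_def norm_mult norm_e_fun complex_cnj_cnj by (simp add: mult_left_mono)
      qed
      finally show ?thesis .
    qed
    have s: "summable (\<lambda>j. norm (X_term (j + J) \<tau> (cnj \<tau>)))"
      by (rule summable_comparison_test'[OF sumM, of 0]) (use bd in simp)
    have "norm (\<Sum>j. X_term (j + J) \<tau> (cnj \<tau>)) \<le> (\<Sum>j. norm (X_term (j + J) \<tau> (cnj \<tau>)))"
      by (rule summable_norm[OF s])
    also have "\<dots> \<le> (\<Sum>j. M (j + J))" by (rule suminf_le[OF bd s sumM])
    finally show "norm (\<Sum>j. X_term (j + J) \<tau> (cnj \<tau>)) \<le> (\<Sum>j. M (j + J)) * exp (0 * Im \<tau>)" by simp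
  qed
  have "exp_growth (\<lambda>\<tau>. (\<Sum>j. X_term (j + J) \<tau> (cnj \<tau>)) + (\<Sum>j<J. X_term j \<tau> (cnj \<tau>)))"
    by (intro exp_growth_add tail exp_growth_sum exp_growth_X_term)
  from exp_growthD[OF this] obtain C K Y where K:
    "\<And>\<tau>. Im \<tau> \<ge> Y \<Longrightarrow> norm ((\<Sum>j. X_term (j + J) \<tau> (cnj \<tau>)) + (\<Sum>j<J. X_term j \<tau> (cnj \<tau>))) \<le> K * exp (C * Im \<tau>)"
    by auto
  show ?thesis
  proof (rule exp_growthI)
    fix \<tau> assume \<tau>: "Im \<tau> \<ge> max Y 1"
    have "summable (\<lambda>j. X_term j \<tau> (cnj \<tau>))"
      by (rule summable_norm_cancel[OF X_term_summable]) (use \<tau> in \<open>auto intro!: rotate_difference_slit\<close>)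
    hence "X \<tau> (cnj \<tau>) = (\<Sum>j. X_term (j + J) \<tau> (cnj \<tau>)) + (\<Sum>j<J. X_term j \<tau> (cnj \<tau>))"
      unfolding X_def by (rule suminf_split_initial_segment)
    thus "norm (X \<tau> (cnj \<tau>)) \<le> K * exp (C * Im \<tau>)" using K[of \<tau>] \<tau> by simp
  qed
qed

text \<open>\<open>X\<close> is complex differentiable in each variable, and joint continuity of the
  derivative in w yields a total derivative, which is composed with the map sending \<tau> to the
  pair of \<tau> and its conjugate. \<open>D\<close> is left unspecified: only the coefficient of
  \<open>cnj h\<close>, the derivative with respect to the conjugate variable, is compared with
  \<open>xi\<close>.\<close>

lemma has_derivative_X_diagonal:
  assumes \<tau>: "\<tau> \<in> upper_half"
  shows "\<exists>D. ((\<lambda>\<tau>. X \<tau> (cnj \<tau>)) has_derivative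
    (\<lambda>h. D * h + \<i> * of_real ((2 * Im \<tau>) powr (- \<kappa>)) * cnj (f \<tau>) * cnj h)) (at \<tau>)"
proof -
  define L where "L = {w. Im w < 0}"
  define Xw where "Xw \<tau> w = \<i> * (\<i> * (w - \<tau>)) powr of_real (- \<kappa>) * cnj (f (cnj w))" for \<tau> w
  have v: "Im \<tau> > 0" using \<tau> by (simp add: upper_half_def)
  have slit: "\<i> * (w - t) \<notin> \<real>\<^sub>\<le>\<^sub>0" if "t \<in> upper_half" "w \<in> L" for t w
    using that by (intro rotate_difference_slit) (simp add: L_def upper_half_def)
  have cL: "cnj \<tau> \<in> L" using v by (simp add: L_def)
  have "(\<lambda>t. X t (cnj \<tau>)) holomorphic_on {t. \<i> * (cnj \<tau> - t) \<notin> \<real>\<^sub>\<le>\<^sub>0}"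
    by (rule X_holomorphic) (use v in simp)
  from holomorphic_derivI[OF this open_slit_left, of \<tau>] obtain D where
    D: "((\<lambda>t. X t (cnj \<tau>)) has_field_derivative D) (at \<tau>)"
    using slit[OF \<tau> cL] by blast
  have "((\<lambda>(t, w). X t w) has_derivative
      (\<lambda>(t, w). D * t + blinfun_apply (blinfun_mult_right (Xw \<tau> (cnj \<tau>))) w)) (at (\<tau>, cnj \<tau>) within upper_half \<times> L)"
  proof (rule has_derivative_partialsI[where fy = "\<lambda>t w. blinfun_mult_right (Xw t w)"])
    show "((\<lambda>t. X t (cnj \<tau>)) has_derivative (*) D) (at \<tau> within upper_half)"
      using D by (simp add: has_field_derivative_def has_derivative_at_withinI)
    show "(X t has_derivative blinfun_apply (blinfun_mult_right (Xw t w))) (at w within L)"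
      if "t \<in> upper_half" "w \<in> L" for t w
    proof -
      have "(X t has_field_derivative Xw t w) (at w)"
        unfolding Xw_def using that by (intro has_field_derivative_X) (auto simp: L_def)
      hence "(X t has_derivative blinfun_apply (blinfun_mult_right (Xw t w))) (at w)"
        by (simp add: has_field_derivative_def blinfun_mult_right.rep_eq)
      thus ?thesis by (rule has_derivative_at_withinI)
    qed
    show "continuous (at (\<tau>, cnj \<tau>) within upper_half \<times> L) (\<lambda>(t, w). blinfun_mult_right (Xw t w))"
    proof -
      have "continuous_on (upper_half \<times> L) (\<lambda>p. f (cnj (snd p)))"
        by (rule continuous_on_compose2[OF holomorphic_on_imp_continuous_on[OF f_holomorphic]])
           (auto intro!: continuous_intros simp: L_def upper_half_def)
      moreover have "continuous_on (upper_half \<times> L) (\<lambda>p. (\<i> * (snd p - fst p)) powr of_real (- \<kappa>))"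
      proof (rule continuous_on_compose2[where g = "\<lambda>z. z powr of_real (- \<kappa>)" and f = "\<lambda>p. \<i> * (snd p - fst p)"])
        show "continuous_on (- \<real>\<^sub>\<le>\<^sub>0) (\<lambda>z :: complex. z powr of_real (- \<kappa>))"
          by (intro holomorphic_on_imp_continuous_on holomorphic_intros) auto
        show "continuous_on (upper_half \<times> L) (\<lambda>p. \<i> * (snd p - fst p))" by (intro continuous_intros)
      qed (use slit in auto)
      ultimately have "continuous_on (upper_half \<times> L) (\<lambda>p. Xw (fst p) (snd p))"
        unfolding Xw_def by (intro continuous_on_mult continuous_on_const continuous_on_cnj)
      hence "continuous_on (upper_half \<times> L) (\<lambda>p. blinfun_mult_right (Xw (fst p) (snd p)))"
        by (rule bounded_linear.continuous_on[OF bounded_linear_blinfun_mult_right])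
      thus ?thesis
        using \<tau> cL unfolding case_prod_beta' by (simp add: continuous_on_eq_continuous_within)
    qed
    show "convex L" unfolding L_def by (rule convex_halfspace_Im_lt)
  qed (rule cL)
  moreover have "(\<lambda>t. (t, cnj t)) ` upper_half \<subseteq> upper_half \<times> L"
    by (auto simp: upper_half_def L_def)
  ultimately have outer: "((\<lambda>(t, w). X t w) has_derivative
      (\<lambda>(t, w). D * t + blinfun_apply (blinfun_mult_right (Xw \<tau> (cnj \<tau>))) w)) (at (\<tau>, cnj \<tau>) within (\<lambda>t. (t, cnj t)) ` upper_half)"
    by (rule has_derivative_subset)
  have inner: "((\<lambda>t. (t, cnj t)) has_derivative (\<lambda>h. (h, cnj h))) (at \<tau> within upper_half)"
    by (auto intro!: derivative_eq_intros)
  have "((\<lambda>t. X t (cnj t)) has_derivative (\<lambda>h. D * h + Xw \<tau> (cnj \<tau>) * cnj h)) (at \<tau> within upper_half)"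
    using has_derivative_in_compose[OF inner outer] by (simp add: blinfun_mult_right.rep_eq)
  moreover have "at \<tau> within upper_half = at \<tau>"
    using \<tau> by (rule at_within_open) (simp add: upper_half_def open_halfspace_Im_gt)
  ultimately have "((\<lambda>t. X t (cnj t)) has_derivative (\<lambda>h. D * h + Xw \<tau> (cnj \<tau>) * cnj h)) (at \<tau>)"
    by (simp only:)
  moreover have "Xw \<tau> (cnj \<tau>) = \<i> * of_real ((2 * Im \<tau>) powr (- \<kappa>)) * cnj (f \<tau>)"
    unfolding Xw_def diagonal complex_cnj_cnj using v
    by (simp only: powr_of_real mult_nonneg_nonneg less_imp_le zero_le_numeral)
  ultimately have "((\<lambda>\<tau>. X \<tau> (cnj \<tau>)) has_derivative
    (\<lambda>h. D * h + \<i> * of_real ((2 * Im \<tau>) powr (- \<kappa>)) * cnj (f \<tau>) * cnj h)) (at \<tau>)" by (simp only:)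
  thus ?thesis by (rule exI)
qed

end

lemma frechet_derivative_d_u_d_v:
  assumes "F differentiable (at \<tau>)"
  shows "(F has_derivative (\<lambda>h. (d_u F \<tau> - \<i> * d_v F \<tau>) / 2 * h + d_taubar F \<tau> * cnj h)) (at \<tau>)"
proof -
  have F: "(F has_derivative frechet_derivative F (at \<tau>)) (at \<tau>)"
    using assms by (simp add: frechet_derivative_works)
  interpret bounded_linear "frechet_derivative F (at \<tau>)" by (rule has_derivative_bounded_linear[OF F])
  have "frechet_derivative F (at \<tau>) h = (d_u F \<tau> - \<i> * d_v F \<tau>) / 2 * h + d_taubar F \<tau> * cnj h" for h
  proof -
    have "frechet_derivative F (at \<tau>) h = frechet_derivative F (at \<tau>) (Re h *\<^sub>R 1 + Im h *\<^sub>R \<i>)"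
      by (rule arg_cong[of _ _ "frechet_derivative F (at \<tau>)"]) (simp add: complex_eq_iff)
    also have "\<dots> = of_real (Re h) * d_u F \<tau> + of_real (Im h) * d_v F \<tau>"
      unfolding add scaleR d_u_def d_v_def by (simp add: scaleR_conv_of_real)
    also have "\<dots> = (d_u F \<tau> - \<i> * d_v F \<tau>) / 2 * (of_real (Re h) + \<i> * of_real (Im h))
        + d_taubar F \<tau> * (of_real (Re h) - \<i> * of_real (Im h))"
      by (simp add: d_taubar_def field_simps)
    also have "of_real (Re h) + \<i> * of_real (Im h) = h" by (simp add: complex_eq_iff)
    also have "of_real (Re h) - \<i> * of_real (Im h) = cnj h" by (simp add: complex_eq_iff)
    finally show ?thesis .
  qed
  hence "frechet_derivative F (at \<tau>) = (\<lambda>h. (d_u F \<tau> - \<i> * d_v F \<tau>) / 2 * h + d_taubar F \<tau> * cnj h)" by blast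
  with F show ?thesis by simp
qed

section \<open>Splitting off the holomorphic part and existence of the expansion\<close>

context eichler_integral
begin

text \<open>From \<open>xi\<close> the derivative of \<open>F\<close> with respect to the conjugate
  variable is (\<i>/2) v^(-\<kappa>) times \<open>cnj (f \<tau>)\<close>; for the diagonal of
  \<open>X\<close> it is \<i> (2v)^(-\<kappa>) times \<open>cnj (f \<tau>)\<close>. The quotient is
  the constant 2^(\<kappa> - 1), and after subtraction a complex linear derivative remains.\<close>

lemma holomorphic_part:
  assumes "\<And>\<tau>. \<tau> \<in> upper_half \<Longrightarrow> F differentiable (at \<tau>)"
    and "\<And>\<tau>. \<tau> \<in> upper_half \<Longrightarrow> xi \<kappa> F \<tau> = f \<tau>"
  shows "(\<lambda>\<tau>. F \<tau> - of_real (2 powr (\<kappa> - 1)) * X \<tau> (cnj \<tau>)) holomorphic_on upper_half"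
proof (rule holomorphic_onI)
  fix \<tau> assume \<tau>: "\<tau> \<in> upper_half"
  hence v: "Im \<tau> > 0" by (simp add: upper_half_def)
  obtain D where D: "((\<lambda>\<tau>. X \<tau> (cnj \<tau>)) has_derivative
    (\<lambda>h. D * h + \<i> * of_real ((2 * Im \<tau>) powr (- \<kappa>)) * cnj (f \<tau>) * cnj h)) (at \<tau>)"
    using has_derivative_X_diagonal[OF \<tau>] by blast
  have tb: "d_taubar F \<tau> = of_real (2 powr (\<kappa> - 1)) * (\<i> * of_real ((2 * Im \<tau>) powr (- \<kappa>)) * cnj (f \<tau>))"
  proof -
    have "cnj (f \<tau>) = - (2 * \<i>) * of_real (Im \<tau> powr \<kappa>) * d_taubar F \<tau>"
      using arg_cong[OF assms(2)[OF \<tau>], of cnj] by (simp add: xi_def)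
    hence "of_real (2 powr (\<kappa> - 1)) * (\<i> * of_real ((2 * Im \<tau>) powr (- \<kappa>)) * cnj (f \<tau>)) =
      of_real (2 * 2 powr (\<kappa> - 1) * (2 * Im \<tau>) powr (- \<kappa>) * Im \<tau> powr \<kappa>) * d_taubar F \<tau>"
      by (simp add: mult_ac)
    also have "2 * 2 powr (\<kappa> - 1) * (2 * Im \<tau>) powr (- \<kappa>) * Im \<tau> powr \<kappa> = 1"
      using v by (simp add: powr_mult powr_diff powr_minus field_simps)
    finally show ?thesis by simp
  qed
  define A where "A = (d_u F \<tau> - \<i> * d_v F \<tau>) / 2"
  have "((\<lambda>\<tau>. F \<tau> - of_real (2 powr (\<kappa> - 1)) * X \<tau> (cnj \<tau>)) has_derivative
     (\<lambda>h. (A * h + d_taubar F \<tau> * cnj h) - of_real (2 powr (\<kappa> - 1)) *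
        (D * h + \<i> * of_real ((2 * Im \<tau>) powr (- \<kappa>)) * cnj (f \<tau>) * cnj h))) (at \<tau>)"
    unfolding A_def
    by (intro has_derivative_diff has_derivative_mult_right D frechet_derivative_d_u_d_v assms(1) \<tau>)
  also have "(\<lambda>h. (A * h + d_taubar F \<tau> * cnj h) - of_real (2 powr (\<kappa> - 1)) *
        (D * h + \<i> * of_real ((2 * Im \<tau>) powr (- \<kappa>)) * cnj (f \<tau>) * cnj h)) =
      (*) (A - of_real (2 powr (\<kappa> - 1)) * D)"
    unfolding tb by (rule ext) (simp add: algebra_simps)
  finally show "(\<lambda>\<tau>. F \<tau> - of_real (2 powr (\<kappa> - 1)) * X \<tau> (cnj \<tau>)) field_differentiable at \<tau> within upper_half"
    unfolding field_differentiable_def has_field_derivative_def[symmetric]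
    by (blast intro: has_field_derivative_at_within)
qed

text \<open>On the diagonal \<open>T\<close> is evaluated at 2 Im \<tau>, which the translation does
  not change, and all exponentials acquire the same factor.\<close>

lemma X_periodic:
  assumes "\<tau> \<in> upper_half" "e_fun m0 1 = cnj \<eta>"
  shows "X (\<tau> + 1) (cnj (\<tau> + 1)) = \<eta> * X \<tau> (cnj \<tau>)"
proof -
  have idx: "e_fun (- (m0 + real j)) 1 = \<eta>" for j
  proof -
    have "e_fun (m0 + real j) 1 = e_fun m0 1 * e_fun 1 1 ^ j" unfolding e_fun_add[of m0] e_fun_of_nat ..
    also have "e_fun 1 1 = 1" by (simp add: exp_two_pi_i)
    finally have "e_fun (m0 + real j) 1 = cnj \<eta> * 1 ^ j" unfolding assms(2) .
    hence "e_fun (m0 + real j) 1 = cnj \<eta>" by (simp only: power_one mult_1_right)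
    from arg_cong[OF this, of cnj] show ?thesis by (simp only: cnj_e_fun complex_cnj_cnj complex_cnj_one)
  qed
  have term_eq: "X_term j (\<tau> + 1) (cnj (\<tau> + 1)) = \<eta> * X_term j \<tau> (cnj \<tau>)" for j
  proof -
    have "\<i> * (cnj (\<tau> + 1) - (\<tau> + 1)) = \<i> * (cnj \<tau> - \<tau>)" by simp
    thus ?thesis unfolding X_term_def e_fun_add_arg[of _ \<tau> 1] idx by (simp only: mult_ac)
  qed
  have sm: "(\<lambda>j. X_term j \<tau> (cnj \<tau>)) sums X \<tau> (cnj \<tau>)" if "\<tau> \<in> upper_half" for \<tau>
    using that by (intro X_sums rotate_difference_slit) (auto simp: upper_half_def)
  have "\<tau> + 1 \<in> upper_half" using assms(1) by (simp add: upper_half_def)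
  from sm[OF this] sums_mult[OF sm[OF assms(1)], of \<eta>] show ?thesis
    unfolding term_eq by (rule sums_unique2)
qed

text \<open>The holomorphic part inherits growth and translation behaviour from \<open>F\<close> and
  \<open>X\<close>, so it has a Fourier expansion, giving \<open>cp\<close>; the diagonal terms of
  \<open>X\<close> give \<open>cm\<close>. The value of the \<open>cp\<close> series is recorded in
  the conclusion, since \<open>maass_plus\<close> is that series.\<close>

lemma maass_expansion_exists:
  assumes "\<And>\<tau>. \<tau> \<in> upper_half \<Longrightarrow> F differentiable (at \<tau>)"
    and "\<And>\<tau>. \<tau> \<in> upper_half \<Longrightarrow> xi \<kappa> F \<tau> = f \<tau>"
    and per: "\<And>\<tau>. \<tau> \<in> upper_half \<Longrightarrow> F (\<tau> + 1) = \<rho>' (mp2_lift sl2z_T) * F \<tau>"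
    and \<eta>: "e_fun m0 1 = cnj (\<rho>' (mp2_lift sl2z_T))" "norm (\<rho>' (mp2_lift sl2z_T)) = 1"
    and "exp_growth F"
  shows "\<exists>cp cm. maass_expansion \<kappa> \<rho>' F cp cm \<and> (\<forall>\<tau>\<in>upper_half.
    ((\<lambda>n. cp n * e_fun n \<tau>) has_sum (F \<tau> - of_real (2 powr (\<kappa> - 1)) * X \<tau> (cnj \<tau>))) (fourier_index \<rho>'))"
proof -
  define s where "s = complex_of_real (2 powr (\<kappa> - 1))"
  define I where "I = fourier_index \<rho>'"
  define G where "G \<tau> = F \<tau> - s * X \<tau> (cnj \<tau>)" for \<tau>
  have eint: "e_fun (real j) 1 = 1" for j
    unfolding e_fun_of_nat by (simp add: exp_two_pi_i)
  have "\<exists>a' m0'. e_fun m0' 1 = \<rho>' (mp2_lift sl2z_T) \<and> (\<forall>\<tau>\<in>upper_half.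
      summable (\<lambda>j. norm (a' j * e_fun (m0' + real j) \<tau>)) \<and> (\<lambda>j. a' j * e_fun (m0' + real j) \<tau>) sums G \<tau>)"
  proof (rule fourier_expansion[OF _ _ \<eta>(2)])
    show "G holomorphic_on upper_half"
      using holomorphic_part[OF assms(1,2)] by (simp add: G_def[abs_def] s_def)
    show "G (\<tau> + 1) = \<rho>' (mp2_lift sl2z_T) * G \<tau>" if "\<tau> \<in> upper_half" for \<tau>
      unfolding G_def X_periodic[OF that \<eta>(1)] per[OF that] by (simp add: algebra_simps)
    have "exp_growth (\<lambda>\<tau>. F \<tau> + (- s) * X \<tau> (cnj \<tau>))"
      by (intro exp_growth_add exp_growth_cmult exp_growth_X assms)
    thus "exp_growth G" by (simp add: G_def[abs_def])
  qed
  then obtain a' m0' where a': "e_fun m0' 1 = \<rho>' (mp2_lift sl2z_T)"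
    "\<And>\<tau>. \<tau> \<in> upper_half \<Longrightarrow> summable (\<lambda>j. norm (a' j * e_fun (m0' + real j) \<tau>))"
    "\<And>\<tau>. \<tau> \<in> upper_half \<Longrightarrow> (\<lambda>j. a' j * e_fun (m0' + real j) \<tau>) sums G \<tau>" by auto
  \<comment> \<open>The holomorphic indices run upwards from m0', those of the non-holomorphic part
    downwards from -m0; both progressions lie in \<open>fourier_index \<rho>'\<close>.\<close>
  define \<psi> where "\<psi> j = m0' + real j" for j
  define \<phi> where "\<phi> j = - (m0 + real j)" for j
  have inj: "inj \<psi>" "inj \<phi>" by (auto simp: inj_def \<psi>_def \<phi>_def)
  have range\<psi>: "range \<psi> \<subseteq> I"
  proof
    fix n assume "n \<in> range \<psi>"
    then obtain j where j: "n = m0' + real j" by (auto simp: \<psi>_def)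
    have "e_fun n 1 = \<rho>' (mp2_lift sl2z_T) * 1"
      unfolding j e_fun_add[of m0'] eint a'(1) ..
    thus "n \<in> I" by (simp add: I_def fourier_index_def)
  qed
  have range\<phi>: "range \<phi> \<subseteq> I"
  proof
    fix n assume "n \<in> range \<phi>"
    then obtain j where j: "n = - (m0 + real j)" by (auto simp: \<phi>_def)
    have "e_fun (m0 + real j) 1 = cnj (\<rho>' (mp2_lift sl2z_T))"
      unfolding e_fun_add[of m0] eint \<eta>(1) by simp
    from arg_cong[OF this, of cnj] show "n \<in> I"
      unfolding j I_def fourier_index_def by (simp only: cnj_e_fun complex_cnj_cnj complex_cnj_one mem_Collect_eq)
  qed
  define cp where "cp n = (if n \<in> range \<psi> then a' (inv_into UNIV \<psi> n) else 0)" for n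
  define C where "C n = (if n \<in> range \<phi> then cnj (a (inv_into UNIV \<phi> n)) else 0)" for n
  \<comment> \<open>The factor \<open>\<beta> n\<close> converts the normalised primitive
    \<open>T n\<close> on the positive axis into \<open>W_fun\<close>, or into the power of v for
    index 0.\<close>
  define cm where "cm n = s * C n * \<beta> n" for n
  have cp\<psi>: "cp (\<psi> j) = a' j" for j using inj(1) by (simp add: cp_def)
  have cp_sum: "((\<lambda>n. cp n * e_fun n \<tau>) has_sum G \<tau>) I" if "\<tau> \<in> upper_half" for \<tau>
  proof (rule has_sum_of_sequence[OF inj(1) range\<psi>])
    show "summable (\<lambda>j. norm (cp (\<psi> j) * e_fun (\<psi> j) \<tau>))" "(\<lambda>j. cp (\<psi> j) * e_fun (\<psi> j) \<tau>) sums G \<tau>"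
      unfolding cp\<psi> using a'(2,3)[OF that] by (simp_all only: \<psi>_def)
  qed (simp add: cp_def)
  have X_sum: "((\<lambda>n. s * (C n * e_fun n \<tau> * T n (of_real (2 * Im \<tau>)))) has_sum s * X \<tau> (cnj \<tau>)) I"
    if \<tau>: "\<tau> \<in> upper_half" for \<tau>
  proof (rule has_sum_cmult_right, rule has_sum_of_sequence[OF inj(2) range\<phi>])
    have "C (\<phi> j) = cnj (a j)" for j using inj(2) by (simp add: C_def)
    hence eq: "C (\<phi> j) * e_fun (\<phi> j) \<tau> * T (\<phi> j) (of_real (2 * Im \<tau>)) = X_term j \<tau> (cnj \<tau>)" for j
      by (simp only: X_term_def diagonal \<phi>_def)
    have w: "Im (cnj \<tau>) < 0" "\<i> * (cnj \<tau> - \<tau>) \<notin> \<real>\<^sub>\<le>\<^sub>0"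
      using \<tau> by (auto simp: upper_half_def intro!: rotate_difference_slit)
    show "summable (\<lambda>j. norm (C (\<phi> j) * e_fun (\<phi> j) \<tau> * T (\<phi> j) (of_real (2 * Im \<tau>))))"
      unfolding eq by (rule X_term_summable[OF w])
    show "(\<lambda>j. C (\<phi> j) * e_fun (\<phi> j) \<tau> * T (\<phi> j) (of_real (2 * Im \<tau>))) sums X \<tau> (cnj \<tau>)"
      unfolding eq by (rule X_sums[OF w])
  qed (simp add: C_def)
  have "maass_expansion \<kappa> \<rho>' F cp cm"
    unfolding maass_expansion_def I_def[symmetric]
  proof (intro conjI allI impI ballI)
    show "cp n = 0" if "n \<notin> I" for n using that range\<psi> by (auto simp: cp_def)
    show "cm n = 0" if "n \<notin> I" for n using that range\<phi> by (auto simp: cm_def C_def)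
    fix \<tau> assume \<tau>: "\<tau> \<in> upper_half"
    hence v: "Im \<tau> > 0" by (simp add: upper_half_def)
    define g where "g n = s * (C n * e_fun n \<tau> * T n (of_real (2 * Im \<tau>)))" for n
    have "(g has_sum (s * X \<tau> (cnj \<tau>) - g 0)) (I - {0})"
    proof (rule has_sum_remove_zero)
      show "(g has_sum (s * X \<tau> (cnj \<tau>))) I" using X_sum[OF \<tau>] by (simp only: g_def[abs_def])
      show "g 0 = 0" if "0 \<notin> I" using that range\<phi> by (auto simp: g_def C_def)
    qed
    moreover have "g n = cm n * W_fun \<kappa> (2 * pi * n * Im \<tau>) * e_fun n \<tau>" if "n \<in> I - {0}" for n
    proof -
      have n0: "n \<noteq> 0" using that by simp
      show ?thesis unfolding g_def cm_def T_W[OF n0 v] by (simp only: mult_ac)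
    qed
    ultimately have "((\<lambda>n. cm n * W_fun \<kappa> (2 * pi * n * Im \<tau>) * e_fun n \<tau>) has_sum (s * X \<tau> (cnj \<tau>) - g 0)) (I - {0})"
      by (subst has_sum_cong[of _ _ g]) auto
    moreover have "g 0 = cm 0 * of_real (Im \<tau> powr (1 - \<kappa>))"
      unfolding g_def cm_def T_0[OF v] by simp
    hence "F \<tau> = G \<tau> + (cm 0 * of_real (Im \<tau> powr (1 - \<kappa>)) + (s * X \<tau> (cnj \<tau>) - g 0))"
      by (simp add: G_def)
    ultimately show "\<exists>Fp Fm. ((\<lambda>n. cp n * e_fun n \<tau>) has_sum Fp) I \<and>
        ((\<lambda>n. cm n * W_fun \<kappa> (2 * pi * n * Im \<tau>) * e_fun n \<tau>) has_sum Fm) (I - {0}) \<and>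
        F \<tau> = Fp + (cm 0 * of_real (Im \<tau> powr (1 - \<kappa>)) + Fm)"
      using cp_sum[OF \<tau>] by blast
  qed
  thus ?thesis using cp_sum unfolding I_def G_def s_def by blast
qed

end

section \<open>Uniqueness of the expansion\<close>

lemma W_fun_not_constant:
  assumes "\<kappa> > 1" "n \<noteq> 0"
  shows "\<exists>v1>0. \<exists>v2>0. W_fun \<kappa> (2 * pi * n * v1) \<noteq> W_fun \<kappa> (2 * pi * n * v2)"
proof (rule ccontr)
  assume neg: "\<not> ?thesis"
  obtain T \<beta> where "is_fourier_primitive \<kappa> n T \<beta>" using fourier_primitive[OF assms(1)] by blast
  hence T: "\<forall>y. y \<notin> \<real>\<^sub>\<le>\<^sub>0 \<longrightarrow>
        (T has_field_derivative y powr of_real (- \<kappa>) * exp (of_real (2 * pi * n) * y)) (at y)"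
    "\<forall>v>0. T (of_real (2 * v)) = \<beta> * W_fun \<kappa> (2 * pi * n * v)"
    using assms(2) by (simp_all add: is_fourier_primitive_def)
  have const: "T (of_real y) = T 2" if "y > 0" for y
  proof -
    have "T (of_real (2 * (y / 2))) = T (of_real (2 * 1))"
      using T(2)[rule_format, of "y / 2"] T(2)[rule_format, of 1] neg that
      by (metis half_gt_zero mult.right_neutral zero_less_one)
    thus ?thesis by simp
  qed
  \<comment> \<open>Constancy of \<open>W_fun\<close> would make \<open>T\<close> constant on the
    positive axis, whereas its derivative at 1 is an exponential.\<close>
  have "complex_of_real 1 \<notin> \<real>\<^sub>\<le>\<^sub>0" by (simp add: complex_nonpos_Reals_iff)
  from has_vector_derivative_real_field[OF T(1)[rule_format, OF this]]
  have 1: "((\<lambda>y. T (of_real y)) has_vector_derivative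
      of_real 1 powr of_real (- \<kappa>) * exp (of_real (2 * pi * n) * of_real 1)) (at 1)" .
  have "((\<lambda>y :: real. T (of_real y)) has_vector_derivative 0) (at 1)"
    by (rule has_vector_derivative_transform_within_open[of "\<lambda>_. T 2" _ _ "{0<..}"])
       (use const in \<open>auto intro!: derivative_eq_intros\<close>)
  from vector_derivative_unique_at[OF 1 this] show False by simp
qed

text \<open>At a fixed height the expansion is a Fourier series in Re \<tau>, so each n gives one
  linear relation between the differences of the coefficients. Two heights at which the
  non-holomorphic factor takes different values force both differences to vanish.\<close>

lemma maass_expansion_unique:
  assumes \<kappa>: "\<kappa> > 1" and 1: "maass_expansion \<kappa> \<rho> F cp cm" and 2: "maass_expansion \<kappa> \<rho> F cp' cm'"
  shows "cp = cp' \<and> cm = cm'"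
proof -
  define w where "w n v = (if n = 0 then of_real (v powr (1 - \<kappa>)) else W_fun \<kappa> (2 * pi * n * v))" for n v
  define I where "I = fourier_index \<rho>"
  have full: "((\<lambda>n. (cp n + cm n * w n (Im \<tau>)) * e_fun n \<tau>) has_sum F \<tau>) I"
    if e: "maass_expansion \<kappa> \<rho> F cp cm" and \<tau>: "\<tau> \<in> upper_half" for cp cm \<tau>
  proof -
    obtain Fp Fm where F: "((\<lambda>n. cp n * e_fun n \<tau>) has_sum Fp) I"
      "((\<lambda>n. cm n * W_fun \<kappa> (2 * pi * n * Im \<tau>) * e_fun n \<tau>) has_sum Fm) (I - {0})"
      "F \<tau> = Fp + (cm 0 * of_real (Im \<tau> powr (1 - \<kappa>)) + Fm)"
      using e \<tau> unfolding maass_expansion_def I_def by blast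
    define g where "g n = cm n * w n (Im \<tau>) * e_fun n \<tau>" for n
    have "(g has_sum Fm) (I - {0})"
      using F(2) by (subst has_sum_cong[of _ _ "\<lambda>n. cm n * W_fun \<kappa> (2 * pi * n * Im \<tau>) * e_fun n \<tau>"]) (auto simp: g_def w_def)
    moreover have "g 0 = 0" if "0 \<notin> I" using e that by (simp add: maass_expansion_def I_def g_def)
    ultimately have "(g has_sum (g 0 + Fm)) I" by (rule has_sum_add_zero)
    from has_sum_add[OF F(1) this]
    have "((\<lambda>n. cp n * e_fun n \<tau> + g n) has_sum (Fp + (g 0 + Fm))) I" .
    moreover have "g 0 = cm 0 * of_real (Im \<tau> powr (1 - \<kappa>))" by (simp add: g_def w_def)
    hence "F \<tau> = Fp + (g 0 + Fm)" using F(3) by simp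
    ultimately have "((\<lambda>n. cp n * e_fun n \<tau> + g n) has_sum F \<tau>) I" by simp
    thus ?thesis by (simp add: g_def distrib_right)
  qed
  have key: "(cp n - cp' n) + (cm n - cm' n) * w n v = 0" if v: "v > 0" and n: "n \<in> I" for n v
  proof -
    define A where "A n = ((cp n - cp' n) + (cm n - cm' n) * w n v) * e_fun n (\<i> * of_real v)" for n
    have "((\<lambda>n. A n * e_fun n (of_real u)) has_sum 0) {n. e_fun n 1 = \<rho> (mp2_lift sl2z_T)}" for u
    proof -
      define \<tau> where "\<tau> = \<i> * of_real v + of_real u"
      have \<tau>: "\<tau> \<in> upper_half" "Im \<tau> = v" using v by (simp_all add: \<tau>_def upper_half_def)
      have "((\<lambda>n. (cp n + cm n * w n v) * e_fun n \<tau> + - ((cp' n + cm' n * w n v) * e_fun n \<tau>)) has_sum (F \<tau> + - F \<tau>)) I"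
        using full[OF 1 \<tau>(1)] full[OF 2 \<tau>(1)] unfolding \<tau>(2) by (intro has_sum_add has_sum_uminusI)
      moreover have "(cp n + cm n * w n v) * e_fun n \<tau> + - ((cp' n + cm' n * w n v) * e_fun n \<tau>) = A n * e_fun n (of_real u)" for n
        unfolding A_def \<tau>_def e_fun_add_arg[of n "\<i> * of_real v"] by (simp add: algebra_simps)
      ultimately show ?thesis by (simp only: I_def fourier_index_def) simp
    qed
    from fourier_coeffs_unique[OF this] n have "A n = 0" by (simp add: I_def fourier_index_def)
    thus ?thesis by (simp add: A_def)
  qed
  have "cp n = cp' n \<and> cm n = cm' n" for n
  proof (cases "n \<in> I")
    case False
    thus ?thesis using 1 2 by (simp add: maass_expansion_def I_def)
  next
    case True
    obtain v1 v2 where v: "v1 > 0" "v2 > 0" "w n v1 \<noteq> w n v2"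
    proof (cases "n = 0")
      case True
      have "(2 :: real) powr (1 - \<kappa>) < 2 powr 0" using \<kappa> by (intro powr_less_mono) auto
      hence "w n 1 \<noteq> w n 2" using True \<kappa> by (simp add: w_def)
      thus ?thesis using that[of 1 2] by simp
    next
      case False
      thus ?thesis using W_fun_not_constant[OF \<kappa> False] that by (auto simp: w_def)
    qed
    have "(cm n - cm' n) * w n v1 = (cm n - cm' n) * w n v2"
      using key[OF v(1) True] key[OF v(2) True] by (metis add_left_cancel)
    hence "cm n = cm' n" using v(3) by simp
    thus ?thesis using key[OF v(1) True] by simp
  qed
  thus ?thesis by blast
qed

lemma maass_plus_eq:
  assumes "\<kappa> > 1" "maass_expansion \<kappa> \<rho> F cp cm" "((\<lambda>n. cp n * e_fun n \<tau>) has_sum S) (fourier_index \<rho>)"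
  shows "maass_plus \<kappa> \<rho> F \<tau> = S"
proof -
  have "maass_coeffs \<kappa> \<rho> F = (cp, cm)"
    unfolding maass_coeffs_def
  proof (rule the_equality)
    show "case (cp, cm) of (cp, cm) \<Rightarrow> maass_expansion \<kappa> \<rho> F cp cm" using assms(2) by simp
    fix x assume "case x of (cp, cm) \<Rightarrow> maass_expansion \<kappa> \<rho> F cp cm"
    hence "maass_expansion \<kappa> \<rho> F (fst x) (snd x)" by (simp add: case_prod_beta)
    from maass_expansion_unique[OF assms(1,2) this] show "x = (cp, cm)" by (simp add: prod_eq_iff)
  qed
  thus ?thesis using assms(3) by (simp add: maass_plus_def infsumI)
qed

section \<open>The cocycle\<close>

text \<open>Half-integral powers become integer powers of the square root, which are multiplicative
  without any condition on arguments.\<close>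

lemma csqrt_power_powr:
  assumes "y \<noteq> 0"
  shows "y powr of_real (- (real N / 2)) = inverse (csqrt y ^ N)"
proof -
  have "csqrt y ^ N = exp (of_nat N * (Ln y / 2))"
    unfolding csqrt_exp_Ln[OF assms] by (rule exp_of_nat_mult[symmetric])
  thus ?thesis using assms by (simp add: powr_def exp_minus[symmetric] algebra_simps)
qed

lemma sl2z_act_cnj: "sl2z_act M (cnj \<tau>) = cnj (sl2z_act M \<tau>)"
  by (simp add: sl2z_act_def autfac_def)

lemma autfac_cnj: "autfac M (cnj \<tau>) = cnj (autfac M \<tau>)"
  by (simp add: autfac_def)

lemma sl2z_act_diff:
  assumes "autfac M w \<noteq> 0" "autfac M \<tau> \<noteq> 0"
  shows "(sl2z_act M w - sl2z_act M \<tau>) * (autfac M w * autfac M \<tau>) = w - \<tau>"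
proof -
  let ?a = "complex_of_int (ea M)" and ?b = "complex_of_int (eb M)"
    and ?c = "complex_of_int (ec M)" and ?d = "complex_of_int (ed M)"
  have "(sl2z_act M w - sl2z_act M \<tau>) * (autfac M w * autfac M \<tau>) =
      (?a * w + ?b) * autfac M \<tau> - (?a * \<tau> + ?b) * autfac M w"
    using assms by (simp add: sl2z_act_def field_simps)
  also have "\<dots> = (?a * ?d - ?b * ?c) * (w - \<tau>)" by (simp add: autfac_def algebra_simps)
  finally show ?thesis by (simp only: sl2z_complex_det mult_1_left)
qed

lemma has_field_derivative_sl2z_act:
  assumes "autfac M w \<noteq> 0"
  shows "(sl2z_act M has_field_derivative inverse ((autfac M w)\<^sup>2)) (at w)"
proof -
  let ?a = "complex_of_int (ea M)" and ?b = "complex_of_int (eb M)"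
    and ?c = "complex_of_int (ec M)" and ?d = "complex_of_int (ed M)"
  have "(sl2z_act M has_field_derivative (?a * autfac M w - (?a * w + ?b) * ?c) / (autfac M w * autfac M w)) (at w)"
    unfolding sl2z_act_def[abs_def] using assms unfolding autfac_def
    by (auto intro!: derivative_eq_intros)
  also have "?a * autfac M w - (?a * w + ?b) * ?c = ?a * ?d - ?b * ?c" by (simp add: autfac_def algebra_simps)
  finally show ?thesis by (simp only: sl2z_complex_det power2_eq_square inverse_eq_divide)
qed

lemma Im_sl2z_act_neg: "Im w < 0 \<Longrightarrow> Im (sl2z_act M w) < 0"
  using sl2z_act_upper[of "cnj w" M] by (simp add: sl2z_act_cnj upper_half_def)

text \<open>The two sides agree up to sign because their squares do; both are positive at \<open>w = cnj \<tau>\<close>.\<close>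

lemma csqrt_sl2z_act_diff:
  assumes \<tau>: "\<tau> \<in> upper_half" and w: "Im w < 0"
  shows "csqrt (\<i> * (sl2z_act M w - sl2z_act M \<tau>)) * (sqrt_autfac M \<tau> * cnj (sqrt_autfac M (cnj w)))
    = csqrt (\<i> * (w - \<tau>))"
proof -
  define L where "L = {w. Im w < 0}"
  define p where "p w = csqrt (\<i> * (sl2z_act M w - sl2z_act M \<tau>)) * (sqrt_autfac M \<tau> * cnj (sqrt_autfac M (cnj w)))" for w
  define q where "q w = csqrt (\<i> * (w - \<tau>))" for w
  have \<tau>0: "Im \<tau> > 0" "autfac M \<tau> \<noteq> 0" using \<tau> autfac_nonzero[of \<tau> M] by (auto simp: upper_half_def)
  have Mt: "Im (sl2z_act M \<tau>) > 0" using sl2z_act_upper[OF \<tau>, of M] by (simp add: upper_half_def)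
  have L: "autfac M w \<noteq> 0" "\<i> * (w - \<tau>) \<notin> \<real>\<^sub>\<le>\<^sub>0" "\<i> * (sl2z_act M w - sl2z_act M \<tau>) \<notin> \<real>\<^sub>\<le>\<^sub>0" "w - \<tau> \<noteq> 0"
    if "w \<in> L" for w
  proof -
    have i: "Im w < 0" using that by (simp add: L_def)
    show "autfac M w \<noteq> 0" using i autfac_nonzero[of w M] by simp
    show "\<i> * (w - \<tau>) \<notin> \<real>\<^sub>\<le>\<^sub>0" using i \<tau>0 by (intro rotate_difference_slit) simp
    show "\<i> * (sl2z_act M w - sl2z_act M \<tau>) \<notin> \<real>\<^sub>\<le>\<^sub>0"
      using Im_sl2z_act_neg[OF i, of M] Mt by (intro rotate_difference_slit) simp
    show "w - \<tau> \<noteq> 0" using i \<tau>0 by auto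
  qed
  have sq: "(p w)\<^sup>2 = (q w)\<^sup>2" if "w \<in> L" for w
  proof -
    have "(p w)\<^sup>2 = \<i> * ((sl2z_act M w - sl2z_act M \<tau>) * (autfac M w * autfac M \<tau>))"
      unfolding p_def power_mult_distrib power2_csqrt sqrt_autfac_square complex_cnj_power[symmetric]
      by (simp add: autfac_cnj mult_ac)
    also have "\<dots> = \<i> * (w - \<tau>)" using sl2z_act_diff[OF L(1)[OF that] \<tau>0(2)] by simp
    finally show ?thesis by (simp add: q_def)
  qed
  have qnz: "q w \<noteq> 0" if "w \<in> L" for w using L(4)[OF that] by (simp add: q_def)
  have "(\<lambda>w. p w / q w) constant_on L"
  proof (rule continuous_finite_range_constant)
    show "connected L" unfolding L_def by (intro convex_connected convex_halfspace_Im_lt)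
    have csq: "continuous_on (- \<real>\<^sub>\<le>\<^sub>0) csqrt"
      by (intro holomorphic_on_imp_continuous_on holomorphic_intros) auto
    have "continuous_on L (\<lambda>w. csqrt (\<i> * (w - \<tau>)))"
      by (rule continuous_on_compose2[OF csq]) (use L in \<open>auto intro!: continuous_intros\<close>)
    moreover have "continuous_on L (sl2z_act M)"
      by (intro continuous_at_imp_continuous_on ballI DERIV_isCont[OF has_field_derivative_sl2z_act] L)
    hence "continuous_on L (\<lambda>w. \<i> * (sl2z_act M w - sl2z_act M \<tau>))" by (intro continuous_intros)
    hence "continuous_on L (\<lambda>w. csqrt (\<i> * (sl2z_act M w - sl2z_act M \<tau>)))"
      by (rule continuous_on_compose2[OF csq]) (use L in auto)
    moreover have "continuous_on L (\<lambda>w. sqrt_autfac M (cnj w))"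
      by (rule continuous_on_compose2[OF holomorphic_on_imp_continuous_on[OF sqrt_autfac_holomorphic]])
         (auto intro!: continuous_intros simp: L_def upper_half_def)
    ultimately show "continuous_on L (\<lambda>w. p w / q w)"
      unfolding p_def q_def using qnz unfolding q_def by (intro continuous_intros) auto
    have "p w / q w \<in> {1, -1}" if "w \<in> L" for w
    proof -
      have "(p w / q w)\<^sup>2 = 1" using sq[OF that] qnz[OF that] by (simp add: power_divide)
      thus ?thesis by (simp add: power2_eq_1_iff)
    qed
    hence "(\<lambda>w. p w / q w) ` L \<subseteq> {1, -1}" by blast
    thus "finite ((\<lambda>w. p w / q w) ` L)" by (rule finite_subset) simp
  qed
  then obtain c where c: "\<And>w. w \<in> L \<Longrightarrow> p w / q w = c" by (auto simp: constant_on_def)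
  have cL: "cnj \<tau> \<in> L" using \<tau>0 by (simp add: L_def)
  define r where "r = sqrt (2 * Im (sl2z_act M \<tau>)) * (norm (sqrt_autfac M \<tau>))\<^sup>2 / sqrt (2 * Im \<tau>)"
  have d: "\<i> * (cnj z - z) = of_real (2 * Im z)" for z by (simp add: complex_eq_iff)
  have "p (cnj \<tau>) / q (cnj \<tau>) = of_real r"
  proof -
    have "sqrt_autfac M \<tau> * cnj (sqrt_autfac M \<tau>) = of_real ((norm (sqrt_autfac M \<tau>))\<^sup>2)"
      by (rule complex_norm_square[symmetric])
    moreover have "csqrt (of_real (2 * Im z)) = of_real (sqrt (2 * Im z))" if "Im z > 0" for z
      using that by (intro of_real_sqrt[symmetric]) simp
    ultimately show ?thesis
      unfolding p_def q_def sl2z_act_cnj d complex_cnj_cnj r_def using \<tau>0 Mt by (simp only: of_real_mult of_real_divide)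
  qed
  moreover have "r > 0"
    unfolding r_def using \<tau>0 Mt sqrt_autfac_nonzero[OF \<tau>0(2)] by (intro divide_pos_pos mult_pos_pos) auto
  moreover have "c = 1 \<or> c = -1"
  proof -
    have "c\<^sup>2 = 1" using sq[OF cL] qnz[OF cL] c[OF cL] by (auto simp: power_divide)
    thus ?thesis by (simp add: power2_eq_1_iff)
  qed
  ultimately have "Re c > 0" "c = 1 \<or> c = -1" using c[OF cL] by auto
  hence "c = 1" by auto
  moreover have wL: "w \<in> L" using w by (simp add: L_def)
  ultimately have "p w = q w" using c[OF wL] qnz[OF wL] by (simp add: field_simps)
  thus ?thesis by (simp add: p_def q_def)
qed

section \<open>Dependence of \<open>X\<close> on the base point\<close>

context eichler_integral
begin

lemma slash_X_difference:
  fixes N :: nat and M :: sl2z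
  assumes N: "4 \<le> N" "\<kappa> = real N / 2"
    and \<rho>: "unitary_character \<rho>" and f: "modular (2 - \<kappa>) \<rho> f"
    and \<tau>: "\<tau> \<in> upper_half" and w: "Im w < 0" "Im w' < 0"
  defines "\<mu> \<equiv> sqrt_autfac M \<tau> powi (- \<lfloor>2 * \<kappa>\<rfloor>) * inverse (cnj (\<rho> (mp2_lift M)))"
  shows "\<mu> * X (sl2z_act M \<tau>) (sl2z_act M w) - X \<tau> w = \<mu> * X (sl2z_act M \<tau>) (sl2z_act M w') - X \<tau> w'"
proof -
  define L where "L = {w. Im w < 0}"
  \<comment> \<open>The weight of \<open>f\<close> is 2 - \<kappa> = -n/2. Its transformation
    contributes n factors of the inverse conjugated square root and the derivative of the Moebius
    map contributes 4; the total N = n + 4 matches the power in the kernel.\<close>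
  define n where "n = N - 4"
  have n: "N = n + 4" using N(1) by (simp add: n_def)
  have "real N = real n + 4" using n by simp
  moreover have \<kappa>2: "2 * \<kappa> = real N" using N(2) by simp
  ultimately have "2 * (2 - \<kappa>) = - real n" by (simp add: algebra_simps)
  with \<kappa>2 have fl: "\<lfloor>2 * \<kappa>\<rfloor> = int N" "\<lfloor>2 * (2 - \<kappa>)\<rfloor> = - int n" by linarith+
  have \<rho>nz: "\<rho> (mp2_lift M) \<noteq> 0" using \<rho> unfolding unitary_character_def by (metis norm_zero zero_neq_one)
  have \<mu>: "\<mu> = inverse (sqrt_autfac M \<tau> ^ N) * inverse (cnj (\<rho> (mp2_lift M)))"
    unfolding \<mu>_def fl by (simp add: power_int_minus)
  have Mt: "sl2z_act M \<tau> \<in> upper_half" by (rule sl2z_act_upper[OF \<tau>])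
  have "((\<lambda>w. \<mu> * X (sl2z_act M \<tau>) (sl2z_act M w) - X \<tau> w) has_field_derivative 0) (at w within L)" if "w \<in> L" for w
  proof -
    have w: "Im w < 0" using that by (simp add: L_def)
    hence j: "autfac M w \<noteq> 0" using autfac_nonzero[of w M] by simp
    have cw: "cnj w \<in> upper_half" using w by (simp add: upper_half_def)
    let ?D = "\<i> * (sl2z_act M w - sl2z_act M \<tau>)" and ?B = "\<lambda>w. \<mu> * X (sl2z_act M \<tau>) (sl2z_act M w) - X \<tau> w"
    define s where "s = sqrt_autfac M \<tau>"
    define S where "S = sqrt_autfac M (cnj w)"
    have nz: "s \<noteq> 0" "S \<noteq> 0"
      unfolding s_def S_def using autfac_nonzero[of \<tau> M] autfac_nonzero[of "cnj w" M] \<tau> w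
      by (auto intro!: sqrt_autfac_nonzero simp: upper_half_def)
    define P where "P = csqrt ?D"
    define Q where "Q = csqrt (\<i> * (w - \<tau>))"
    have PQ: "P * (s * cnj S) = Q"
      unfolding P_def Q_def s_def S_def by (rule csqrt_sl2z_act_diff[OF \<tau> w])
    have "w - \<tau> \<noteq> 0" using w \<tau> by (auto simp: upper_half_def)
    hence Qnz: "Q \<noteq> 0" by (simp add: Q_def)
    hence Pnz: "P \<noteq> 0" using PQ by auto
    have pw: "?D powr of_real (- \<kappa>) = inverse (P ^ N)"
      "(\<i> * (w - \<tau>)) powr of_real (- \<kappa>) = inverse (Q ^ N)"
    proof -
      have "?D \<noteq> 0" using Pnz unfolding P_def by force
      thus "?D powr of_real (- \<kappa>) = inverse (P ^ N)"
        unfolding P_def N(2) by (rule csqrt_power_powr)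
      have "\<i> * (w - \<tau>) \<noteq> 0" using Qnz unfolding Q_def by force
      thus "(\<i> * (w - \<tau>)) powr of_real (- \<kappa>) = inverse (Q ^ N)"
        unfolding Q_def N(2) by (rule csqrt_power_powr)
    qed
    have "slash (2 - \<kappa>) \<rho> f M (cnj w) = f (cnj w)" using f cw unfolding modular_def by blast
    hence "S ^ n * inverse (\<rho> (mp2_lift M)) * f (sl2z_act M (cnj w)) = f (cnj w)"
      unfolding slash_def fl S_def by simp
    hence "f (sl2z_act M (cnj w)) = \<rho> (mp2_lift M) * f (cnj w) * inverse (S ^ n)"
      using nz \<rho>nz by (auto simp: field_simps)
    hence fM: "cnj (f (cnj (sl2z_act M w))) = cnj (\<rho> (mp2_lift M)) * cnj (f (cnj w)) * inverse (cnj S ^ n)"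
      by (simp add: sl2z_act_cnj)
    have jS: "autfac M w = cnj S ^ 2"
      using sqrt_autfac_square[of M "cnj w"] by (simp add: S_def autfac_cnj flip: complex_cnj_power)
    have "((\<lambda>w. X (sl2z_act M \<tau>) (sl2z_act M w)) has_field_derivative
       \<i> * ?D powr of_real (- \<kappa>) * cnj (f (cnj (sl2z_act M w))) * inverse ((autfac M w)\<^sup>2)) (at w)"
      by (rule DERIV_chain2[OF has_field_derivative_X[OF Mt Im_sl2z_act_neg[OF w]] has_field_derivative_sl2z_act[OF j]])
    from DERIV_diff[OF DERIV_cmult[OF this, of \<mu>] has_field_derivative_X[OF \<tau> w]]
    have "(?B has_field_derivative
       \<mu> * (\<i> * ?D powr of_real (- \<kappa>) * cnj (f (cnj (sl2z_act M w))) * inverse ((autfac M w)\<^sup>2))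
       - \<i> * (\<i> * (w - \<tau>)) powr of_real (- \<kappa>) * cnj (f (cnj w))) (at w)" .
    moreover have "\<mu> * (\<i> * ?D powr of_real (- \<kappa>) * cnj (f (cnj (sl2z_act M w))) * inverse ((autfac M w)\<^sup>2))
       = \<i> * (\<i> * (w - \<tau>)) powr of_real (- \<kappa>) * cnj (f (cnj w))"
    proof -
      have "\<mu> * (\<i> * ?D powr of_real (- \<kappa>) * cnj (f (cnj (sl2z_act M w))) * inverse ((autfac M w)\<^sup>2))
        = (inverse (cnj (\<rho> (mp2_lift M))) * cnj (\<rho> (mp2_lift M))) * (\<i> * cnj (f (cnj w)) *
           (inverse (s ^ N) * inverse (P ^ N) * (inverse (cnj S ^ n) * inverse (cnj S ^ 4))))"
        unfolding pw fM jS \<mu> s_def[symmetric] by (simp add: power_mult[symmetric] mult_ac)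
      also have "inverse (cnj (\<rho> (mp2_lift M))) * cnj (\<rho> (mp2_lift M)) = 1" using \<rho>nz by simp
      also have "inverse (cnj S ^ n) * inverse (cnj S ^ 4) = inverse (cnj S ^ N)"
        unfolding n by (simp add: power_add)
      \<comment> \<open>All three factors now carry the same exponent, so the relation
        \<open>PQ\<close> between the square roots applies to the whole product at once.\<close>
      also have "inverse (s ^ N) * inverse (P ^ N) * inverse (cnj S ^ N) = inverse ((P * (s * cnj S)) ^ N)"
        by (simp add: power_mult_distrib mult_ac)
      finally show ?thesis unfolding PQ pw by (simp add: mult_ac)
    qed
    ultimately have "(?B has_field_derivative 0) (at w)" by (simp only: diff_self)
    thus ?thesis by (rule has_field_derivative_at_within)
  qed
  moreover have "convex L" unfolding L_def by (rule convex_halfspace_Im_lt)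
  ultimately have "\<exists>c. \<forall>w\<in>L. \<mu> * X (sl2z_act M \<tau>) (sl2z_act M w) - X \<tau> w = c"
    by (intro has_field_derivative_zero_constant)
  thus ?thesis using w by (auto simp: L_def)
qed

lemma X_in_D_mod:
  assumes w: "Im w < 0"
  shows "abs_germ (\<lambda>\<tau>. c * X \<tau> w) \<in> D_mod \<kappa>'"
proof (rule D_modI)
  define S where "S = {\<tau>. \<i> * (w - \<tau>) \<notin> \<real>\<^sub>\<le>\<^sub>0}"
  show "open S" unfolding S_def by (rule open_slit_left)
  show "(\<lambda>\<tau>. c * X \<tau> w) holomorphic_on S"
    unfolding S_def by (intro holomorphic_intros X_holomorphic w)
  \<comment> \<open>The vertical ray below w lies in the half-strip of half-width |Re w| that begins
    at the height of w.\<close>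
  have "- {\<tau>. \<bar>Re \<tau>\<bar> \<le> \<bar>Re w\<bar> \<and> Im \<tau> \<le> - (- Im w)} \<subseteq> S"
    by (auto simp: S_def complex_nonpos_Reals_iff)
  thus "excised_nbhd {None} (Some ` S)"
    using w by (intro excised_nbhd_mono[OF excised_nbhd_compl_lower_strip[of "- Im w" "\<bar>Re w\<bar>"]] image_mono) auto
qed (auto simp: P1Q_def)

end

section \<open>The slash operator on functions, and the theorem\<close>

lemma mp2_lift_one: "mp2_lift 1 = 1"
proof -
  have "sqrt_autfac 1 = (\<lambda>_. 1)" by (rule ext) (simp add: sqrt_autfac_def)
  thus ?thesis by (simp add: mp2_rep_inject[symmetric] mp2_lift.rep_eq one_mp2.rep_eq)
qed

lemma slash_one:
  assumes "unitary_character \<rho>" shows "slash \<kappa> \<rho> h 1 \<tau> = h \<tau>"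
proof -
  have "\<rho> 1 * \<rho> 1 = \<rho> 1" "\<rho> 1 \<noteq> 0"
    using assms unfolding unitary_character_def by (metis mult_1_left, metis norm_zero zero_neq_one)
  hence "\<rho> 1 = 1" by simp
  thus ?thesis by (simp add: slash_def mp2_lift_one sqrt_autfac_def sl2z_act_def autfac_def)
qed

text \<open>\<open>mp2_lift\<close> is not a homomorphism, since the square roots multiply only up
  to sign. The product of two lifts is used as an element of the metaplectic group, and the
  condition on \<open>mp2_Z\<close> ensures that the slash operator sees only its matrix.\<close>

lemma slash_mult:
  assumes \<rho>: "unitary_character \<rho>" "\<rho> mp2_Z = (-1) powi \<lfloor>2 * \<kappa>\<rfloor>" and \<tau>: "\<tau> \<in> upper_half"
  shows "slash \<kappa> \<rho> (slash \<kappa> \<rho> h M) N \<tau> = slash \<kappa> \<rho> h (M * N) \<tau>"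
proof -
  have "mp2_fun (mp2_lift M * mp2_lift N) \<tau> = sqrt_autfac M (sl2z_act N \<tau>) * sqrt_autfac N \<tau>"
    using \<tau> sl2z_act_upper[OF \<tau>, of N]
    by (simp add: mp2_fun_def times_mp2.rep_eq mp2_lift.rep_eq res_upper_def)
  moreover have "autfac N \<tau> \<noteq> 0" using \<tau> autfac_nonzero[of \<tau> N] by (simp add: upper_half_def)
  hence "sl2z_act (M * N) \<tau> = sl2z_act M (sl2z_act N \<tau>)" by (rule sl2z_act_mult)
  moreover have "\<rho> (mp2_lift M * mp2_lift N) = \<rho> (mp2_lift M) * \<rho> (mp2_lift N)"
    using \<rho>(1) by (simp add: unitary_character_def)
  ultimately have "slash_mp \<kappa> \<rho> h (mp2_lift M * mp2_lift N) \<tau> = slash \<kappa> \<rho> (slash \<kappa> \<rho> h M) N \<tau>"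
    by (simp add: slash_mp_def slash_def power_int_mult_distrib mult_ac)
  thus ?thesis using slash_mp_eq_slash[OF \<rho> \<tau>, of h "mp2_lift M * mp2_lift N"] by simp
qed

lemma slash_T:
  "slash \<kappa> \<rho> h sl2z_T \<tau> = inverse (\<rho> (mp2_lift sl2z_T)) * h (\<tau> + 1)"
  by (simp add: slash_def sqrt_autfac_def sl2z_act_def autfac_def)

lemma modular_periodic:
  assumes "modular \<kappa> \<rho> h" "\<rho> (mp2_lift sl2z_T) \<noteq> 0" "\<tau> \<in> upper_half"
  shows "h (\<tau> + 1) = \<rho> (mp2_lift sl2z_T) * h \<tau>"
proof -
  have "slash \<kappa> \<rho> h sl2z_T \<tau> = h \<tau>" using assms by (simp add: modular_def)
  thus ?thesis using assms(2) unfolding slash_T by (simp add: field_simps)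
qed

lemma slash_cong:
  "(\<And>\<tau>. \<tau> \<in> upper_half \<Longrightarrow> g \<tau> = h \<tau>) \<Longrightarrow> \<tau> \<in> upper_half \<Longrightarrow> slash \<kappa> \<rho> g M \<tau> = slash \<kappa> \<rho> h M \<tau>"
  by (simp add: slash_def sl2z_act_upper)

lemma eichler_integral_exists:
  assumes \<kappa>: "\<kappa> > 1" and f: "f holomorphic_on upper_half" "exp_growth f"
    and per: "\<And>\<tau>. \<tau> \<in> upper_half \<Longrightarrow> f (\<tau> + 1) = \<eta> * f \<tau>" "norm \<eta> = 1"
  shows "\<exists>T \<beta> a m0. eichler_integral \<kappa> T \<beta> a m0 f \<and> e_fun m0 1 = \<eta>"
proof -
  obtain a m0 where a: "e_fun m0 1 = \<eta>" "\<forall>\<tau>\<in>upper_half.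
    summable (\<lambda>j. norm (a j * e_fun (m0 + real j) \<tau>)) \<and> (\<lambda>j. a j * e_fun (m0 + real j) \<tau>) sums f \<tau>"
    using fourier_expansion[OF f(1) per f(2)] by auto
  obtain T \<beta> where "\<And>n. is_fourier_primitive \<kappa> n (T n) (\<beta> n)" using fourier_primitive[OF \<kappa>] by metis
  hence "eichler_integral \<kappa> T \<beta> a m0 f" by unfold_locales (use \<kappa> f a in auto)
  thus ?thesis using a(1) by blast
qed

theorem theorem5p5:
  fixes k :: real and \<rho> :: "mp2 \<Rightarrow> complex" and f F :: "complex \<Rightarrow> complex"
  assumes "\<exists>n::nat. k = - real n / 2"
    and "unitary_character \<rho>" and "factors_through_finite_quotient \<rho>"
    and "\<rho> mp2_Z = (-1) powi \<lfloor>2 * k\<rfloor>"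
    and "f \<in> weakly_holomorphic k \<rho>"
    and "F \<in> harmonic_maass (2 - k) (\<lambda>x. cnj (\<rho> x))"
    and "\<forall>\<tau>\<in>upper_half. xi (2 - k) F \<tau> = f \<tau>"
  shows "(\<forall>M. \<exists>!\<gamma>. \<gamma> \<in> D_mod (2 - k) \<and>
             (\<forall>\<tau>\<in>upper_half. germ_upper \<gamma> \<tau> = sigma_fun k \<rho> F M \<tau>)) \<and>
         sigma_cocycle k \<rho> F \<in> Z1_par (2 - k) (\<lambda>x. cnj (\<rho> x)) \<and>
         cohomologous (2 - k) (\<lambda>x. cnj (\<rho> x)) `` {sigma_cocycle k \<rho> F} \<in> H1_par (2 - k) (\<lambda>x. cnj (\<rho> x))"
proof -
  obtain n :: nat where n: "k = - real n / 2" using assms(1) by blast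
  define \<kappa> where "\<kappa> = 2 - k"
  define \<rho>' where "\<rho>' = (\<lambda>x. cnj (\<rho> x))"
  \<comment> \<open>From k = -n/2 one gets 2\<kappa> = 4 - 2k = n + 4.\<close>
  define N where "N = n + 4"
  have weight: "\<kappa> > 1" "\<kappa> = real N / 2" "k = 2 - \<kappa>" by (simp_all add: \<kappa>_def n N_def add_divide_distrib)
  have \<rho>': "unitary_character \<rho>'" using assms(2) by (simp add: unitary_character_def \<rho>'_def)
  \<comment> \<open>The integers 2k = -n and 2\<kappa> = n + 4 have the same parity, and the sign is
    real, so conjugation of \<rho> preserves the condition.\<close>
  have \<rho>'Z: "\<rho>' mp2_Z = (-1) powi \<lfloor>2 * \<kappa>\<rfloor>"
  proof -
    have k2: "2 * k = of_int (- int n)" "2 * \<kappa> = of_int (4 + int n)" by (simp_all add: \<kappa>_def n)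
    have "\<lfloor>2 * k\<rfloor> = - int n" "\<lfloor>2 * \<kappa>\<rfloor> = 4 + int n" unfolding k2 floor_of_int by simp_all
    thus ?thesis using assms(4) by (simp add: \<rho>'_def power_int_add power_int_minus flip: power_inverse)
  qed
  have f: "f holomorphic_on upper_half" "modular k \<rho> f" "exp_growth f"
    using assms(5) by (simp_all add: weakly_holomorphic_def)
  have F: "C2_on upper_half F" "modular \<kappa> \<rho>' F" "exp_growth F"
    using assms(6) by (simp_all add: harmonic_maass_def \<kappa>_def \<rho>'_def)
  have Fd: "F differentiable (at \<tau>)" if "\<tau> \<in> upper_half" for \<tau>
    using F(1) that by (simp add: C2_on_def C1_on_def)
  have xi: "xi \<kappa> F \<tau> = f \<tau>" if "\<tau> \<in> upper_half" for \<tau> using assms(7) that by (simp add: \<kappa>_def)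
  have unit: "norm (\<rho> x) = 1" "norm (\<rho>' x) = 1" "\<rho> x \<noteq> 0" "\<rho>' x \<noteq> 0" for x
  proof -
    show 1: "norm (\<rho> x) = 1" "norm (\<rho>' x) = 1" using assms(2) \<rho>' by (auto simp: unitary_character_def)
    show "\<rho> x \<noteq> 0" "\<rho>' x \<noteq> 0" using 1 by auto
  qed
  obtain T \<beta> a m0 where E: "eichler_integral \<kappa> T \<beta> a m0 f" "e_fun m0 1 = \<rho> (mp2_lift sl2z_T)"
    using eichler_integral_exists[OF weight(1) f(1,3) modular_periodic[OF f(2) unit(3)] unit(1)] by blast
  interpret eichler_integral \<kappa> T \<beta> a m0 f by (rule E(1))
  define Fp where "Fp = maass_plus \<kappa> \<rho>' F"
  define s where "s = complex_of_real (2 powr (\<kappa> - 1))"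
  have Fp: "Fp \<tau> = F \<tau> - s * X \<tau> (cnj \<tau>)" if "\<tau> \<in> upper_half" for \<tau>
  proof -
    have "e_fun m0 1 = cnj (\<rho>' (mp2_lift sl2z_T))" using E(2) by (simp add: \<rho>'_def)
    from maass_expansion_exists[where F = F and \<rho>' = \<rho>', OF Fd xi modular_periodic[OF F(2) unit(4)] this unit(2) F(3)]
    obtain cp cm where c: "maass_expansion \<kappa> \<rho>' F cp cm"
      "\<forall>\<tau>\<in>upper_half. ((\<lambda>n. cp n * e_fun n \<tau>) has_sum (F \<tau> - of_real (2 powr (\<kappa> - 1)) * X \<tau> (cnj \<tau>))) (fourier_index \<rho>')"
      by blast
    show ?thesis
      unfolding Fp_def s_def by (rule maass_plus_eq[OF weight(1) c(1)]) (use c(2) that in blast)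
  qed
  define C where "C = (- 2 * \<i>) powr of_real (k + 1) * of_real pi"
  have sigma: "sigma_fun k \<rho> F M \<tau> = C * (slash \<kappa> \<rho>' Fp M \<tau> - Fp \<tau>)" for M \<tau>
    unfolding sigma_fun_def Let_def \<kappa>_def[symmetric] \<rho>'_def[symmetric] Fp_def[symmetric] slash_one[OF \<rho>'] C_def ..
  define \<gamma> where "\<gamma> w = abs_germ (\<lambda>\<tau>. (- C * s) * X \<tau> w)" for w
  \<comment> \<open>The candidate germ. The base point of the first term moves with M; with a fixed
    base point the same expression would be a coboundary. The matrix keeps the image of -\<i> in the
    lower half-plane, so both terms lie in the module.\<close>
  define \<sigma> where "\<sigma> M = germ_slash \<kappa> \<rho>' (\<gamma> (sl2z_act M (- \<i>))) M - \<gamma> (- \<i>)" for M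
  have mem: "\<sigma> M \<in> D_mod \<kappa>" for M
    unfolding \<sigma>_def \<gamma>_def
    by (intro D_mod_diff D_mod_slash X_in_D_mod Im_sl2z_act_neg) auto
  have val: "germ_upper (\<sigma> M) \<tau> = sigma_fun k \<rho> F M \<tau>" if \<tau>: "\<tau> \<in> upper_half" for M \<tau>
  proof -
    define \<mu> where "\<mu> = sqrt_autfac M \<tau> powi (- \<lfloor>2 * \<kappa>\<rfloor>) * inverse (\<rho>' (mp2_lift M))"
    have sl: "slash \<kappa> \<rho>' h M \<tau> = \<mu> * h (sl2z_act M \<tau>)" for h by (simp add: slash_def \<mu>_def)
    have Mt: "sl2z_act M \<tau> \<in> upper_half" by (rule sl2z_act_upper[OF \<tau>])
    \<comment> \<open>Independence of the base point holds for each fixed \<tau>, so the second base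
      point may be \<open>cnj \<tau>\<close>. This exchanges an expression that is not visibly
      holomorphic for one that continues holomorphically.\<close>
    have "\<mu> * X (sl2z_act M \<tau>) (sl2z_act M (- \<i>)) - X \<tau> (- \<i>) = \<mu> * X (sl2z_act M \<tau>) (sl2z_act M (cnj \<tau>)) - X \<tau> (cnj \<tau>)"
      unfolding \<mu>_def \<rho>'_def
      by (rule slash_X_difference[OF _ weight(2) assms(2)]) (use f(2) \<tau> weight(3) in \<open>auto simp: N_def upper_half_def\<close>)
    hence X: "\<mu> * X (sl2z_act M \<tau>) (sl2z_act M (- \<i>)) - X \<tau> (- \<i>) = \<mu> * X (sl2z_act M \<tau>) (cnj (sl2z_act M \<tau>)) - X \<tau> (cnj \<tau>)"
      by (simp only: sl2z_act_cnj)
    have "\<mu> * F (sl2z_act M \<tau>) = F \<tau>"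
      using F(2) \<tau> unfolding modular_def sl[symmetric] by blast
    \<comment> \<open>Invariance of \<open>F\<close> cancels its two contributions, so only the
      diagonal values of \<open>X\<close> remain, with the opposite sign.\<close>
    hence "sigma_fun k \<rho> F M \<tau> = - C * s * (\<mu> * X (sl2z_act M \<tau>) (cnj (sl2z_act M \<tau>)) - X \<tau> (cnj \<tau>))"
      unfolding sigma sl Fp[OF \<tau>] Fp[OF Mt] by (simp add: algebra_simps)
    also have "\<dots> = - C * s * (\<mu> * X (sl2z_act M \<tau>) (sl2z_act M (- \<i>)) - X \<tau> (- \<i>))"
      unfolding X ..
    also have "\<dots> = germ_upper (\<sigma> M) \<tau>"
      unfolding \<sigma>_def germ_upper_diff germ_upper_slash[OF \<tau>] sl \<gamma>_def germ_upper_abs_germ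
      using \<tau> Mt by (simp add: res_upper_def algebra_simps)
    finally show ?thesis ..
  qed
  have ex1: "\<exists>!\<gamma>. \<gamma> \<in> D_mod \<kappa> \<and> (\<forall>\<tau>\<in>upper_half. germ_upper \<gamma> \<tau> = sigma_fun k \<rho> F M \<tau>)" for M
  proof (rule ex1I[of _ "\<sigma> M"])
    show "\<sigma> M \<in> D_mod \<kappa> \<and> (\<forall>\<tau>\<in>upper_half. germ_upper (\<sigma> M) \<tau> = sigma_fun k \<rho> F M \<tau>)"
      using mem val by blast
    fix \<gamma> assume "\<gamma> \<in> D_mod \<kappa> \<and> (\<forall>\<tau>\<in>upper_half. germ_upper \<gamma> \<tau> = sigma_fun k \<rho> F M \<tau>)"
    thus "\<gamma> = \<sigma> M" using mem val by (intro D_mod_eqI[of _ \<kappa> _ \<kappa>]) auto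
  qed
  have cocycle: "sigma_cocycle k \<rho> F = \<sigma>"
    unfolding sigma_cocycle_def \<kappa>_def[symmetric]
    by (intro ext the1_equality[OF ex1]) (use mem val in blast)
  have "\<sigma> (M * K) = germ_slash \<kappa> \<rho>' (\<sigma> M) K + \<sigma> K" for M K
  proof (rule D_mod_eqI)
    show "\<sigma> (M * K) \<in> D_mod \<kappa>" "germ_slash \<kappa> \<rho>' (\<sigma> M) K + \<sigma> K \<in> D_mod \<kappa>"
      by (intro mem D_mod_add D_mod_slash)+
    fix \<tau> assume \<tau>: "\<tau> \<in> upper_half"
    \<comment> \<open>On the upper half-plane the values of \<sigma> have the coboundary form of the
      function \<open>Fp\<close>, which itself need not come from the module; the relation then
      follows from the action property and linearity of the slash operator.\<close>
    have "slash \<kappa> \<rho>' (germ_upper (\<sigma> M)) K \<tau> = slash \<kappa> \<rho>' (\<lambda>\<tau>. C * (slash \<kappa> \<rho>' Fp M \<tau> - Fp \<tau>)) K \<tau>"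
      by (rule slash_cong[OF _ \<tau>]) (simp add: val sigma)
    also have "\<dots> = C * (slash \<kappa> \<rho>' (slash \<kappa> \<rho>' Fp M) K \<tau> - slash \<kappa> \<rho>' Fp K \<tau>)"
      by (simp add: slash_def[of _ _ _ K] algebra_simps)
    also have "slash \<kappa> \<rho>' (slash \<kappa> \<rho>' Fp M) K \<tau> = slash \<kappa> \<rho>' Fp (M * K) \<tau>"
      by (rule slash_mult[OF \<rho>' \<rho>'Z \<tau>])
    finally show "germ_upper (\<sigma> (M * K)) \<tau> = germ_upper (germ_slash \<kappa> \<rho>' (\<sigma> M) K + \<sigma> K) \<tau>"
      unfolding germ_upper_add germ_upper_slash[OF \<tau>] val[OF \<tau>] sigma by (simp add: algebra_simps)
  qed
  moreover have "\<sigma> sl2z_T = germ_slash_diff \<kappa> \<rho>' 0 sl2z_T"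
  proof (rule D_mod_eqI)
    show "\<sigma> sl2z_T \<in> D_mod \<kappa>" "germ_slash_diff \<kappa> \<rho>' 0 sl2z_T \<in> D_mod \<kappa>"
      unfolding germ_slash_diff_def by (intro mem D_mod_diff D_mod_slash zero_in_D_mod)+
    fix \<tau> assume \<tau>: "\<tau> \<in> upper_half"
    have "Fp (\<tau> + 1) = \<rho>' (mp2_lift sl2z_T) * Fp \<tau>"
    proof -
      have "\<tau> + 1 \<in> upper_half" using \<tau> by (simp add: upper_half_def)
      hence "Fp (\<tau> + 1) = F (\<tau> + 1) - s * X (\<tau> + 1) (cnj (\<tau> + 1))" by (rule Fp)
      also have "X (\<tau> + 1) (cnj (\<tau> + 1)) = \<rho>' (mp2_lift sl2z_T) * X \<tau> (cnj \<tau>)"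
        by (rule X_periodic[OF \<tau>]) (use E(2) in \<open>simp add: \<rho>'_def\<close>)
      also have "F (\<tau> + 1) = \<rho>' (mp2_lift sl2z_T) * F \<tau>"
        by (rule modular_periodic[OF F(2) unit(4) \<tau>])
      finally show ?thesis unfolding Fp[OF \<tau>] by (simp add: algebra_simps)
    qed
    hence "sigma_fun k \<rho> F sl2z_T \<tau> = 0" unfolding sigma slash_T using unit(4) by simp
    thus "germ_upper (\<sigma> sl2z_T) \<tau> = germ_upper (germ_slash_diff \<kappa> \<rho>' 0 sl2z_T) \<tau>"
      unfolding germ_slash_diff_def germ_upper_diff germ_upper_slash[OF \<tau>] val[OF \<tau>]
      by (simp add: slash_def germ_upper_zero)
  qed
  ultimately have Z: "sigma_cocycle k \<rho> F \<in> Z1_par \<kappa> \<rho>'"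
    unfolding cocycle Z1_par_def using mem zero_in_D_mod by blast
  hence "cohomologous \<kappa> \<rho>' `` {sigma_cocycle k \<rho> F} \<in> H1_par \<kappa> \<rho>'"
    unfolding H1_par_def by (rule quotientI)
  with ex1 Z show ?thesis unfolding \<kappa>_def \<rho>'_def by blast
qed

end
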